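(* Let $(\Omega,\mathcal F,\mathbb P)$ be a complete probability space with a filtration $(\mathcal F_n)_{n\ge0}$ such that $\mathcal F=\sigma(\bigcup_n\mathcal F_n)$ and every $\mathcal F_n$ is generated by countably many atoms. Let $p(\cdot):\Omega\to(0,\infty)$ be measurable with $0<p_-\le p_+<\infty$, assume there is a constant $K\ge1$ such that $\mathbb P(A)^{p_-(A)-p_+(A)}\le K$ for every atom $A$ of every $\mathcal F_n$, and let $0<q\le\infty$. Then the following inequalities hold for all martingales $f$ in the space on the right-hand side, with a constant $C$ independent of $f$: (1) $\|f\|_{H^M_{p(\cdot),q}}\le C\|f\|_{H^s_{p(\cdot),q}}$ and $\|f\|_{H^S_{p(\cdot),q}}\le C\|f\|_{H^s_{p(\cdot),q}}$, if $0<p_-\le p_+<2$; (2) $\|f\|_{H^M_{p(\cdot),q}}\le\|f\|_{P_{p(\cdot),q}}$ and $\|f\|_{H^S_{p(\cdot),q}}\le\|f\|_{Q_{p(\cdot),q}}$; (3) $\|f\|_{H^S_{p(\cdot),q}}\le C\|f\|_{P_{p(\cdot),q}}$ and $\|f\|_{H^M_{p(\cdot),q}}\le C\|f\|_{Q_{p(\cdot),q}}$; (4) $\|f\|_{H^s_{p(\cdot),q}}\le C\|f\|_{P_{p(\cdot),q}}$ and $\|f\|_{H^s_{p(\cdot),q}}\le C\|f\|_{Q_{p(\cdot),q}}$; (5) $\|f\|_{P_{p(\cdot),q}}\le C\|f\|_{Q_{p(\cdot),q}}$ and $\|f\|_{Q_{p(\cdot),q}}\le C\|f\|_{P_{p(\cdot),q}}$.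 Moreover, if $(\mathcal F_n)_{n\ge0}$ is regular, then $$H^S_{p(\cdot),q}=Q_{p(\cdot),q}=P_{p(\cdot),q}=H^M_{p(\cdot),q}=H^s_{p(\cdot),q}$$ with equivalent quasi-norms.
   Context: For measurable $A$, $p_-(A)=\operatorname{ess\,inf}_Ap$, $p_+(A)=\operatorname{ess\,sup}_Ap$; $p_\pm=p_\pm(\Omega)$; $\|f\|_{p(\cdot)}=\inf\{\lambda>0:\int_\Omega(|f|/\lambda)^{p(x)}d\mathbb P\le1\}$. Variable Lorentz quasi-norm: $\|f\|_{L_{p(\cdot),q}}=\left(\int_0^\infty\lambda^q\|\chi_{\{|f|>\lambda\}}\|_{p(\cdot)}^q\frac{d\lambda}{\lambda}\right)^{1/q}$ for $q<\infty$, $\|f\|_{L_{p(\cdot),\infty}}=\sup_{\lambda>0}\lambda\|\chi_{\{|f|>\lambda\}}\|_{p(\cdot)}$; $L_{p(\cdot),q}$ is the space where this is finite. $B\in\mathcal F_n$ (of positive measure) is an atom of $\mathcal F_n$ if every $A\subset B$, $A\in\mathcal F_n$ with $\mathbb P(A)<\mathbb P(B)$ has $\mathbb P(A)=0$. $(\mathcal F_n)$ is regular if there is $R>0$ such that for all $n\ge1$ and $A\in\mathcal F_n$ there is $B\in\mathcal F_{n-1}$ with $A\subset B$ and $\mathbb P(B)\le R\,\mathbb P(A)$. Martingales $f=(f_n)_{n\ge0}$ are with respect to $(\mathcal F_n)$; $f_{-1}=0$, $d_nf=f_n-f_{n-1}$, $\mathbb E_n=\mathbb E(\cdot|\mathcal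 F_n)$, $\mathbb E_{-1}:=\mathbb E_0$. $M(f)=\sup_n|f_n|$, $S_n(f)=(\sum_{k=0}^n|d_kf|^2)^{1/2}$, $S(f)=\lim_nS_n(f)$, $s(f)=(\sum_{n\ge0}\mathbb E_{n-1}|d_nf|^2)^{1/2}$. $H^M_{p(\cdot),q}$, $H^S_{p(\cdot),q}$, $H^s_{p(\cdot),q}$ are the spaces of martingales for which $\|M(f)\|_{L_{p(\cdot),q}}$, $\|S(f)\|_{L_{p(\cdot),q}}$, $\|s(f)\|_{L_{p(\cdot),q}}$, respectively, is finite, with that quantity as quasi-norm. $\Lambda$ is the set of non-decreasing, non-negative, adapted sequences $(\lambda_n)_{n\ge0}$, with $\lambda_\infty=\lim\lambda_n$. $Q_{p(\cdot),q}$ (resp. $P_{p(\cdot),q}$) is the set of martingales $f$ for which there is $(\lambda_n)\in\Lambda$ with $\lambda_\infty\in L_{p(\cdot),q}$ and $S_n(f)\le\lambda_{n-1}$ (resp. $|f_n|\le\lambda_{n-1}$) for all $n\ge1$; the quasi-norm is the infimum of $\|\lambda_\infty\|_{L_{p(\cdot),q}}$ over all such $(\lambda_n)$. *)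

theory Defs
  imports "HOL-Probability.Probability"
begin

section \<open>Essential bounds, variable Lebesgue and Lorentz quasi-norms\<close>

definition p_plus :: "'a measure \<Rightarrow> ('a \<Rightarrow> real) \<Rightarrow> 'a set \<Rightarrow> ereal" where
  "p_plus M p A = esssup (restrict_space M A) (\<lambda>x. ereal (p x))"

text \<open>There is no essential infimum in the library; it is minus the essential supremum of \<open>-p\<close>.\<close>

definition p_minus :: "'a measure \<Rightarrow> ('a \<Rightarrow> real) \<Rightarrow> 'a set \<Rightarrow> ereal" where
  "p_minus M p A = - esssup (restrict_space M A) (\<lambda>x. - ereal (p x))"

definition var_norm :: "'a measure \<Rightarrow> ('a \<Rightarrow> real) \<Rightarrow> ('a \<Rightarrow> real) \<Rightarrow> ennreal" where
  "var_norm M p f =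
     Inf {ennreal l | l. 0 < l \<and> (\<integral>\<^sup>+x. ennreal ((\<bar>f x\<bar> / l) powr p x) \<partial>M) \<le> 1}"

text \<open>Powers of extended non-negative reals; only exponents \<open>r > 0\<close> are used, so
  \<open>\<infinity>\<close> is sent to \<open>\<infinity>\<close> and \<open>0\<close> to \<open>0\<close>.\<close>

definition epowr :: "ennreal \<Rightarrow> real \<Rightarrow> ennreal" where
  "epowr x r = (if x = \<infinity> then \<infinity> else ennreal (enn2real x powr r))"

text \<open>The functions measured below, such as maximal functions and square functions, may take the
  value \<open>\<infinity>\<close>, so the Lorentz quasi-norm is defined for \<open>[0,\<infinity>]\<close>-valued functions.\<close>

definition level_norm :: "'a measure \<Rightarrow> ('a \<Rightarrow> real) \<Rightarrow> ('a \<Rightarrow> ennreal) \<Rightarrow> real \<Rightarrow> ennreal" where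
  "level_norm M p g t = var_norm M p (indicator {x \<in> space M. ennreal t < g x})"

definition lorentz_norm ::
    "'a measure \<Rightarrow> ('a \<Rightarrow> real) \<Rightarrow> ennreal \<Rightarrow> ('a \<Rightarrow> ennreal) \<Rightarrow> ennreal" where
  "lorentz_norm M p q g =
     (if q = \<infinity> then SUP t\<in>{0<..}. ennreal t * level_norm M p g t
      else epowr (\<integral>\<^sup>+t\<in>{0<..}. ennreal (t powr enn2real q)
                      * epowr (level_norm M p g t) (enn2real q) * ennreal (1 / t) \<partial>lborel)
                 (1 / enn2real q))"

section \<open>Filtrations\<close>

definition is_atom :: "'a measure \<Rightarrow> 'a measure \<Rightarrow> 'a set \<Rightarrow> bool" where
  "is_atom M G B \<longleftrightarrow> B \<in> sets G \<and> 0 < measure M B \<and>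
     (\<forall>A\<in>sets G. A \<subseteq> B \<and> measure M A < measure M B \<longrightarrow> measure M A = 0)"

definition generated_by_countably_many_atoms :: "'a measure \<Rightarrow> 'a measure \<Rightarrow> bool" where
  "generated_by_countably_many_atoms M G \<longleftrightarrow>
     (\<exists>\<A>. countable \<A> \<and> (\<forall>A\<in>\<A>. is_atom M G A) \<and> sets G = sigma_sets (space M) \<A>)"

text \<open>As usual in a complete probability space, the \<open>\<sigma>\<close>-algebra generated by the filtration is
  understood to contain the null sets.  Otherwise already the dyadic filtration of \<open>[0,1)\<close>,
  with Lebesgue measure, would be excluded.\<close>

definition filtration_generates :: "'a measure \<Rightarrow> (nat \<Rightarrow> 'a measure) \<Rightarrow> bool" where
  "filtration_generates M F \<longleftrightarrow>
     sets M = sigma_sets (space M) ((\<Union>n. sets (F n)) \<union> null_sets M)"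

text \<open>The condition without null sets is a special case.\<close>

lemma filtration_generatesI:
  assumes "sets M = sigma_sets (space M) (\<Union>n. sets (F n))"
  shows "filtration_generates M F"
proof -
  have "(\<Union>n. sets (F n)) \<union> null_sets M \<subseteq> sets M"
    using assms by (auto intro: sigma_sets.Basic)
  then have "sigma_sets (space M) ((\<Union>n. sets (F n)) \<union> null_sets M) \<subseteq> sets M"
    by (rule sets.sigma_sets_subset)
  moreover have "sets M \<subseteq> sigma_sets (space M) ((\<Union>n. sets (F n)) \<union> null_sets M)"
    by (subst assms, rule sigma_sets_mono') auto
  ultimately show ?thesis
    by (simp add: filtration_generates_def)
qed

definition regular_filtration :: "'a measure \<Rightarrow> (nat \<Rightarrow> 'a measure) \<Rightarrow> bool" where
  "regular_filtration M F \<longleftrightarrow>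
     (\<exists>R>0. \<forall>n\<ge>1. \<forall>A\<in>sets (F n). \<exists>B\<in>sets (F (n - 1)).
        A \<subseteq> B \<and> measure M B \<le> R * measure M A)"

section \<open>Martingales and their operators\<close>

definition martingale :: "'a measure \<Rightarrow> (nat \<Rightarrow> 'a measure) \<Rightarrow> (nat \<Rightarrow> 'a \<Rightarrow> real) \<Rightarrow> bool" where
  "martingale M F f \<longleftrightarrow>
     (\<forall>n. f n \<in> borel_measurable (F n) \<and> integrable M (f n)) \<and>
     (\<forall>m n. m \<le> n \<longrightarrow> (AE x in M. real_cond_exp M (F m) (f n) x = f m x))"

definition mdiff :: "(nat \<Rightarrow> 'a \<Rightarrow> real) \<Rightarrow> nat \<Rightarrow> 'a \<Rightarrow> real" where
  "mdiff f n x = (if n = 0 then f 0 x else f n x - f (n - 1) x)"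

definition maximal_fn :: "(nat \<Rightarrow> 'a \<Rightarrow> real) \<Rightarrow> 'a \<Rightarrow> ennreal" where
  "maximal_fn f x = (SUP n. ennreal \<bar>f n x\<bar>)"

definition square_fn_upto :: "(nat \<Rightarrow> 'a \<Rightarrow> real) \<Rightarrow> nat \<Rightarrow> 'a \<Rightarrow> real" where
  "square_fn_upto f n x = sqrt (\<Sum>k\<le>n. \<bar>mdiff f k x\<bar>\<^sup>2)"

definition square_fn :: "(nat \<Rightarrow> 'a \<Rightarrow> real) \<Rightarrow> 'a \<Rightarrow> ennreal" where
  "square_fn f x = lim (\<lambda>n. ennreal (square_fn_upto f n x))"

text \<open>The differences need not be square integrable, so the conditional expectation of
  \<open>\<bar>d\<^sub>n f\<bar>\<^sup>2\<close> is the \<open>[0,\<infinity>]\<close>-valued one.  Truncated subtraction gives the convention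
  \<open>E\<^sub>-\<^sub>1 = E\<^sub>0\<close> for the term \<open>n = 0\<close>.\<close>

definition cond_square_fn ::
    "'a measure \<Rightarrow> (nat \<Rightarrow> 'a measure) \<Rightarrow> (nat \<Rightarrow> 'a \<Rightarrow> real) \<Rightarrow> 'a \<Rightarrow> ennreal" where
  "cond_square_fn M F f x =
     epowr (\<Sum>n. nn_cond_exp M (F (n - 1)) (\<lambda>y. ennreal (\<bar>mdiff f n y\<bar>\<^sup>2)) x) (1 / 2)"

section \<open>Martingale Hardy-Lorentz spaces with variable exponents\<close>

definition HM_norm where "HM_norm M p q f = lorentz_norm M p q (maximal_fn f)"
definition HS_norm where "HS_norm M p q f = lorentz_norm M p q (square_fn f)"
definition Hs_norm where "Hs_norm M F p q f = lorentz_norm M p q (cond_square_fn M F f)"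

definition HM_space where "HM_space M F p q = {f. martingale M F f \<and> HM_norm M p q f < \<infinity>}"
definition HS_space where "HS_space M F p q = {f. martingale M F f \<and> HS_norm M p q f < \<infinity>}"
definition Hs_space where "Hs_space M F p q = {f. martingale M F f \<and> Hs_norm M F p q f < \<infinity>}"

definition control_seqs :: "'a measure \<Rightarrow> (nat \<Rightarrow> 'a measure) \<Rightarrow> (nat \<Rightarrow> 'a \<Rightarrow> real) set" where
  "control_seqs M F = {l. (\<forall>n. l n \<in> borel_measurable (F n)) \<and>
     (\<forall>n. \<forall>x\<in>space M. 0 \<le> l n x) \<and> (\<forall>n. \<forall>x\<in>space M. l n x \<le> l (Suc n) x)}"

definition control_limit :: "(nat \<Rightarrow> 'a \<Rightarrow> real) \<Rightarrow> 'a \<Rightarrow> ennreal" where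
  "control_limit l x = lim (\<lambda>n. ennreal (l n x))"

definition Q_controls where
  "Q_controls M F p q f = {l \<in> control_seqs M F. lorentz_norm M p q (control_limit l) < \<infinity> \<and>
     (\<forall>n\<ge>1. AE x in M. square_fn_upto f n x \<le> l (n - 1) x)}"

definition P_controls where
  "P_controls M F p q f = {l \<in> control_seqs M F. lorentz_norm M p q (control_limit l) < \<infinity> \<and>
     (\<forall>n\<ge>1. AE x in M. \<bar>f n x\<bar> \<le> l (n - 1) x)}"

definition Q_space where "Q_space M F p q = {f. martingale M F f \<and> Q_controls M F p q f \<noteq> {}}"
definition P_space where "P_space M F p q = {f. martingale M F f \<and> P_controls M F p q f \<noteq> {}}"

definition Q_norm where
  "Q_norm M F p q f = (INF l\<in>Q_controls M F p q f. lorentz_norm M p q (control_limit l))"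

definition P_norm where
  "P_norm M F p q f = (INF l\<in>P_controls M F p q f. lorentz_norm M p q (control_limit l))"

definition equivalent_on :: "'b set \<Rightarrow> ('b \<Rightarrow> ennreal) \<Rightarrow> ('b \<Rightarrow> ennreal) \<Rightarrow> bool" where
  "equivalent_on X N N' \<longleftrightarrow>
     (\<exists>c>0. \<exists>C>0. \<forall>f\<in>X. ennreal c * N f \<le> N' f \<and> N' f \<le> ennreal C * N f)"

end

theory Submission
  imports Defs
begin

text \<open>
  Everything is reduced to estimates between the norms of level sets.  The essential bounds of \<open>p\<close>
  on the whole space are called \<open>a\<close> and \<open>b\<close>.

  The condition on \<open>p\<close> and the atoms enters once, in \<open>set_norm_comparison\<close>.  If an event \<open>G\<close> has
  modular at most \<open>1\<close> for some \<open>l \<le> 1\<close> and fills a fixed proportion of an atom, then \<open>l\<close> is bounded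
  below by a power of the measure of the atom, so \<open>l powr - p x\<close> is constant on that atom up to a
  factor.  Hence, if this holds on disjoint atoms \<open>A\<close>, of arbitrary levels, that cover \<open>E\<close>, a bound
  \<open>measure M (E \<inter> A) \<le> \<epsilon> * measure M A\<close> turns into a bound of the norm of \<open>E\<close> by that of
  \<open>G\<close>, with a factor of order \<open>\<epsilon> powr (1 / b)\<close> for small \<open>\<epsilon>\<close>.  On the other side,
  \<open>lorentz_norm_le_of_level_dominated\<close> turns a bound of the level of a function at \<open>t\<close> by the levels
  of another one at \<open>c * 2 powr - real j * t\<close>, with weights \<open>2 powr - (\<theta> * real j)\<close> and \<open>\<theta> > 1\<close>,
  into an inequality between Lorentz quasi-norms.

  A predictable control of \<open>f\<close> or of its square function bounds the jumps, and bounds the conditional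
  quadratic variation as long as the control is small (\<open>controlled\<close>).  With the weak type inequality
  for square integrable martingale differences this gives good-lambda inequalities for the maximal
  function, the square function and the conditional square function (\<open>good_lambda_gauge\<close>,
  \<open>good_lambda_cond_square\<close>).  Their iteration, \<open>level_dominated_of_good_lambda\<close>, does not need any
  of these functions to have finite norm, because the norms of sets are at most \<open>1\<close>.  The running
  maximum of one operator plus twice the control is then a control for that operator, so the two
  spaces of controlled martingales agree.

  For \<open>b < 2\<close> the conditional square function controls the others although it does not control the
  jumps: the differences are split into layers according to the size of the conditional square sum.
  On each layer the weak type inequality has order \<open>2\<close>, hence exponent \<open>2 / b > 1\<close> after the comparison,
  and the layers can be summed (\<open>level_dominated_cond_square\<close>).

  For a regular filtration an atom of level \<open>Suc n\<close> fills a fixed proportion of its parent.  The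
  predictable envelope of the maximal or square function therefore has comparable levels
  (\<open>level_norm_envelope\<close>), and the squared differences are at most a multiple of their conditional
  means (\<open>regular_jump\<close>).  Both yield controls.
\<close>

section \<open>Variable Lebesgue norms of sets\<close>

locale variable_exponent = prob_space M for M :: "'a measure" +
  fixes p :: "'a \<Rightarrow> real" and a b :: real
  assumes p_measurable [measurable]: "p \<in> borel_measurable M"
    and a_pos: "0 < a"
    and p_bounds: "AE x in M. a \<le> p x \<and> p x \<le> b"
begin

text \<open>The modular of the indicator function of \<open>E\<close> divided by \<open>l\<close>.\<close>

definition modular :: "real \<Rightarrow> 'a set \<Rightarrow> ennreal" where
  "modular l E = (\<integral>\<^sup>+x. ennreal (l powr - p x) * indicator E x \<partial>M)"

text \<open>The variable norm of an indicator function; the levels of the Lorentz quasi-norms are of this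
  form.\<close>

definition set_norm :: "'a set \<Rightarrow> ennreal" where
  "set_norm E = var_norm M p (indicator E)"

lemma a_le_b: "a \<le> b"
proof -
  have "AE x in M. a \<le> b"
    using p_bounds by eventually_elim auto
  then show ?thesis by simp
qed

lemma b_pos: "0 < b"
  using a_pos a_le_b by simp

lemma modular_var_norm:
  assumes "0 < l"
  shows "(\<integral>\<^sup>+x. ennreal ((\<bar>indicator E x\<bar> / l) powr p x) \<partial>M) = modular l E"
  unfolding modular_def
  by (rule nn_integral_cong)
    (use assms in \<open>auto simp: indicator_def powr_minus powr_divide divide_simps\<close>)

lemma set_norm_eq: "set_norm E = Inf {ennreal l | l. 0 < l \<and> modular l E \<le> 1}"
proof -
  have "{ennreal l | l. 0 < l \<and> (\<integral>\<^sup>+x. ennreal ((\<bar>indicator E x\<bar> / l) powr p x) \<partial>M) \<le> 1}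
      = {ennreal l | l. 0 < l \<and> modular l E \<le> 1}"
    using modular_var_norm[of _ E] by (intro Collect_cong ex_cong1) auto
  then show ?thesis
    unfolding set_norm_def var_norm_def by simp
qed

lemma level_norm_eq: "level_norm M p g t = set_norm {x \<in> space M. ennreal t < g x}"
  unfolding level_norm_def set_norm_def ..

lemma modular_mono_AE:
  assumes "AE x in M. x \<in> A \<longrightarrow> x \<in> B" "0 < l"
  shows "modular l A \<le> modular l B"
  unfolding modular_def
  by (rule nn_integral_mono_AE) (use assms in \<open>auto elim!: eventually_mono simp: indicator_def\<close>)

lemma modular_antimono:
  assumes "0 < l" "l \<le> m"
  shows "modular m E \<le> modular l E"
  unfolding modular_def
proof (rule nn_integral_mono_AE)
  show "AE x in M. ennreal (m powr - p x) * indicator E x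
      \<le> ennreal (l powr - p x) * indicator E x"
    using p_bounds
  proof eventually_elim
    case (elim x)
    then have "m powr - p x \<le> l powr - p x"
      using assms a_pos by (intro powr_mono2') auto
    then show ?case by (intro mult_right_mono ennreal_leI) auto
  qed
qed

lemma set_norm_le: "0 < l \<Longrightarrow> modular l E \<le> 1 \<Longrightarrow> set_norm E \<le> ennreal l"
  unfolding set_norm_eq by (intro Inf_lower) auto

lemma set_norm_less:
  assumes "set_norm E < ennreal l"
  shows "0 < l" "modular l E \<le> 1"
proof -
  obtain m where m: "0 < m" "modular m E \<le> 1" "ennreal m < ennreal l"
    using assms unfolding set_norm_eq Inf_less_iff by auto
  then have "m < l" by (metis ennreal_leI not_le)
  then show "0 < l" "modular l E \<le> 1"
    using m modular_antimono[of m l E] by auto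
qed

lemma set_norm_mono_AE:
  assumes "AE x in M. x \<in> A \<longrightarrow> x \<in> B"
  shows "set_norm A \<le> set_norm B"
  unfolding set_norm_eq[of B]
proof (rule Inf_greatest)
  fix z assume "z \<in> {ennreal l |l. 0 < l \<and> modular l B \<le> 1}"
  then show "set_norm A \<le> z"
    using modular_mono_AE[OF assms] by (auto intro!: set_norm_le intro: order_trans)
qed

lemma set_norm_mono: "A \<subseteq> B \<Longrightarrow> set_norm A \<le> set_norm B"
  by (rule set_norm_mono_AE) auto

lemma modular_le_measure:
  assumes E: "E \<in> sets M" and le: "AE x in M. x \<in> E \<longrightarrow> p x \<le> \<beta>" and l: "0 < l" "l \<le> 1"
  shows "modular l E \<le> ennreal (l powr - \<beta> * measure M E)"
proof -
  have "modular l E \<le> (\<integral>\<^sup>+x. ennreal (l powr - \<beta>) * indicator E x \<partial>M)"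
    unfolding modular_def
  proof (rule nn_integral_mono_AE)
    show "AE x in M. ennreal (l powr - p x) * indicator E x
        \<le> ennreal (l powr - \<beta>) * indicator E x"
      using le
    proof eventually_elim
      case (elim x)
      then have "x \<in> E \<Longrightarrow> l powr - p x \<le> l powr - \<beta>"
        using l by (intro powr_mono') auto
      then show ?case by (auto simp: indicator_def intro: ennreal_leI)
    qed
  qed
  also have "\<dots> = ennreal (l powr - \<beta> * measure M E)"
    using E by (simp add: nn_integral_cmult_indicator emeasure_eq_measure ennreal_mult)
  finally show ?thesis .
qed

lemma measure_le_modular:
  assumes E: "E \<in> sets M" and ge: "AE x in M. x \<in> E \<longrightarrow> \<alpha> \<le> p x" and l: "0 < l" "l \<le> 1"
  shows "ennreal (l powr - \<alpha> * measure M E) \<le> modular l E"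
proof -
  have "ennreal (l powr - \<alpha> * measure M E) = (\<integral>\<^sup>+x. ennreal (l powr - \<alpha>) * indicator E x \<partial>M)"
    using E by (simp add: nn_integral_cmult_indicator emeasure_eq_measure ennreal_mult)
  also have "\<dots> \<le> modular l E"
    unfolding modular_def
  proof (rule nn_integral_mono_AE)
    show "AE x in M. ennreal (l powr - \<alpha>) * indicator E x
        \<le> ennreal (l powr - p x) * indicator E x"
      using ge
    proof eventually_elim
      case (elim x)
      then have "x \<in> E \<Longrightarrow> l powr - \<alpha> \<le> l powr - p x"
        using l by (intro powr_mono') auto
      then show ?case by (auto simp: indicator_def intro: ennreal_leI)
    qed
  qed
  finally show ?thesis .
qed

lemma modular_one_le: "modular 1 E \<le> 1"
proof -
  have "modular 1 E \<le> modular 1 UNIV"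
    by (rule modular_mono_AE) auto
  also have "\<dots> = 1"
    unfolding modular_def using emeasure_space_1 by simp
  finally show ?thesis .
qed

lemma set_norm_le_1: "set_norm E \<le> 1"
  using set_norm_le[of 1 E] modular_one_le[of E] by simp

lemma measure_le_of_set_norm:
  assumes E: "E \<in> sets M" and "set_norm E < ennreal l" "l \<le> 1"
  shows "measure M E \<le> l powr a"
proof -
  note l = set_norm_less[OF assms(2)]
  have "ennreal (l powr - a * measure M E) \<le> ennreal 1"
    using order_trans[OF measure_le_modular[OF E _ l(1) assms(3), of a] l(2)] p_bounds
    by (simp add: eventually_mono)
  then have "l powr - a * measure M E \<le> 1" by (subst (asm) ennreal_le_iff) auto
  then show ?thesis using l(1) by (simp add: powr_minus divide_simps)
qed

lemma null_of_set_norm_zero: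
  assumes E: "E \<in> sets M" and small: "\<And>e. 0 < e \<Longrightarrow> e < 1 \<Longrightarrow> set_norm E < ennreal e"
  shows "measure M E = 0"
proof (rule ccontr)
  assume "measure M E \<noteq> 0"
  then have pos: "0 < measure M E" using measure_nonneg[of M E] by linarith
  define e where "e = (measure M E / 2) powr (1 / a)"
  have "measure M E / 2 < 1" using prob_le_1[of E] by linarith
  then have "e < 1" unfolding e_def using pos a_pos powr_less_mono2[of "1 / a" "measure M E / 2" 1] by simp
  moreover have "0 < e" unfolding e_def using pos by simp
  ultimately have "measure M E \<le> e powr a"
    using measure_le_of_set_norm[OF E small] by auto
  also have "\<dots> = measure M E / 2"
    unfolding e_def using pos a_pos by (simp add: powr_powr)
  finally show False using pos by simp
qed

section \<open>Bounding one norm by another through the modulars\<close>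

text \<open>Since \<open>p\<close> takes values between \<open>a\<close> and \<open>b\<close>, multiplying the modular by \<open>c\<close> changes
  the norm by at most this factor.\<close>

definition norm_factor :: "real \<Rightarrow> real" where
  "norm_factor c = max (c powr (1 / a)) (c powr (1 / b))"

lemma norm_factor_pos: "0 < c \<Longrightarrow> 0 < norm_factor c"
  unfolding norm_factor_def by (simp add: less_max_iff_disj)

lemma norm_factor_powr_neg:
  assumes "0 < c" "a \<le> r" "r \<le> b"
  shows "norm_factor c powr - r \<le> 1 / c"
proof -
  have "c \<le> norm_factor c powr r"
  proof (cases "1 \<le> c")
    case True
    have "c \<le> (c powr (1 / a)) powr r"
      using True assms a_pos
      by (simp add: powr_powr) (rule order_trans[OF _ powr_mono[of 1 "r / a" c]], auto)
    also have "\<dots> \<le> norm_factor c powr r"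
      unfolding norm_factor_def using assms a_pos by (intro powr_mono2) auto
    finally show ?thesis .
  next
    case False
    have "c \<le> (c powr (1 / b)) powr r"
      using False assms b_pos
      by (simp add: powr_powr) (rule order_trans[OF _ powr_mono'[of "r / b" 1 c]], auto)
    also have "\<dots> \<le> norm_factor c powr r"
      unfolding norm_factor_def using assms a_pos by (intro powr_mono2) auto
    finally show ?thesis .
  qed
  then show ?thesis using assms norm_factor_pos[of c]
    by (simp add: powr_minus divide_simps)
qed

lemma modular_norm_factor:
  assumes [measurable]: "E \<in> sets M" and c: "0 < c" and l: "0 < l"
  shows "modular (norm_factor c * l) E \<le> ennreal (1 / c) * modular l E"
proof -
  have "modular (norm_factor c * l) E
      \<le> (\<integral>\<^sup>+x. ennreal (1 / c) * (ennreal (l powr - p x) * indicator E x) \<partial>M)"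
    unfolding modular_def
  proof (rule nn_integral_mono_AE)
    show "AE x in M. ennreal ((norm_factor c * l) powr - p x) * indicator E x
        \<le> ennreal (1 / c) * (ennreal (l powr - p x) * indicator E x)"
      using p_bounds
    proof eventually_elim
      case (elim x)
      have "(norm_factor c * l) powr - p x \<le> 1 / c * l powr - p x"
        using norm_factor_powr_neg[OF c] elim norm_factor_pos[OF c] l
        by (simp add: powr_mult mult_right_mono del: times_divide_eq_left mult_1_left)
      then have "ennreal ((norm_factor c * l) powr - p x)
          \<le> ennreal (1 / c) * ennreal (l powr - p x)"
        using c by (simp add: ennreal_mult[symmetric])
      then show ?case by (auto simp: indicator_def)
    qed
  qed
  also have "\<dots> \<le> ennreal (1 / c) * modular l E"
    unfolding modular_def by (subst nn_integral_cmult) auto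
  finally show ?thesis .
qed

lemma set_norm_le_of_modular:
  assumes E: "E \<in> sets M" and c: "0 < c"
    and le: "\<And>l. 0 < l \<Longrightarrow> l \<le> 1 \<Longrightarrow> modular l G \<le> 1 \<Longrightarrow> modular l E \<le> ennreal c"
  shows "set_norm E \<le> ennreal (norm_factor c) * set_norm G"
proof -
  have step: "set_norm E \<le> ennreal (norm_factor c) * ennreal l"
    if l: "0 < l" "modular l G \<le> 1" for l
  proof -
    define m where "m = min l 1"
    have m: "0 < m" "m \<le> 1" "m \<le> l" "modular m G \<le> 1"
      using l modular_one_le[of G] by (auto simp: m_def min_def)
    have "modular (norm_factor c * m) E \<le> ennreal (1 / c) * ennreal c"
      using modular_norm_factor[OF E c m(1)] le[OF m(1,2,4)]
      by (meson mult_left_mono order_trans zero_le)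
    also have "\<dots> = 1" using c by (simp add: ennreal_mult[symmetric])
    finally have "set_norm E \<le> ennreal (norm_factor c * m)"
      using norm_factor_pos[OF c] m by (intro set_norm_le) auto
    also have "\<dots> \<le> ennreal (norm_factor c * l)"
      using norm_factor_pos[OF c] m by (intro ennreal_leI mult_left_mono) auto
    finally show ?thesis using norm_factor_pos[OF c] l by (simp add: ennreal_mult)
  qed
  have pos: "0 < ennreal (norm_factor c)" using norm_factor_pos[OF c] by simp
  have "set_norm E / ennreal (norm_factor c) \<le> set_norm G"
    unfolding set_norm_eq[of G]
  proof (rule Inf_greatest)
    fix z assume "z \<in> {ennreal l |l. 0 < l \<and> modular l G \<le> 1}"
    then obtain l where "z = ennreal l" "0 < l" "modular l G \<le> 1" by auto
    then show "set_norm E / ennreal (norm_factor c) \<le> z"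
      using step[of l] pos by (auto intro!: divide_le_posI_ennreal simp: mult.commute)
  qed
  then show ?thesis
    using pos by (metis ennreal_less_top ennreal_times_divide mult.commute
      mult_divide_eq_ennreal mult_left_mono order_less_irrefl order_less_le_trans zero_le ennreal_neq_top)
qed

section \<open>Norms of countable unions\<close>

lemma modular_UN_le:
  assumes [measurable]: "\<And>j. E j \<in> sets M"
  shows "modular l (\<Union>j. E j) \<le> (\<Sum>j. modular l (E j))"
proof -
  have "modular l (\<Union>j. E j) \<le> (\<integral>\<^sup>+x. (\<Sum>j. ennreal (l powr - p x) * indicator (E j) x) \<partial>M)"
    unfolding modular_def
  proof (rule nn_integral_mono)
    fix x
    show "ennreal (l powr - p x) * indicator (\<Union>j. E j) x
        \<le> (\<Sum>j. ennreal (l powr - p x) * indicator (E j) x)"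
    proof (cases "x \<in> (\<Union>j. E j)")
      case True
      then obtain i where "x \<in> E i" by auto
      then have "ennreal (l powr - p x) * indicator (\<Union>j. E j) x
          \<le> (\<Sum>j\<in>{i}. ennreal (l powr - p x) * indicator (E j) x)"
        by (auto simp: indicator_def)
      also have "\<dots> \<le> (\<Sum>j. ennreal (l powr - p x) * indicator (E j) x)"
        by (rule sum_le_suminf) auto
      finally show ?thesis .
    qed auto
  qed
  also have "\<dots> = (\<Sum>j. modular l (E j))"
    unfolding modular_def by (rule nn_integral_suminf) measurable
  finally show ?thesis .
qed

text \<open>The variable norms are not countably subadditive, but a union is controlled by a supremum
  with geometrically growing weights, at a cost that depends only on the rate of growth.\<close>

lemma set_norm_UN_le:
  assumes e: "0 < e"
  shows "\<exists>B>0. \<forall>E. (\<forall>j. E j \<in> sets M) \<longrightarrow>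
    set_norm (\<Union>j::nat. E j) \<le> ennreal B * (SUP j. ennreal (2 powr (e * real j)) * set_norm (E j))"
proof -
  define r where "r = 2 powr (- e * a)"
  have r: "0 < r" "r < 1" unfolding r_def using e a_pos by (auto intro!: powr_less_one)
  define B where "B = max 1 ((1 / (1 - r)) powr (1 / a))"
  have B: "0 < B" "1 \<le> B" unfolding B_def by auto
  have Ba: "B powr - a \<le> 1 - r"
  proof -
    have "1 / (1 - r) = ((1 / (1 - r)) powr (1 / a)) powr a"
      using r a_pos by (simp add: powr_powr)
    also have "\<dots> \<le> B powr a"
      unfolding B_def using a_pos by (intro powr_mono2) auto
    finally show ?thesis using r B by (simp add: powr_minus divide_simps mult.commute)
  qed
  show ?thesis
  proof (intro exI[of _ B] conjI allI impI B(1))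
    fix E :: "nat \<Rightarrow> 'a set" assume "\<forall>j. E j \<in> sets M"
    then have E [measurable]: "\<And>j. E j \<in> sets M" by auto
    let ?S = "SUP j. ennreal (2 powr (e * real j)) * set_norm (E j)"
    have *: "set_norm (\<Union>j. E j) \<le> ennreal B * ennreal s" if s: "?S < ennreal s" for s
    proof -
      have s0: "0 < s" using s by (metis ennreal_neg not_le not_less_zero)
      have m1: "modular (2 powr (- e * real j) * s) (E j) \<le> 1" for j
      proof -
        have "ennreal (2 powr (e * real j)) * set_norm (E j) \<le> ?S" by (rule SUP_upper) auto
        then have lt: "ennreal (2 powr (e * real j)) * set_norm (E j) < ennreal s"
          using s by simp
        have "set_norm (E j) = ennreal (2 powr (- e * real j)) *
            (ennreal (2 powr (e * real j)) * set_norm (E j))"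
          by (simp add: mult.assoc[symmetric] ennreal_mult[symmetric] powr_add[symmetric])
        also have "\<dots> < ennreal (2 powr (- e * real j)) * ennreal s"
          using lt by (intro ennreal_mult_strict_left_mono) auto
        also have "\<dots> = ennreal (2 powr (- e * real j) * s)"
          using s0 by (simp add: ennreal_mult)
        finally show ?thesis by (rule set_norm_less(2))
      qed
      have mj: "modular (B * s) (E j) \<le> ennreal ((1 - r) * r ^ j)" for j
      proof -
        have "modular (B * s) (E j)
            \<le> (\<integral>\<^sup>+x. ennreal ((1 - r) * r ^ j) *
                (ennreal ((2 powr (- e * real j) * s) powr - p x) * indicator (E j) x) \<partial>M)"
          unfolding modular_def
        proof (rule nn_integral_mono_AE)
          show "AE x in M. ennreal ((B * s) powr - p x) * indicator (E j) x
            \<le> ennreal ((1 - r) * r ^ j) *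
                (ennreal ((2 powr (- e * real j) * s) powr - p x) * indicator (E j) x)"
            using p_bounds
          proof eventually_elim
            case (elim x)
            have "B powr - p x \<le> B powr - a"
              using elim B by (intro powr_mono) auto
            also have "\<dots> \<le> 1 - r" by (rule Ba)
            finally have 1: "B powr - p x \<le> 1 - r" .
            have "(2::real) powr (- e * real j * p x) \<le> 2 powr (- e * real j * a)"
              using elim e by (intro powr_mono) (auto intro!: mult_left_mono)
            also have "\<dots> = r ^ j"
              unfolding r_def by (simp add: powr_powr powr_realpow[symmetric] mult_ac)
            finally have 2: "(2::real) powr (- e * real j * p x) \<le> r ^ j" .
            have "(B * s) powr - p x = B powr - p x * 2 powr (- e * real j * p x)
                * (2 powr (- e * real j) * s) powr - p x"
              using B s0 by (simp add: powr_mult powr_powr powr_add[symmetric])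
            also have "\<dots> \<le> (1 - r) * r ^ j * (2 powr (- e * real j) * s) powr - p x"
              using 1 2 r by (intro mult_right_mono mult_mono) auto
            finally have "ennreal ((B * s) powr - p x) \<le> ennreal ((1 - r) * r ^ j) *
                ennreal ((2 powr (- e * real j) * s) powr - p x)"
              using r by (simp add: ennreal_mult[symmetric])
            then show ?case by (auto simp: indicator_def)
          qed
        qed
        also have "\<dots> = ennreal ((1 - r) * r ^ j) * modular (2 powr (- e * real j) * s) (E j)"
          unfolding modular_def by (rule nn_integral_cmult) measurable
        also have "\<dots> \<le> ennreal ((1 - r) * r ^ j)"
          using mult_left_mono[OF m1[of j], of "ennreal ((1 - r) * r ^ j)"] by simp
        finally show ?thesis .
      qed
      have "modular (B * s) (\<Union>j. E j) \<le> (\<Sum>j. modular (B * s) (E j))"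
        by (rule modular_UN_le) measurable
      also have "\<dots> \<le> (\<Sum>j. ennreal ((1 - r) * r ^ j))"
        by (intro suminf_le mj) auto
      also have "\<dots> = ennreal 1"
      proof (rule suminf_ennreal_eq)
        show "(\<lambda>j. (1 - r) * r ^ j) sums 1"
          using sums_mult[OF geometric_sums[of r], of "1 - r"] r by simp
      qed (use r in auto)
      finally have "set_norm (\<Union>j. E j) \<le> ennreal (B * s)"
        using B s0 by (intro set_norm_le) auto
      then show ?thesis using B s0 by (simp add: ennreal_mult)
    qed
    show "set_norm (\<Union>j. E j) \<le> ennreal B * ?S"
    proof (cases "?S = \<infinity>")
      case True
      then have "ennreal B * ?S = \<infinity>" using B by (simp only: True) (simp add: ennreal_mult_top)
      then show ?thesis by (simp only: infinity_ennreal_def top_greatest)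
    next
      case False
      then obtain u where u: "0 \<le> u" "?S = ennreal u" by (cases ?S) auto
      show ?thesis unfolding u
      proof (rule ennreal_le_epsilon)
        fix d :: real assume d: "0 < d"
        have "?S < ennreal (u + d / B)"
          unfolding u using d B u by (subst ennreal_less_iff) auto
        from *[OF this] show "set_norm (\<Union>j. E j) \<le> ennreal B * ennreal u + ennreal d"
          using B d u by (simp add: ennreal_mult[symmetric] ennreal_plus[symmetric] distrib_left
              del: ennreal_plus)
      qed
    qed
  qed
qed

lemma set_norm_Un_le:
  "\<exists>B>0. \<forall>E\<in>sets M. \<forall>E'\<in>sets M.
    set_norm (E \<union> E') \<le> ennreal B * max (set_norm E) (set_norm E')"
proof -
  obtain B where B: "0 < B" and *: "\<And>E. (\<And>j. E j \<in> sets M) \<Longrightarrow>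
    set_norm (\<Union>j::nat. E j) \<le> ennreal B * (SUP j. ennreal (2 powr (1 * real j)) * set_norm (E j))"
    using set_norm_UN_le[of 1] by auto
  show ?thesis
  proof (intro exI[of _ "B * 2"] conjI ballI)
    fix E E' assume E: "E \<in> sets M" "E' \<in> sets M"
    define A where "A j = (if j = 0 then E else if j = 1 then E' else {})" for j :: nat
    have A: "(\<Union>j. A j) = E \<union> E'"
      unfolding A_def by (auto split: if_splits)
    have empty: "set_norm {} = 0"
    proof -
      have "set_norm {} \<le> ennreal d" if "0 < d" for d
        by (rule set_norm_le) (use that in \<open>auto simp: modular_def\<close>)
      then have "set_norm {} \<le> 0" using ennreal_le_epsilon[of 0 "set_norm {}"] by auto
      then show ?thesis by simp
    qed
    have "set_norm (\<Union>j. A j) \<le> ennreal B * (SUP j. ennreal (2 powr (1 * real j)) * set_norm (A j))"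
      by (rule *) (use E in \<open>auto simp: A_def\<close>)
    also have "\<dots> \<le> ennreal B * (ennreal 2 * max (set_norm E) (set_norm E'))"
    proof (intro mult_left_mono SUP_least zero_le)
      fix j :: nat
      consider "j = 0" | "j = 1" | "j > 1" by linarith
      then show "ennreal (2 powr (1 * real j)) * set_norm (A j)
          \<le> ennreal 2 * max (set_norm E) (set_norm E')"
      proof cases
        case 1
        have "1 * set_norm E \<le> ennreal 2 * max (set_norm E) (set_norm E')"
          by (intro mult_mono) auto
        then show ?thesis using 1 by (simp add: A_def)
      next
        case 2
        then show ?thesis by (auto simp: A_def intro!: mult_left_mono)
      qed (simp add: A_def empty)
    qed
    finally show "set_norm (E \<union> E') \<le> ennreal (B * 2) * max (set_norm E) (set_norm E')"
      using B by (simp add: A ennreal_mult mult.assoc)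
  qed (use B in auto)
qed

end

section \<open>Atoms and the comparison of sets\<close>

lemma atom_subset:
  assumes "finite_measure M" "subalgebra M G" "is_atom M G B" "A \<in> sets G" "A \<subseteq> B" "measure M A \<noteq> 0"
  shows "is_atom M G A" "measure M A = measure M B"
proof -
  interpret finite_measure M by fact
  have B: "B \<in> sets M" using assms by (auto simp: is_atom_def subalgebra_def)
  have le: "measure M A \<le> measure M B" using assms B by (intro finite_measure_mono) auto
  moreover have "\<not> measure M A < measure M B" using assms unfolding is_atom_def by auto
  ultimately show eq: "measure M A = measure M B" by simp
  show "is_atom M G A"
    using assms eq by (auto simp: is_atom_def)
qed

lemma sigma_sets_contains_or_disjoint:
  assumes "A \<in> sigma_sets S \<A>"
  shows "S - \<Union>\<A> \<subseteq> A \<or> (S - \<Union>\<A>) \<inter> A = {}"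
  using assms
proof induction
  case (Union B)
  then show ?case by (cases "\<exists>i. S - \<Union>\<A> \<subseteq> B i") blast+
qed auto

text \<open>The set left uncovered by the generating atoms is itself null or an atom, and two generating
  atoms may overlap, in a null set or almost everywhere; making the family disjoint keeps atoms and
  null sets only.\<close>

lemma atom_decomposition:
  assumes fin: "finite_measure M" and sub: "subalgebra M G"
    and gen: "generated_by_countably_many_atoms M G" and D: "D \<in> sets G"
  shows "\<exists>J :: nat \<Rightarrow> 'a set. disjoint_family J \<and> D = (\<Union>i. J i) \<and>
    (\<forall>i. J i \<in> sets G \<and> (measure M (J i) = 0 \<or> is_atom M G (J i)))"
proof -
  interpret finite_measure M by fact
  obtain \<A> where \<A>: "countable \<A>" "\<And>A. A \<in> \<A> \<Longrightarrow> is_atom M G A"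
    "sets G = sigma_sets (space M) \<A>"
    using gen unfolding generated_by_countably_many_atoms_def by auto
  have sp: "space G = space M" using sub by (auto simp: subalgebra_def)
  have \<A>G: "A \<in> sets G" if "A \<in> \<A>" for A using \<A>(2)[OF that] by (simp add: is_atom_def)
  define C where "C = space M - \<Union>\<A>"
  have CG: "C \<in> sets G"
    unfolding C_def sp[symmetric] using \<A>(1) \<A>G by (intro sets.Diff sets.countable_Union) auto
  have C: "measure M C = 0 \<or> is_atom M G C"
  proof (cases "measure M C = 0")
    case False
    then have "0 < measure M C" using measure_nonneg[of M C] by linarith
    moreover have "measure M A = 0" if "A \<in> sets G" "A \<subseteq> C" "measure M A < measure M C" for A
    proof -
      have "C \<subseteq> A \<or> C \<inter> A = {}"
        using sigma_sets_contains_or_disjoint[of A "space M" \<A>] that \<A>(3) by (simp add: C_def)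
      then have "A = C \<or> A = {}" using that by auto
      then show ?thesis using that by auto
    qed
    ultimately show ?thesis using CG by (auto simp: is_atom_def)
  qed auto
  define A where "A = from_nat_into (insert C \<A>)"
  have ranA: "range A = insert C \<A>"
    unfolding A_def using \<A>(1) by (intro range_from_nat_into) auto
  define J where "J = disjointed (\<lambda>i. D \<inter> A i)"
  have AG: "A i \<in> sets G" for i
    using ranA CG \<A>G by (metis insertE rangeI)
  have Aat: "measure M (A i) = 0 \<or> is_atom M G (A i)" for i
    using ranA C \<A>(2) by (metis insertE rangeI)
  have JG: "J i \<in> sets G" for i
    unfolding J_def using AG D sets.range_disjointed_sets[of "\<lambda>i. D \<inter> A i" G] by auto
  have JA: "J i \<subseteq> A i" for i
    unfolding J_def using disjointed_subset[of "\<lambda>i. D \<inter> A i" i] by auto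
  have "(\<Union>i. J i) = D \<inter> (\<Union>i. A i)"
    unfolding J_def by (simp add: UN_disjointed_eq)
  also have "\<dots> = D"
    using ranA sets.sets_into_space[OF D] by (auto simp: C_def sp)
  finally have "D = (\<Union>i. J i)" ..
  moreover have "disjoint_family J"
    unfolding J_def by (rule disjoint_family_disjointed)
  moreover have "measure M (J i) = 0 \<or> is_atom M G (J i)" for i
  proof (cases "measure M (J i) = 0")
    case False
    have Ai: "A i \<in> sets M" using AG[of i] sub by (auto simp: subalgebra_def)
    have "measure M (J i) \<le> measure M (A i)" using JA Ai by (intro finite_measure_mono) auto
    then have "measure M (A i) \<noteq> 0" using False measure_nonneg[of M "J i"] by linarith
    then show ?thesis using atom_subset(1)[OF fin sub _ JG JA False] Aat by auto
  qed auto
  ultimately show ?thesis using JG by blast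
qed

text \<open>The last assumption is the consequence of the condition on \<open>p\<close> and the atoms that is used:
  on every atom, \<open>p\<close> has essential bounds \<open>\<alpha>\<close> and \<open>\<beta>\<close> that are close on the scale of its measure.\<close>

locale atomic_filtration = variable_exponent M p a b for M :: "'a measure" and p a b +
  fixes F :: "nat \<Rightarrow> 'a measure" and K :: real
  assumes subalg: "subalgebra M (F n)"
    and F_mono: "m \<le> n \<Longrightarrow> sets (F m) \<subseteq> sets (F n)"
    and atoms: "generated_by_countably_many_atoms M (F n)"
    and K_ge_1: "1 \<le> K"
    and oscillation: "is_atom M (F n) A \<Longrightarrow> \<exists>\<alpha> \<beta>. a \<le> \<alpha> \<and> \<alpha> \<le> \<beta> \<and> \<beta> \<le> b \<and>
        (AE x in M. x \<in> A \<longrightarrow> \<alpha> \<le> p x \<and> p x \<le> \<beta>) \<and> measure M A powr (\<alpha> - \<beta>) \<le> K"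
begin

lemma F_sets: "A \<in> sets (F n) \<Longrightarrow> A \<in> sets M"
  using subalg[of n] by (auto simp: subalgebra_def)

lemma F_space: "space (F n) = space M"
  using subalg[of n] by (auto simp: subalgebra_def)

lemma F_measurable: "f \<in> measurable (F n) N \<Longrightarrow> f \<in> measurable M N"
  by (rule measurable_from_subalg[OF subalg])

lemma F_mono_measurable: "m \<le> n \<Longrightarrow> f \<in> measurable (F m) N \<Longrightarrow> f \<in> measurable (F n) N"
  using F_mono[of m n] by (auto simp: measurable_def F_space)

lemma atom_sets: "is_atom M (F n) A \<Longrightarrow> A \<in> sets M"
  by (auto simp: is_atom_def F_sets)

text \<open>A bound for the ratio of two values of \<open>l powr - p x\<close> on an atom, when \<open>l\<close> is at least
  \<open>(m / R) powr (1 / \<alpha>)\<close>, where \<open>m\<close> is the measure of the atom.\<close>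

definition osc_const :: "real \<Rightarrow> real" where
  "osc_const R = (K * R powr (b - a)) powr (1 / a)"

lemma osc_const_pos: "1 \<le> R \<Longrightarrow> 0 < osc_const R"
  unfolding osc_const_def using K_ge_1 by simp

text \<open>If \<open>G\<close> fills a fixed proportion of an atom and has modular at most \<open>1\<close>, then \<open>l\<close> is
  bounded below by a power of the measure of the atom, so that on this atom \<open>l powr - p x\<close> is
  constant up to a factor.  Hence modulars compare on the atom as measures do.\<close>

lemma modular_atom_le:
  assumes A: "is_atom M (F n) A" and [measurable]: "E \<in> sets M" "G \<in> sets M"
    and l: "0 < l" "l \<le> 1" and G1: "modular l G \<le> 1" and R: "1 \<le> R" and e: "0 < e"
    and EA: "measure M (E \<inter> A) \<le> e * measure M A"
    and GA: "measure M A \<le> R * measure M (G \<inter> A)"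
  shows "modular l (E \<inter> A) \<le> ennreal (osc_const R * R * e) * modular l (G \<inter> A)"
proof -
  have [measurable]: "A \<in> sets M" by (rule atom_sets[OF A])
  obtain \<alpha> \<beta> where ab: "a \<le> \<alpha>" "\<alpha> \<le> \<beta>" "\<beta> \<le> b"
    and p: "AE x in M. x \<in> A \<longrightarrow> \<alpha> \<le> p x \<and> p x \<le> \<beta>"
    and K: "measure M A powr (\<alpha> - \<beta>) \<le> K"
    using oscillation[OF A] by auto
  have \<alpha>: "0 < \<alpha>" using ab a_pos by simp
  define m where "m = measure M A"
  have m: "0 < m" using A by (simp add: m_def is_atom_def)
  have lower: "ennreal (l powr - \<alpha> * measure M (G \<inter> A)) \<le> modular l (G \<inter> A)"
    by (rule measure_le_modular) (use p l in \<open>auto elim!: eventually_mono\<close>)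
  also have "\<dots> \<le> modular l G" using l by (intro modular_mono_AE) auto
  also have "\<dots> \<le> ennreal 1" using G1 by simp
  finally have "l powr - \<alpha> * measure M (G \<inter> A) \<le> 1" by (subst (asm) ennreal_le_iff) auto
  then have "measure M (G \<inter> A) \<le> l powr \<alpha>" using l by (simp add: powr_minus divide_simps)
  then have "m \<le> R * l powr \<alpha>" using GA R unfolding m_def
    by (meson mult_left_mono order_trans zero_le_one)
  then have "m / R \<le> l powr \<alpha>" using R by (simp add: divide_simps mult.commute)
  then have "(m / R) powr (1 / \<alpha>) \<le> (l powr \<alpha>) powr (1 / \<alpha>)"
    using m R \<alpha> by (intro powr_mono2) auto
  then have lge: "(m / R) powr (1 / \<alpha>) \<le> l" using l \<alpha> by (simp add: powr_powr)
  have "l powr (\<alpha> - \<beta>) \<le> ((m / R) powr (1 / \<alpha>)) powr (\<alpha> - \<beta>)"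
    using lge m R ab by (intro powr_mono2') auto
  also have "\<dots> = (m powr (\<alpha> - \<beta>) * R powr (\<beta> - \<alpha>)) powr (1 / \<alpha>)"
  proof -
    have "(m / R) powr (\<alpha> - \<beta>) = m powr (\<alpha> - \<beta>) * R powr (\<beta> - \<alpha>)"
      using m R powr_minus_divide[of R "\<alpha> - \<beta>"] powr_divide[of m R "\<alpha> - \<beta>"] by simp
    then show ?thesis by (metis mult.commute powr_powr)
  qed
  also have "\<dots> \<le> (K * R powr (b - a)) powr (1 / \<alpha>)"
    using K K_ge_1 ab R m \<alpha> by (intro powr_mono2 mult_mono powr_mono) (auto simp: m_def)
  also have "\<dots> \<le> osc_const R"
  proof -
    have "1 * 1 \<le> K * R powr (b - a)"
      using K_ge_1 R a_le_b by (intro mult_mono ge_one_powr_ge_zero) auto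
    then show ?thesis unfolding osc_const_def
      using ab a_pos by (intro powr_mono) (auto simp: divide_simps)
  qed
  finally have osc: "l powr (\<alpha> - \<beta>) \<le> osc_const R" .
  have "modular l (E \<inter> A) \<le> ennreal (l powr - \<beta> * measure M (E \<inter> A))"
    by (rule modular_le_measure) (use p l in \<open>auto elim!: eventually_mono\<close>)
  also have "\<dots> \<le> ennreal (osc_const R * R * e * (l powr - \<alpha> * measure M (G \<inter> A)))"
  proof (rule ennreal_leI)
    have "l powr - \<beta> * measure M (E \<inter> A) = l powr (\<alpha> - \<beta>) * l powr - \<alpha> * measure M (E \<inter> A)"
      by (simp add: powr_add[symmetric])
    also have "\<dots> \<le> osc_const R * l powr - \<alpha> * (e * (R * measure M (G \<inter> A)))"
      using osc EA GA e osc_const_pos[OF R]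
      by (intro mult_mono order_trans[OF EA] mult_left_mono) auto
    finally show "l powr - \<beta> * measure M (E \<inter> A)
        \<le> osc_const R * R * e * (l powr - \<alpha> * measure M (G \<inter> A))"
      by (simp add: mult_ac)
  qed
  also have "\<dots> = ennreal (osc_const R * R * e) * ennreal (l powr - \<alpha> * measure M (G \<inter> A))"
    using osc_const_pos[OF R] R e by (simp add: ennreal_mult)
  also have "\<dots> \<le> ennreal (osc_const R * R * e) * modular l (G \<inter> A)"
    by (intro mult_left_mono lower) auto
  finally show ?thesis .
qed

text \<open>The atoms of different levels are glued along disjoint sets \<open>D n\<close>, such as the sets on which
  a stopping time equals \<open>n\<close>.\<close>

lemma set_norm_comparison:
  assumes D: "\<And>n. D n \<in> sets (F n)" "disjoint_family D"
    and E [measurable]: "E \<in> sets M" and G [measurable]: "G \<in> sets M"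
    and cover: "AE x in M. x \<in> E \<longrightarrow> x \<in> (\<Union>n. D n)"
    and R: "1 \<le> R" and e: "0 < e"
    and EA: "\<And>n A. is_atom M (F n) A \<Longrightarrow> A \<subseteq> D n \<Longrightarrow> measure M (E \<inter> A) \<le> e * measure M A"
    and GA: "\<And>n A. is_atom M (F n) A \<Longrightarrow> A \<subseteq> D n \<Longrightarrow> measure M A \<le> R * measure M (G \<inter> A)"
  shows "set_norm E \<le> ennreal (norm_factor (osc_const R * R * e)) * set_norm G"
proof (rule set_norm_le_of_modular[OF E])
  let ?c = "osc_const R * R * e"
  show "0 < ?c" using osc_const_pos[OF R] R e by simp
  fix l :: real assume l: "0 < l" "l \<le> 1" and G1: "modular l G \<le> 1"
  have "\<forall>n. \<exists>J :: nat \<Rightarrow> 'a set. disjoint_family J \<and> D n = (\<Union>i. J i) \<and>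
    (\<forall>i. J i \<in> sets (F n) \<and> (measure M (J i) = 0 \<or> is_atom M (F n) (J i)))"
    using atom_decomposition[OF finite_measure_axioms subalg atoms D(1)] by blast
  from choice[OF this] obtain J :: "nat \<Rightarrow> nat \<Rightarrow> 'a set" where J: "\<forall>n. disjoint_family (J n) \<and> D n = (\<Union>i. J n i) \<and>
    (\<forall>i. J n i \<in> sets (F n) \<and> (measure M (J n i) = 0 \<or> is_atom M (F n) (J n i)))" ..
  then have J: "\<And>n. disjoint_family (J n)" "\<And>n. D n = (\<Union>i. J n i)"
    "\<And>n i. J n i \<in> sets (F n)" "\<And>n i. measure M (J n i) = 0 \<or> is_atom M (F n) (J n i)"
    by blast+
  define I where "I k = (case prod_decode k of (n, i) \<Rightarrow> J n i)" for k
  have IM [measurable]: "I k \<in> sets M" for k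
    unfolding I_def using J(3) F_sets by (auto split: prod.split)
  have I_disj: "disjoint_family I"
    unfolding disjoint_family_on_def
  proof (intro ballI impI)
    fix k k' :: nat assume ne: "k \<noteq> k'"
    obtain n i n' i' where dec: "prod_decode k = (n, i)" "prod_decode k' = (n', i')"
      by (metis surj_pair)
    have "(n, i) \<noteq> (n', i')" using ne dec by (metis prod_decode_inverse)
    moreover have "J n i \<subseteq> D n" "J n' i' \<subseteq> D n'" using J(2) by auto
    moreover have "n \<noteq> n' \<Longrightarrow> D n \<inter> D n' = {}" "i \<noteq> i' \<Longrightarrow> J n i \<inter> J n i' = {}"
      using D(2) J(1)[of n] by (auto simp: disjoint_family_on_def)
    ultimately have "J n i \<inter> J n' i' = {}" by (cases "n = n'") (simp, blast)
    then show "I k \<inter> I k' = {}" by (simp add: I_def dec)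
  qed
  have I_UN: "(\<Union>k. I k) = (\<Union>n. D n)"
  proof
    show "(\<Union>k. I k) \<subseteq> (\<Union>n. D n)" unfolding I_def using J(2) by (fastforce split: prod.split)
    show "(\<Union>n. D n) \<subseteq> (\<Union>k. I k)"
    proof
      fix x assume "x \<in> (\<Union>n. D n)"
      then obtain n i where "x \<in> J n i" using J(2) by auto
      then have "x \<in> I (prod_encode (n, i))" by (simp add: I_def)
      then show "x \<in> (\<Union>k. I k)" by auto
    qed
  qed
  have "modular l E \<le> modular l (\<Union>k. E \<inter> I k)"
    using cover l I_UN by (intro modular_mono_AE) (auto elim!: eventually_mono)
  also have "\<dots> \<le> (\<Sum>k. modular l (E \<inter> I k))" by (rule modular_UN_le) measurable
  also have "\<dots> \<le> (\<Sum>k. ennreal ?c * modular l (G \<inter> I k))"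
  proof (intro suminf_le)
    fix k
    obtain n i where dec: "prod_decode k = (n, i)" by (metis surj_pair)
    have Ik: "I k = J n i" by (simp add: I_def dec)
    from J(4)[of n i] show "modular l (E \<inter> I k) \<le> ennreal ?c * modular l (G \<inter> I k)"
    proof
      assume "measure M (J n i) = 0"
      then have "AE x in M. x \<notin> I k"
        using Ik IM[of k] by (intro AE_not_in) (simp add: null_sets_def emeasure_eq_measure)
      then have "modular l (E \<inter> I k) \<le> modular l {}"
        using l by (intro modular_mono_AE) (auto elim!: eventually_mono)
      then show ?thesis by (simp add: modular_def)
    next
      assume at: "is_atom M (F n) (J n i)"
      have "J n i \<subseteq> D n" using J(2) by auto
      then show ?thesis unfolding Ik
        using EA[OF at] GA[OF at] by (intro modular_atom_le[OF at E G l G1 R e]) auto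
    qed
  qed auto
  also have "\<dots> = ennreal ?c * (\<Sum>k. modular l (G \<inter> I k))" by (rule ennreal_suminf_cmult)
  also have "(\<Sum>k. modular l (G \<inter> I k))
      = (\<integral>\<^sup>+x. (\<Sum>k. ennreal (l powr - p x) * indicator (G \<inter> I k) x) \<partial>M)"
    unfolding modular_def by (rule nn_integral_suminf[symmetric]) measurable
  also have "\<dots> = modular l (\<Union>k. G \<inter> I k)"
    unfolding modular_def
  proof (rule nn_integral_cong)
    fix x
    have "disjoint_family (\<lambda>k. G \<inter> I k)"
      using I_disj by (auto simp: disjoint_family_on_def)
    then show "(\<Sum>k. ennreal (l powr - p x) * indicator (G \<inter> I k) x)
        = ennreal (l powr - p x) * indicator (\<Union>k. G \<inter> I k) x"
      by (simp add: ennreal_suminf_cmult suminf_indicator)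
  qed
  also have "\<dots> \<le> modular l G" using l by (intro modular_mono_AE) auto
  also have "\<dots> \<le> 1" by fact
  finally show "modular l E \<le> ennreal ?c" by (simp add: mult_left_mono)
qed

end

section \<open>Comparison of Lorentz norms\<close>

lemma epowr_ennreal: "0 \<le> x \<Longrightarrow> epowr (ennreal x) r = ennreal (x powr r)"
  by (simp add: epowr_def)

lemma epowr_mono:
  assumes "x \<le> y" "0 < r"
  shows "epowr x r \<le> epowr y r"
proof (cases "y = \<infinity>")
  case False
  then have "x \<noteq> \<infinity>" using assms(1) by (auto simp: top_unique)
  then show ?thesis using False assms
    by (auto simp: epowr_def intro!: ennreal_leI powr_mono2 enn2real_mono simp: less_top)
qed (simp add: epowr_def)

lemma epowr_epowr:
  assumes "0 < r"
  shows "epowr (epowr x r) (1 / r) = x" "epowr (epowr x (1 / r)) r = x"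
  using assms by (cases x; simp add: epowr_def powr_powr)+

lemma epowr_mult:
  assumes "0 < r"
  shows "epowr (x * y) r = epowr x r * epowr y r"
proof (cases "x = \<infinity> \<or> y = \<infinity>")
  case True
  then show ?thesis
    using assms by (cases x; cases y) (auto simp: epowr_def ennreal_mult_top ennreal_top_mult
      ennreal_mult_eq_top_iff)
next
  case False
  then obtain u v where "0 \<le> u" "x = ennreal u" "0 \<le> v" "y = ennreal v" by (cases x; cases y) auto
  then show ?thesis by (simp add: ennreal_mult[symmetric] epowr_ennreal powr_mult)
qed

lemma epowr_SUP_le_suminf:
  assumes r: "0 < r"
  shows "epowr (SUP j. x j) r \<le> (\<Sum>j::nat. epowr (x j) r)"
proof -
  have "x j \<le> epowr (\<Sum>j. epowr (x j) r) (1 / r)" for j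
  proof -
    have "epowr (x j) r \<le> (\<Sum>j. epowr (x j) r)"
      using sum_le_suminf[of "\<lambda>j. epowr (x j) r" "{j}"] by simp
    then have "epowr (epowr (x j) r) (1 / r) \<le> epowr (\<Sum>j. epowr (x j) r) (1 / r)"
      using r by (intro epowr_mono) auto
    then show ?thesis using r by (simp add: epowr_epowr)
  qed
  then have "epowr (SUP j. x j) r \<le> epowr (epowr (\<Sum>j. epowr (x j) r) (1 / r)) r"
    using r by (intro epowr_mono SUP_least) auto
  then show ?thesis using r by (simp add: epowr_epowr)
qed

lemma epowr_measurable [measurable]: "(\<lambda>x. epowr x r) \<in> borel_measurable borel"
  unfolding epowr_def by measurable

context variable_exponent
begin

lemma level_norm_antimono: "s \<le> t \<Longrightarrow> level_norm M p g t \<le> level_norm M p g s"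
  unfolding level_norm_eq
  by (intro set_norm_mono) (auto intro: le_less_trans ennreal_leI)

lemma level_norm_le_1: "level_norm M p g t \<le> 1"
  unfolding level_norm_eq by (rule set_norm_le_1)

lemma level_norm_measurable [measurable]: "level_norm M p g \<in> borel_measurable borel"
proof -
  have fin: "level_norm M p g t < top" for t
    using level_norm_le_1[of g t] by (rule le_less_trans) simp
  have "mono (\<lambda>t. - enn2real (level_norm M p g t))"
    using fin by (auto intro!: monoI enn2real_mono level_norm_antimono)
  then have "(\<lambda>t. - (- enn2real (level_norm M p g t))) \<in> borel_measurable borel"
    by (intro borel_measurable_uminus borel_measurable_mono)
  then have "(\<lambda>t. ennreal (- (- enn2real (level_norm M p g t)))) \<in> borel_measurable borel"
    by measurable
  then show ?thesis using fin by simp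
qed

lemma lorentz_norm_mono_AE:
  assumes "AE x in M. g x \<le> h x" "0 < q"
  shows "lorentz_norm M p q g \<le> lorentz_norm M p q h"
proof -
  have le: "level_norm M p g t \<le> level_norm M p h t" for t
    unfolding level_norm_eq using assms(1)
    by (intro set_norm_mono_AE) (auto elim!: eventually_mono intro: less_le_trans)
  show ?thesis
  proof (cases "q = \<infinity>")
    case True
    then show ?thesis unfolding lorentz_norm_def
      using le by (auto intro!: SUP_mono' mult_left_mono)
  next
    case False
    then have "0 < enn2real q" using assms(2) by (simp add: enn2real_positive_iff less_top)
    then show ?thesis unfolding lorentz_norm_def using False le
      by (auto intro!: epowr_mono nn_integral_mono mult_right_mono mult_left_mono)
  qed
qed

text \<open>The levels of \<open>G\<close> are dominated by lower and lower levels of \<open>g\<close>, with weights that decay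
  geometrically, at a rate \<open>\<theta>\<close> that will have to exceed the rate \<open>1\<close> at which the levels decrease.\<close>

definition level_dominated :: "real \<Rightarrow> real \<Rightarrow> real \<Rightarrow> ('a \<Rightarrow> ennreal) \<Rightarrow> ('a \<Rightarrow> ennreal) \<Rightarrow> bool" where
  "level_dominated C c \<theta> G g \<longleftrightarrow> (\<forall>t>0. level_norm M p G t \<le> ennreal C *
     (SUP j::nat. ennreal (2 powr - (\<theta> * real j)) * level_norm M p g (c * 2 powr - real j * t)))"

text \<open>The integrand of the Lorentz quasi-norm for a finite exponent \<open>r\<close>.\<close>

definition lorentz_density :: "real \<Rightarrow> ('a \<Rightarrow> ennreal) \<Rightarrow> real \<Rightarrow> ennreal" where
  "lorentz_density r g t =
     ennreal (t powr r) * epowr (level_norm M p g t) r * ennreal (1 / t) * indicator {0<..} t"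

lemma lorentz_density_measurable [measurable]: "lorentz_density r g \<in> borel_measurable borel"
  unfolding lorentz_density_def by measurable

lemma lorentz_norm_eq:
  assumes "q \<noteq> \<infinity>"
  shows "lorentz_norm M p q g
    = epowr (\<integral>\<^sup>+t. lorentz_density (enn2real q) g t \<partial>lborel) (1 / enn2real q)"
  using assms unfolding lorentz_norm_def lorentz_density_def by simp

text \<open>The measure \<open>dt / t\<close> is invariant under dilations.\<close>

lemma lorentz_density_scale:
  assumes s: "0 < s"
  shows "(\<integral>\<^sup>+t. ennreal (t powr r) * epowr (level_norm M p g (s * t)) r * ennreal (1 / t)
      * indicator {0<..} t \<partial>lborel)
    = ennreal (s powr - r) * (\<integral>\<^sup>+t. lorentz_density r g t \<partial>lborel)"
proof -
  have "(\<integral>\<^sup>+t. lorentz_density r g t \<partial>lborel) = ennreal s * (\<integral>\<^sup>+t. lorentz_density r g (s * t) \<partial>lborel)"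
    using nn_integral_real_affine[of "lorentz_density r g" s 0] s by simp
  then have "ennreal (s powr - r) * (\<integral>\<^sup>+t. lorentz_density r g t \<partial>lborel)
      = ennreal (s powr - r) * ennreal s * (\<integral>\<^sup>+t. lorentz_density r g (s * t) \<partial>lborel)"
    by (simp add: mult.assoc)
  also have "\<dots> = (\<integral>\<^sup>+t. ennreal (s powr - r) * ennreal s * lorentz_density r g (s * t) \<partial>lborel)"
    by (rule nn_integral_cmult[symmetric]) measurable
  also have "\<dots> = (\<integral>\<^sup>+t. ennreal (t powr r) * epowr (level_norm M p g (s * t)) r * ennreal (1 / t)
      * indicator {0<..} t \<partial>lborel)"
  proof (rule nn_integral_cong)
    fix t :: real
    show "ennreal (s powr - r) * ennreal s * lorentz_density r g (s * t)
      = ennreal (t powr r) * epowr (level_norm M p g (s * t)) r * ennreal (1 / t) * indicator {0<..} t"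
    proof (cases "0 < t")
      case True
      have "ennreal (s powr - r) * ennreal s * ennreal ((s * t) powr r) * ennreal (1 / (s * t))
          = ennreal (s powr - r * s * (s * t) powr r * (1 / (s * t)))"
        using s True by (simp add: ennreal_mult[symmetric])
      also have "s powr - r * s * (s * t) powr r * (1 / (s * t)) = t powr r * (1 / t)"
        using s True by (simp add: powr_mult powr_minus field_simps)
      also have "ennreal (t powr r * (1 / t)) = ennreal (t powr r) * ennreal (1 / t)"
        using True by (intro ennreal_mult) auto
      finally have key: "ennreal (s powr - r) * ennreal s * ennreal ((s * t) powr r) * ennreal (1 / (s * t))
          = ennreal (t powr r) * ennreal (1 / t)" .
      have "ennreal (s powr - r) * ennreal s * lorentz_density r g (s * t)
          = (ennreal (s powr - r) * ennreal s * ennreal ((s * t) powr r) * ennreal (1 / (s * t)))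
            * epowr (level_norm M p g (s * t)) r"
        using True s by (simp add: lorentz_density_def ac_simps)
      also note key
      finally show ?thesis using True by (simp add: ac_simps)
    qed (use s in \<open>simp add: lorentz_density_def zero_less_mult_iff\<close>)
  qed
  finally show ?thesis ..
qed

lemma lorentz_norm_le_of_level_dominated:
  assumes C: "0 < C" and c: "0 < c" and \<theta>: "1 < \<theta>" and q: "0 < q"
  shows "\<exists>C'>0. \<forall>G g. level_dominated C c \<theta> G g \<longrightarrow>
    lorentz_norm M p q G \<le> ennreal C' * lorentz_norm M p q g"
proof (cases "q = \<infinity>")
  case True
  show ?thesis
  proof (intro exI[of _ "C / c"] conjI allI impI)
    fix G g assume dom: "level_dominated C c \<theta> G g"
    let ?L = "lorentz_norm M p q g"
    have L: "ennreal s * level_norm M p g s \<le> ?L" if "0 < s" for s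
      unfolding lorentz_norm_def using True that by (auto intro!: SUP_upper2)
    have "ennreal t * level_norm M p G t \<le> ennreal (C / c) * ?L" if t: "0 < t" for t
    proof -
      have "ennreal t * level_norm M p G t \<le> ennreal t * (ennreal C *
          (SUP j::nat. ennreal (2 powr - (\<theta> * real j)) * level_norm M p g (c * 2 powr - real j * t)))"
        using dom t unfolding level_dominated_def by (intro mult_left_mono) auto
      also have "\<dots> = (SUP j::nat. ennreal t * (ennreal C *
          (ennreal (2 powr - (\<theta> * real j)) * level_norm M p g (c * 2 powr - real j * t))))"
        by (simp add: SUP_mult_left_ennreal)
      also have "\<dots> \<le> ennreal (C / c) * ?L"
      proof (rule SUP_least)
        fix j :: nat
        define s where "s = c * 2 powr - real j * t"
        have s: "0 < s" using c t by (simp add: s_def)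
        have "t * C * 2 powr - (\<theta> * real j) \<le> t * C * 2 powr - real j"
          using t C \<theta> mult_right_mono[of 1 \<theta> "real j"] by (intro mult_left_mono powr_mono) auto
        also have "\<dots> = C / c * s" using c by (simp add: s_def)
        finally have "ennreal (t * C * 2 powr - (\<theta> * real j)) \<le> ennreal (C / c * s)"
          by (rule ennreal_leI)
        then have "ennreal t * ennreal C * ennreal (2 powr - (\<theta> * real j)) \<le> ennreal (C / c) * ennreal s"
          using t C c s by (simp add: ennreal_mult[symmetric])
        then have "ennreal t * ennreal C * ennreal (2 powr - (\<theta> * real j)) * level_norm M p g s
            \<le> ennreal (C / c) * ennreal s * level_norm M p g s"
          by (rule mult_right_mono) auto
        also have "\<dots> \<le> ennreal (C / c) * ?L"
          using L[OF s] by (simp add: mult.assoc mult_left_mono)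
        finally show "ennreal t * (ennreal C * (ennreal (2 powr - (\<theta> * real j)) *
            level_norm M p g (c * 2 powr - real j * t))) \<le> ennreal (C / c) * ?L"
          by (simp add: mult.assoc s_def)
      qed
      finally show ?thesis .
    qed
    then show "lorentz_norm M p q G \<le> ennreal (C / c) * ?L"
      using True unfolding lorentz_norm_def[of _ _ _ G] by (auto intro: SUP_least)
  qed (use C c in auto)
next
  case False
  define r where "r = enn2real q"
  have r: "0 < r" using q False by (simp add: r_def enn2real_positive_iff less_top)
  define \<rho> where "\<rho> = 2 powr - ((\<theta> - 1) * r)"
  have \<rho>: "0 < \<rho>" "\<rho> < 1" unfolding \<rho>_def using \<theta> r by (auto intro!: powr_less_one)
  define C1 where "C1 = (C / c) powr r * (1 / (1 - \<rho>))"
  have C1: "0 < C1" using C c \<rho> by (simp add: C1_def)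
  show ?thesis
  proof (intro exI[of _ "C1 powr (1 / r)"] conjI allI impI)
    fix G g assume dom: "level_dominated C c \<theta> G g"
    let ?I = "\<integral>\<^sup>+t. lorentz_density r g t \<partial>lborel"
    let ?s = "\<lambda>j::nat. c * 2 powr - real j"
    let ?h = "\<lambda>(j::nat) t. ennreal (t powr r) * epowr (level_norm M p g (?s j * t)) r * ennreal (1 / t)
          * indicator {0<..} t"
    have "lorentz_density r G t \<le> (\<Sum>j. ennreal (C powr r * 2 powr - (\<theta> * real j * r)) * ?h j t)" for t
    proof (cases "0 < t")
      case t: True
      have "epowr (level_norm M p G t) r \<le> epowr (ennreal C * (SUP j::nat.
          ennreal (2 powr - (\<theta> * real j)) * level_norm M p g (?s j * t))) r"
        using dom t r unfolding level_dominated_def by (intro epowr_mono) auto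
      also have "\<dots> \<le> epowr (ennreal C) r * (\<Sum>j::nat. epowr
          (ennreal (2 powr - (\<theta> * real j)) * level_norm M p g (?s j * t)) r)"
        using r by (subst epowr_mult) (auto intro!: mult_left_mono epowr_SUP_le_suminf)
      also have "\<dots> = (\<Sum>j. ennreal (C powr r * 2 powr - (\<theta> * real j * r)) *
          epowr (level_norm M p g (?s j * t)) r)"
      proof (subst ennreal_suminf_cmult[symmetric], rule arg_cong[where f = suminf], rule ext)
        fix j
        show "epowr (ennreal C) r * epowr (ennreal (2 powr - (\<theta> * real j)) * level_norm M p g (?s j * t)) r
            = ennreal (C powr r * 2 powr - (\<theta> * real j * r)) * epowr (level_norm M p g (?s j * t)) r"
          using r C by (simp add: epowr_mult epowr_ennreal powr_powr ennreal_mult mult.assoc)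
      qed
      finally have le: "epowr (level_norm M p G t) r \<le> (\<Sum>j. ennreal (C powr r * 2 powr - (\<theta> * real j * r)) *
          epowr (level_norm M p g (?s j * t)) r)" .
      have "lorentz_density r G t = ennreal (t powr r) * ennreal (1 / t) * epowr (level_norm M p G t) r"
        using t by (simp add: lorentz_density_def ac_simps)
      also have "\<dots> \<le> ennreal (t powr r) * ennreal (1 / t) * (\<Sum>j. ennreal (C powr r * 2 powr - (\<theta> * real j * r)) *
          epowr (level_norm M p g (?s j * t)) r)"
        by (rule mult_left_mono[OF le]) auto
      also have "\<dots> = (\<Sum>j. ennreal (C powr r * 2 powr - (\<theta> * real j * r)) * ?h j t)"
      proof (subst ennreal_suminf_cmult[symmetric], rule arg_cong[where f = suminf], rule ext)
        fix j
        show "ennreal (t powr r) * ennreal (1 / t) * (ennreal (C powr r * 2 powr - (\<theta> * real j * r)) *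
            epowr (level_norm M p g (?s j * t)) r) = ennreal (C powr r * 2 powr - (\<theta> * real j * r)) * ?h j t"
          using t by (simp add: ac_simps)
      qed
      finally show ?thesis .
    qed (simp add: lorentz_density_def)
    then have "(\<integral>\<^sup>+t. lorentz_density r G t \<partial>lborel)
        \<le> (\<integral>\<^sup>+t. (\<Sum>j. ennreal (C powr r * 2 powr - (\<theta> * real j * r)) * ?h j t) \<partial>lborel)"
      by (intro nn_integral_mono) auto
    also have "\<dots> = (\<Sum>j. ennreal (C powr r * 2 powr - (\<theta> * real j * r)) * (\<integral>\<^sup>+t. ?h j t \<partial>lborel))"
      by (subst nn_integral_suminf) (auto simp: nn_integral_cmult)
    also have "\<dots> = (\<Sum>j. ennreal ((C / c) powr r * \<rho> ^ j) * ?I)"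
    proof (rule arg_cong[where f = suminf], rule ext)
      fix j
      have "C powr r * 2 powr - (\<theta> * real j * r) * (?s j) powr - r = (C / c) powr r * \<rho> ^ j"
      proof -
        have "\<rho> ^ j = 2 powr - ((\<theta> - 1) * r * real j)"
          unfolding \<rho>_def by (simp add: powr_realpow[symmetric] powr_powr)
        moreover have "2 powr - (\<theta> * real j * r) * 2 powr (real j * r) = 2 powr - ((\<theta> - 1) * r * real j)"
          by (simp add: powr_add[symmetric] algebra_simps)
        ultimately show ?thesis
          using C c by (simp add: powr_mult powr_powr powr_divide powr_minus_divide[of c])
      qed
      then show "ennreal (C powr r * 2 powr - (\<theta> * real j * r)) * (\<integral>\<^sup>+t. ?h j t \<partial>lborel)
          = ennreal ((C / c) powr r * \<rho> ^ j) * ?I"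
        using lorentz_density_scale[of "?s j" r g] c
        by (simp add: mult.assoc[symmetric] ennreal_mult'[symmetric])
    qed
    also have "\<dots> = ennreal C1 * ?I"
    proof -
      have "(\<Sum>j. ennreal ((C / c) powr r * \<rho> ^ j)) = ennreal C1"
      proof (rule suminf_ennreal_eq)
        show "(\<lambda>j. (C / c) powr r * \<rho> ^ j) sums C1"
          unfolding C1_def using \<rho> by (intro sums_mult geometric_sums) auto
      qed (use \<rho> in auto)
      then show ?thesis by (simp add: ennreal_suminf_multc)
    qed
    finally have "epowr (\<integral>\<^sup>+t. lorentz_density r G t \<partial>lborel) (1 / r) \<le> epowr (ennreal C1 * ?I) (1 / r)"
      using r by (intro epowr_mono) auto
    then show "lorentz_norm M p q G \<le> ennreal (C1 powr (1 / r)) * lorentz_norm M p q g"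
      using False r C1 by (simp add: lorentz_norm_eq r_def[symmetric] epowr_mult epowr_ennreal)
  qed (use C1 in auto)
qed

lemma level_norm_le_lorentz_norm:
  assumes q: "0 < q"
  shows "\<exists>C>0. \<forall>g t. 0 < t \<longrightarrow> ennreal t * level_norm M p g t \<le> ennreal C * lorentz_norm M p q g"
proof (cases "q = \<infinity>")
  case True
  then show ?thesis
    by (intro exI[of _ 1]) (auto simp: lorentz_norm_def intro!: SUP_upper2)
next
  case False
  define r where "r = enn2real q"
  have r: "0 < r" using q False by (simp add: r_def enn2real_positive_iff less_top)
  define C1 :: real where "C1 = 2 powr r * 2"
  have C1: "0 < C1" by (simp add: C1_def)
  show ?thesis
  proof (intro exI[of _ "C1 powr (1 / r)"] conjI allI impI)
    fix g and t :: real assume t: "0 < t"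
    let ?N = "epowr (level_norm M p g t) r"
    have "ennreal (t powr r) * ?N = ennreal C1 * ((ennreal ((t / 2) powr r) * ?N * ennreal (1 / t))
          * emeasure lborel {t / 2..t})"
    proof -
      have "C1 * ((t / 2) powr r * (1 / t) * (t / 2)) = t powr r"
        using t by (simp add: C1_def powr_divide)
      then have "ennreal (t powr r) = ennreal C1 * (ennreal ((t / 2) powr r) * ennreal (1 / t) * ennreal (t / 2))"
        using t C1 by (simp add: ennreal_mult[symmetric] del: times_divide_eq_right)
      then show ?thesis using t by (simp add: ac_simps)
    qed
    also have "\<dots> = ennreal C1 * (\<integral>\<^sup>+s. (ennreal ((t / 2) powr r) * ?N * ennreal (1 / t))
          * indicator {t / 2..t} s \<partial>lborel)"
      by (simp add: nn_integral_cmult_indicator)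
    also have "\<dots> \<le> ennreal C1 * (\<integral>\<^sup>+s. lorentz_density r g s \<partial>lborel)"
    proof (intro mult_left_mono nn_integral_mono zero_le)
      fix s
      show "(ennreal ((t / 2) powr r) * ?N * ennreal (1 / t)) * indicator {t / 2..t} s
          \<le> lorentz_density r g s"
      proof (cases "s \<in> {t / 2..t}")
        case True
        then have "0 < s" using t by auto
        then show ?thesis unfolding lorentz_density_def using True r t
          by (auto intro!: mult_mono ennreal_leI powr_mono2 epowr_mono level_norm_antimono
              simp: divide_simps)
      qed simp
    qed
    finally have "epowr (ennreal (t powr r) * ?N) (1 / r)
        \<le> epowr (ennreal C1 * (\<integral>\<^sup>+s. lorentz_density r g s \<partial>lborel)) (1 / r)"
      using r by (intro epowr_mono) auto
    then show "ennreal t * level_norm M p g t \<le> ennreal (C1 powr (1 / r)) * lorentz_norm M p q g"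
      using False r C1 t
      by (simp add: lorentz_norm_eq r_def[symmetric] epowr_mult epowr_ennreal epowr_epowr powr_powr)
  qed (use C1 in auto)
qed

lemma AE_finite_of_lorentz_norm:
  assumes [measurable]: "g \<in> borel_measurable M" and q: "0 < q" and fin: "lorentz_norm M p q g < \<infinity>"
  shows "AE x in M. g x < \<infinity>"
proof -
  obtain C where C: "0 < C" and le: "\<And>t. 0 < t \<Longrightarrow>
      ennreal t * level_norm M p g t \<le> ennreal C * lorentz_norm M p q g"
    using level_norm_le_lorentz_norm[OF q] by blast
  obtain L where L: "0 \<le> L" "lorentz_norm M p q g = ennreal L"
    using fin by (cases "lorentz_norm M p q g") auto
  define E where "E = {x \<in> space M. g x = \<infinity>}"
  have E: "E \<in> sets M" unfolding E_def by measurable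
  have "measure M E = 0"
  proof (rule null_of_set_norm_zero[OF E])
    fix e :: real assume e: "0 < e"
    define t where "t = (C * L + 1) / e"
    have t: "0 < t" using C L e by (simp add: t_def add_nonneg_pos)
    have "set_norm E \<le> level_norm M p g t"
      unfolding level_norm_eq by (rule set_norm_mono) (auto simp: E_def)
    then have "ennreal t * set_norm E \<le> ennreal t * level_norm M p g t"
      by (rule mult_left_mono) auto
    also have "\<dots> \<le> ennreal (C * L)" using le[OF t] C L by (simp add: ennreal_mult)
    also have "\<dots> < ennreal (t * e)"
      using e C L by (subst ennreal_less_iff) (auto simp: t_def)
    also have "\<dots> = ennreal t * ennreal e" using t e by (simp add: ennreal_mult)
    finally show "set_norm E < ennreal e"
      by (metis mult_left_mono not_le zero_le)
  qed
  then have "AE x in M. x \<notin> E"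
    using E by (intro AE_not_in) (simp add: null_sets_def emeasure_eq_measure)
  then show ?thesis
    using AE_space by eventually_elim (auto simp: E_def less_top)
qed

end

section \<open>The maximal function and the square function as gauges of the differences\<close>

text \<open>Both operators are suprema of functionals of the first differences.  The two functionals share
  the properties collected here, so that each estimate below is proved once for both.\<close>

definition sum_gauge :: "nat \<Rightarrow> (nat \<Rightarrow> real) \<Rightarrow> real" where
  "sum_gauge m d = \<bar>\<Sum>k\<le>m. d k\<bar>"

definition square_gauge :: "nat \<Rightarrow> (nat \<Rightarrow> real) \<Rightarrow> real" where
  "square_gauge m d = sqrt (\<Sum>k\<le>m. (d k)\<^sup>2)"

definition gauges :: "(nat \<Rightarrow> (nat \<Rightarrow> real) \<Rightarrow> real) set" where
  "gauges = {sum_gauge, square_gauge}"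

definition gauge_sup :: "(nat \<Rightarrow> (nat \<Rightarrow> real) \<Rightarrow> real) \<Rightarrow> (nat \<Rightarrow> real) \<Rightarrow> ennreal" where
  "gauge_sup \<phi> d = (SUP m. ennreal (\<phi> m d))"

lemma sum_gauge_in [simp]: "sum_gauge \<in> gauges" and square_gauge_in [simp]: "square_gauge \<in> gauges"
  by (simp_all add: gauges_def)

lemma gauge_nonneg: "\<phi> \<in> gauges \<Longrightarrow> 0 \<le> \<phi> m d"
  by (auto simp: gauges_def sum_gauge_def square_gauge_def sum_nonneg)

lemma gauge_cong: "\<phi> \<in> gauges \<Longrightarrow> (\<And>k. k \<le> m \<Longrightarrow> d k = e k) \<Longrightarrow> \<phi> m d = \<phi> m e"
  by (auto simp: gauges_def sum_gauge_def square_gauge_def)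

lemma gauge_zero: "\<phi> \<in> gauges \<Longrightarrow> \<phi> m (\<lambda>k. 0) = 0"
  by (auto simp: gauges_def sum_gauge_def square_gauge_def)

lemma gauge_add:
  assumes "\<phi> \<in> gauges"
  shows "\<phi> m (\<lambda>k. d k + e k) \<le> \<phi> m d + \<phi> m e"
  using assms L2_set_triangle_ineq[of d e "{..m}"]
  by (auto simp: gauges_def sum_gauge_def square_gauge_def sum.distrib L2_set_def)

lemma gauge_sum:
  assumes "\<phi> \<in> gauges"
  shows "\<phi> m (\<lambda>k. \<Sum>j<(J::nat). e j k) \<le> (\<Sum>j<J. \<phi> m (e j))"
proof (induction J)
  case (Suc J)
  have "\<phi> m (\<lambda>k. (\<Sum>j<J. e j k) + e J k) \<le> \<phi> m (\<lambda>k. \<Sum>j<J. e j k) + \<phi> m (e J)"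
    by (rule gauge_add[OF assms])
  then show ?case using Suc by simp
qed (simp add: gauge_zero[OF assms])

lemma gauge_before:
  assumes "\<phi> \<in> gauges"
  shows "\<phi> m (\<lambda>k. if k < n then d k else 0) = (if n = 0 then 0 else \<phi> (min m (n - 1)) d)"
proof -
  have *: "(\<Sum>k\<le>m. if k < n then f k else 0) = (if n = 0 then 0 else \<Sum>k\<le>min m (n - 1). f k)"
    for f :: "nat \<Rightarrow> real"
  proof -
    have "(\<Sum>k\<le>m. if k < n then f k else 0) = sum f ({..m} \<inter> {k. k < n})"
      by (simp add: sum.inter_restrict)
    also have "{..m} \<inter> {k. k < n} = (if n = 0 then {} else {..min m (n - 1)})"
      by auto
    finally show ?thesis by simp
  qed
  have "(\<Sum>k\<le>m. (if k < n then d k else 0)\<^sup>2) = (\<Sum>k\<le>m. if k < n then (d k)\<^sup>2 else 0)"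
    by (intro sum.cong) auto
  then show ?thesis
    using assms by (auto simp: gauges_def sum_gauge_def square_gauge_def *)
qed

lemma gauge_single:
  assumes "\<phi> \<in> gauges"
  shows "\<phi> m (\<lambda>k. if k = n then d k else 0) \<le> \<bar>d n\<bar>"
proof -
  have "(\<Sum>k\<le>m. (if k = n then d k else 0)\<^sup>2) = (\<Sum>k\<le>m. if k = n then (d k)\<^sup>2 else 0)"
    by (intro sum.cong) auto
  then show ?thesis
    using assms by (auto simp: gauges_def sum_gauge_def square_gauge_def sum.delta)
qed

lemma gauge_0: "\<phi> \<in> gauges \<Longrightarrow> \<phi> 0 d = \<bar>d 0\<bar>"
  by (auto simp: gauges_def sum_gauge_def square_gauge_def)

lemma gauge_Suc_le:
  assumes "\<phi> \<in> gauges"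
  shows "\<phi> (Suc n) d \<le> \<phi> n d + \<bar>d (Suc n)\<bar>"
proof -
  have "\<phi> (Suc n) d = \<phi> (Suc n) (\<lambda>k. (if k < Suc n then d k else 0) + (if k = Suc n then d k else 0))"
    by (rule gauge_cong[OF assms]) auto
  also have "\<dots> \<le> \<phi> (Suc n) (\<lambda>k. if k < Suc n then d k else 0)
      + \<phi> (Suc n) (\<lambda>k. if k = Suc n then d k else 0)"
    by (rule gauge_add[OF assms])
  also have "\<dots> \<le> \<phi> n d + \<bar>d (Suc n)\<bar>"
    using gauge_single[OF assms, of "Suc n" "Suc n" d] gauge_before[OF assms, of "Suc n" "Suc n" d] by simp
  finally show ?thesis .
qed

lemma gauge_measurable:
  assumes "\<phi> \<in> gauges" and "\<And>k. k \<le> m \<Longrightarrow> e k \<in> borel_measurable G"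
  shows "(\<lambda>x. \<phi> m (\<lambda>k. e k x)) \<in> borel_measurable G"
  using assms(1) unfolding gauges_def
proof (elim insertE emptyE; hypsubst)
  show "(\<lambda>x. sum_gauge m (\<lambda>k. e k x)) \<in> borel_measurable G"
    unfolding sum_gauge_def using assms(2)
    by (intro borel_measurable_abs borel_measurable_sum) auto
  show "(\<lambda>x. square_gauge m (\<lambda>k. e k x)) \<in> borel_measurable G"
    unfolding square_gauge_def using assms(2)
    by (intro measurable_compose[OF _ borel_measurable_sqrt] borel_measurable_sum
        borel_measurable_power) auto
qed

lemma gauge_sup_measurable:
  assumes "\<phi> \<in> gauges" and "\<And>k. e k \<in> borel_measurable G"
  shows "(\<lambda>x. gauge_sup \<phi> (\<lambda>k. e k x)) \<in> borel_measurable G"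
  unfolding gauge_sup_def using gauge_measurable[OF assms(1), of _ e G] assms(2)
  by (intro borel_measurable_SUP measurable_compose[OF _ measurable_ennreal]) auto

lemma less_gauge_sup_iff:
  "\<phi> \<in> gauges \<Longrightarrow> 0 \<le> u \<Longrightarrow> ennreal u < gauge_sup \<phi> d \<longleftrightarrow> (\<exists>m. u < \<phi> m d)"
  unfolding gauge_sup_def less_SUP_iff by (auto simp: ennreal_less_iff)

lemma sum_mdiff: "(\<Sum>k\<le>m. mdiff f k x) = f m x"
  by (induction m) (auto simp: mdiff_def)

lemma gauge_mdiff: "sum_gauge m (\<lambda>k. mdiff f k x) = \<bar>f m x\<bar>"
  "square_gauge m (\<lambda>k. mdiff f k x) = square_fn_upto f m x"
  by (simp_all add: sum_gauge_def sum_mdiff square_gauge_def square_fn_upto_def)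

lemma maximal_fn_eq: "maximal_fn f x = gauge_sup sum_gauge (\<lambda>k. mdiff f k x)"
  by (simp add: maximal_fn_def gauge_sup_def gauge_mdiff)

lemma lim_eq_SUP: "incseq (X :: nat \<Rightarrow> ennreal) \<Longrightarrow> lim X = (SUP n. X n)"
  by (intro limI LIMSEQ_SUP)

lemma square_fn_eq: "square_fn f x = gauge_sup square_gauge (\<lambda>k. mdiff f k x)"
proof -
  have "incseq (\<lambda>n. ennreal (square_fn_upto f n x))"
    unfolding square_fn_upto_def by (intro incseq_SucI ennreal_leI) simp
  then show ?thesis
    by (simp add: square_fn_def gauge_sup_def gauge_mdiff lim_eq_SUP)
qed

section \<open>Square integrable martingale differences\<close>

context atomic_filtration
begin

lemma sigma_finite_F: "sigma_finite_subalgebra M (F n)"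
  by (rule finite_measure_subalgebra_is_sigma_finite, rule finite_measure_subalgebra.intro)
    (rule finite_measure_axioms, rule finite_measure_subalgebra_axioms.intro, rule subalg)

text \<open>Square integrable martingale differences.  The initial term \<open>e 0\<close> is arbitrary; the others are
  orthogonal to the past, which is stated against all test functions that make sense.\<close>

definition mds :: "(nat \<Rightarrow> 'a \<Rightarrow> real) \<Rightarrow> bool" where
  "mds e \<longleftrightarrow> (\<forall>k. e k \<in> borel_measurable (F k) \<and> integrable M (\<lambda>x. (e k x)\<^sup>2)) \<and>
    (\<forall>k h. h \<in> borel_measurable (F k) \<longrightarrow> integrable M (\<lambda>x. h x * e (Suc k) x) \<longrightarrow>
      (\<integral>x. h x * e (Suc k) x \<partial>M) = 0)"

lemma martingale_F_measurable: "martingale M F f \<Longrightarrow> m \<le> n \<Longrightarrow> f m \<in> borel_measurable (F n)"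
  using F_mono_measurable[of m n "f m"] by (auto simp: martingale_def)

lemma mdiff_F_measurable:
  assumes "martingale M F f" "m \<le> n" shows "mdiff f m \<in> borel_measurable (F n)"
proof (cases m)
  case 0
  then have "mdiff f m = f m" by (auto simp: mdiff_def)
  then show ?thesis using martingale_F_measurable[OF assms] by simp
next
  case (Suc k)
  then have "mdiff f m = (\<lambda>x. f m x - f k x)" by (auto simp: mdiff_def)
  then show ?thesis
    using martingale_F_measurable[OF assms] martingale_F_measurable[OF assms(1), of k n] assms(2) Suc
    by simp
qed

lemma mdiff_measurable: "martingale M F f \<Longrightarrow> mdiff f m \<in> borel_measurable M"
  using mdiff_F_measurable[of f m m] F_measurable by auto

lemma mdiff_orthogonal:
  assumes f: "martingale M F f" and h: "h \<in> borel_measurable (F k)"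
    and int: "integrable M (\<lambda>x. h x * mdiff f (Suc k) x)"
  shows "(\<integral>x. h x * mdiff f (Suc k) x \<partial>M) = 0"
proof -
  interpret sigma_finite_subalgebra M "F k" by (rule sigma_finite_F)
  have fi: "integrable M (f k)" "integrable M (f (Suc k))"
    and ce: "AE x in M. real_cond_exp M (F k) (f (Suc k)) x = f k x"
      "AE x in M. real_cond_exp M (F k) (f k) x = f k x"
    using f unfolding martingale_def by auto
  have "mdiff f (Suc k) = (\<lambda>x. f (Suc k) x - f k x)" by (auto simp: mdiff_def)
  then have ce0: "AE x in M. real_cond_exp M (F k) (mdiff f (Suc k)) x = 0"
    using real_cond_exp_diff[OF fi(2,1)] ce by auto
  have "(\<integral>x. h x * mdiff f (Suc k) x \<partial>M)
      = (\<integral>x. h x * real_cond_exp M (F k) (mdiff f (Suc k)) x \<partial>M)"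
    using real_cond_exp_intg(2)[OF int h mdiff_measurable[OF f]] by simp
  also have "\<dots> = (\<integral>x. 0 \<partial>M)"
    using ce0 F_measurable[OF h]
    by (intro integral_cong_AE) auto
  finally show ?thesis by simp
qed

lemma mds_mdiff:
  assumes f: "martingale M F f" and V: "\<And>k. V k \<in> sets (F (k - 1))"
    and int: "\<And>k. (\<integral>\<^sup>+x. ennreal ((indicator (V k) x * mdiff f k x)\<^sup>2) \<partial>M) < \<infinity>"
  shows "mds (\<lambda>k x. indicator (V k) x * mdiff f k x)"
  unfolding mds_def
proof (intro conjI allI impI)
  fix k
  have Vk: "V k \<in> sets (F k)" using V[of k] F_mono[of "k - 1" k] by auto
  show meas: "(\<lambda>x. indicator (V k) x * mdiff f k x) \<in> borel_measurable (F k)"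
    using mdiff_F_measurable[OF f, of k k] Vk by simp
  show "integrable M (\<lambda>x. (indicator (V k) x * mdiff f k x)\<^sup>2)"
  proof (rule integrableI_nonneg)
    show "(\<lambda>x. (indicator (V k) x * mdiff f k x)\<^sup>2) \<in> borel_measurable M"
      using F_measurable[OF meas] by measurable
  qed (use int[of k] in auto)
next
  fix k h assume h: "h \<in> borel_measurable (F k)"
    and int: "integrable M (\<lambda>x. h x * (indicator (V (Suc k)) x * mdiff f (Suc k) x))"
  have "(\<lambda>x. h x * indicator (V (Suc k)) x) \<in> borel_measurable (F k)"
    using h V[of "Suc k"] by simp
  from mdiff_orthogonal[OF f this] int
  show "(\<integral>x. h x * (indicator (V (Suc k)) x * mdiff f (Suc k) x) \<partial>M) = 0"
    by (simp add: mult.assoc)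
qed

lemma mds_indicator:
  assumes e: "mds e" and V: "\<And>k. V k \<in> sets (F (k - 1))"
  shows "mds (\<lambda>k x. indicator (V k) x * e k x)"
  unfolding mds_def
proof (intro conjI allI impI)
  fix k
  have Vk: "V k \<in> sets (F k)" using V[of k] F_mono[of "k - 1" k] by auto
  show meas: "(\<lambda>x. indicator (V k) x * e k x) \<in> borel_measurable (F k)"
    using e Vk by (intro borel_measurable_times borel_measurable_indicator) (auto simp: mds_def)
  show "integrable M (\<lambda>x. (indicator (V k) x * e k x)\<^sup>2)"
  proof (rule Bochner_Integration.integrable_bound)
    show "integrable M (\<lambda>x. (e k x)\<^sup>2)" using e by (simp add: mds_def)
    show "(\<lambda>x. (indicator (V k) x * e k x)\<^sup>2) \<in> borel_measurable M"
      using F_measurable[OF meas] by measurable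
  qed (auto simp: indicator_def)
next
  fix k h assume h: "h \<in> borel_measurable (F k)"
    and int: "integrable M (\<lambda>x. h x * (indicator (V (Suc k)) x * e (Suc k) x))"
  have "(\<lambda>x. h x * indicator (V (Suc k)) x) \<in> borel_measurable (F k)"
    using h V[of "Suc k"] by simp
  with e int show "(\<integral>x. h x * (indicator (V (Suc k)) x * e (Suc k) x) \<partial>M) = 0"
    unfolding mds_def by (simp add: mult.assoc[symmetric])
qed

lemma integrable_square_product:
  fixes g h :: "'a \<Rightarrow> real"
  assumes [measurable]: "g \<in> borel_measurable M" "h \<in> borel_measurable M"
    and "integrable M (\<lambda>x. (g x)\<^sup>2)" "integrable M (\<lambda>x. (h x)\<^sup>2)"
  shows "integrable M (\<lambda>x. g x * h x)"
proof (rule Bochner_Integration.integrable_bound)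
  show "integrable M (\<lambda>x. (g x)\<^sup>2 + (h x)\<^sup>2)" using assms by auto
  show "AE x in M. norm (g x * h x) \<le> norm ((g x)\<^sup>2 + (h x)\<^sup>2)"
  proof (rule AE_I2)
    fix x
    have "2 * (\<bar>g x\<bar> * \<bar>h x\<bar>) \<le> (g x)\<^sup>2 + (h x)\<^sup>2"
      using sum_squares_bound[of "\<bar>g x\<bar>" "\<bar>h x\<bar>"] by simp
    moreover have "0 \<le> \<bar>g x\<bar> * \<bar>h x\<bar>" by simp
    ultimately have "\<bar>g x\<bar> * \<bar>h x\<bar> \<le> (g x)\<^sup>2 + (h x)\<^sup>2" by linarith
    then show "norm (g x * h x) \<le> norm ((g x)\<^sup>2 + (h x)\<^sup>2)"
      by (simp add: abs_mult)
  qed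
qed measurable

lemma mds_sum_measurable: "mds e \<Longrightarrow> j \<le> n \<Longrightarrow> (\<lambda>x. \<Sum>k\<le>j. e k x) \<in> borel_measurable (F n)"
  by (rule borel_measurable_sum) (auto simp: mds_def intro: F_mono_measurable[OF order_trans])

lemma mds_pythagoras:
  assumes e: "mds e"
  shows "integrable M (\<lambda>x. (\<Sum>k\<le>m. e k x)\<^sup>2)"
    and "(\<integral>x. (\<Sum>k\<le>m. e k x)\<^sup>2 \<partial>M) = (\<Sum>k\<le>m. \<integral>x. (e k x)\<^sup>2 \<partial>M)"
proof (induction m)
  case 0
  { case 1 show ?case using e by (simp add: mds_def) }
  { case 2 show ?case by simp }
next
  case (Suc m)
  let ?g = "\<lambda>x. \<Sum>k\<le>m. e k x"
  have g: "?g \<in> borel_measurable (F m)" by (rule mds_sum_measurable[OF e]) simp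
  have e2: "integrable M (\<lambda>x. (e (Suc m) x)\<^sup>2)" "e (Suc m) \<in> borel_measurable (F (Suc m))"
    using e by (auto simp: mds_def)
  have ge: "integrable M (\<lambda>x. ?g x * e (Suc m) x)"
    using F_measurable[OF g] F_measurable[OF e2(2)] Suc(1) e2(1)
    by (rule integrable_square_product)
  have ge0: "(\<integral>x. ?g x * e (Suc m) x \<partial>M) = 0"
    using e g ge unfolding mds_def by blast
  have eq: "(\<Sum>k\<le>Suc m. e k x)\<^sup>2 = (?g x)\<^sup>2 + 2 * (?g x * e (Suc m) x) + (e (Suc m) x)\<^sup>2" for x
    by (simp add: power2_sum algebra_simps)
  { case 1 show ?case unfolding eq using Suc(1) ge e2(1) by (intro Bochner_Integration.integrable_add integrable_mult_right) auto }
  { case 2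
    have "(\<integral>x. (?g x)\<^sup>2 + 2 * (?g x * e (Suc m) x) + (e (Suc m) x)\<^sup>2 \<partial>M)
      = (\<integral>x. (?g x)\<^sup>2 \<partial>M) + 2 * (\<integral>x. ?g x * e (Suc m) x \<partial>M) + (\<integral>x. (e (Suc m) x)\<^sup>2 \<partial>M)"
      using Suc(1) ge e2(1) by simp
    then show ?case unfolding eq using Suc(2) ge0 by simp }
qed

lemma mds_pythagoras_nn:
  assumes e: "mds e"
  shows "(\<Sum>k\<le>m. \<integral>\<^sup>+x. ennreal ((e k x)\<^sup>2) \<partial>M) = (\<integral>\<^sup>+x. ennreal ((\<Sum>k\<le>m. e k x)\<^sup>2) \<partial>M)"
proof -
  have "(\<Sum>k\<le>m. \<integral>\<^sup>+x. ennreal ((e k x)\<^sup>2) \<partial>M) = (\<Sum>k\<le>m. ennreal (\<integral>x. (e k x)\<^sup>2 \<partial>M))"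
    using e by (intro sum.cong nn_integral_eq_integral) (auto simp: mds_def)
  also have "\<dots> = ennreal (\<integral>x. (\<Sum>k\<le>m. e k x)\<^sup>2 \<partial>M)"
    unfolding mds_pythagoras(2)[OF e] by (rule sum_ennreal) simp
  also have "\<dots> = (\<integral>\<^sup>+x. ennreal ((\<Sum>k\<le>m. e k x)\<^sup>2) \<partial>M)"
    by (intro nn_integral_eq_integral[symmetric] mds_pythagoras(1)[OF e]) auto
  finally show ?thesis .
qed

text \<open>Kolmogorov's maximal inequality: stopping the partial sums when they first exceed \<open>u\<close> amounts
  to multiplying the differences by predictable indicators.\<close>

lemma mds_maximal_inequality:
  assumes e: "mds e" and u: "0 < u"
  shows "ennreal (u\<^sup>2) * emeasure M {x \<in> space M. \<exists>j\<le>m. u < \<bar>\<Sum>k\<le>j. e k x\<bar>}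
    \<le> (\<Sum>k\<le>m. \<integral>\<^sup>+x. ennreal ((e k x)\<^sup>2) \<partial>M)"
proof -
  define V where "V k = {x \<in> space M. \<forall>j\<in>{..<k}. \<bar>\<Sum>i\<le>j. e i x\<bar> \<le> u}" for k
  have V: "V k \<in> sets (F (k - 1))" for k
  proof -
    have "{x \<in> space (F (k - 1)). \<forall>j\<in>{..<k}. \<bar>\<Sum>i\<le>j. e i x\<bar> \<le> u} \<in> sets (F (k - 1))"
    proof (rule sets.sets_Collect_finite_All)
      fix j assume "j \<in> {..<k}"
      then have [measurable]: "(\<lambda>x. \<Sum>i\<le>j. e i x) \<in> borel_measurable (F (k - 1))"
        by (intro mds_sum_measurable[OF e]) auto
      show "{x \<in> space (F (k - 1)). \<bar>\<Sum>i\<le>j. e i x\<bar> \<le> u} \<in> sets (F (k - 1))"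
        by measurable
    qed simp
    then show ?thesis unfolding V_def F_space .
  qed
  let ?e = "\<lambda>k x. indicator (V k) x * e k x"
  have e': "mds ?e" by (rule mds_indicator[OF e V])
  let ?B = "{x \<in> space M. \<exists>j\<le>m. u < \<bar>\<Sum>k\<le>j. e k x\<bar>}"
  have B: "?B \<in> sets M"
  proof -
    define g where "g j x = (\<Sum>i\<le>j. e i x)" for j x
    have [measurable]: "g j \<in> borel_measurable M" for j
      unfolding g_def[abs_def] by (rule F_measurable[OF mds_sum_measurable[OF e order_refl]])
    have "(\<Union>j\<in>{..m}. {x \<in> space M. u < \<bar>g j x\<bar>}) \<in> sets M"
      by (intro sets.finite_UN) auto
    also have "(\<Union>j\<in>{..m}. {x \<in> space M. u < \<bar>g j x\<bar>}) = ?B"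
      unfolding g_def by auto
    finally show ?thesis .
  qed
  have "ennreal (u\<^sup>2) * emeasure M ?B = (\<integral>\<^sup>+x. ennreal (u\<^sup>2) * indicator ?B x \<partial>M)"
    by (rule nn_integral_cmult_indicator[OF B, symmetric])
  also have "\<dots> \<le> (\<integral>\<^sup>+x. ennreal ((\<Sum>k\<le>m. ?e k x)\<^sup>2) \<partial>M)"
  proof (rule nn_integral_mono)
    fix x
    show "ennreal (u\<^sup>2) * indicator ?B x \<le> ennreal ((\<Sum>k\<le>m. ?e k x)\<^sup>2)"
    proof (cases "x \<in> ?B")
      case True
      define j where "j = (LEAST j. u < \<bar>\<Sum>k\<le>j. e k x\<bar>)"
      obtain i where i: "i \<le> m" "u < \<bar>\<Sum>k\<le>i. e k x\<bar>" using True by auto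
      have j: "u < \<bar>\<Sum>k\<le>j. e k x\<bar>" unfolding j_def using i(2) by (rule LeastI)
      have jm: "j \<le> m" using i Least_le[of "\<lambda>j. u < \<bar>\<Sum>k\<le>j. e k x\<bar>" i] by (simp add: j_def)
      have "x \<in> V k \<longleftrightarrow> k \<le> j" for k
      proof
        assume "x \<in> V k"
        then show "k \<le> j" using j unfolding V_def by (auto simp: not_le[symmetric])
      next
        assume "k \<le> j"
        then show "x \<in> V k" using True not_less_Least[of _ "\<lambda>j. u < \<bar>\<Sum>k\<le>j. e k x\<bar>"]
          unfolding V_def j_def by (auto simp: not_less)
      qed
      then have "(\<Sum>k\<le>m. ?e k x) = (\<Sum>k\<le>m. if k \<in> {..j} then e k x else 0)"
        by (intro sum.cong) (auto simp: indicator_def)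
      also have "\<dots> = (\<Sum>k\<le>j. e k x)"
        using jm by (subst sum.inter_restrict[symmetric]) (auto intro!: sum.cong)
      finally have "u\<^sup>2 \<le> (\<Sum>k\<le>m. ?e k x)\<^sup>2"
        using j u by (simp add: abs_le_square_iff[symmetric])
      then show ?thesis using True by (simp add: ennreal_leI)
    qed simp
  qed
  also have "\<dots> = (\<Sum>k\<le>m. \<integral>\<^sup>+x. ennreal ((?e k x)\<^sup>2) \<partial>M)"
    by (rule mds_pythagoras_nn[OF e', symmetric])
  also have "\<dots> \<le> (\<Sum>k\<le>m. \<integral>\<^sup>+x. ennreal ((e k x)\<^sup>2) \<partial>M)"
    by (intro sum_mono nn_integral_mono) (auto simp: indicator_def)
  finally show ?thesis .
qed

lemma mds_weak_type:
  assumes \<phi>: "\<phi> \<in> gauges" and e: "mds e" and u: "0 < u"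
  shows "ennreal (u\<^sup>2) * emeasure M {x \<in> space M. ennreal u < gauge_sup \<phi> (\<lambda>k. e k x)}
    \<le> (\<Sum>k. \<integral>\<^sup>+x. ennreal ((e k x)\<^sup>2) \<partial>M)"
proof -
  have [measurable]: "e k \<in> borel_measurable M" for k
    using e F_measurable by (auto simp: mds_def)
  have gm [measurable]: "(\<lambda>x. \<phi> j (\<lambda>k. e k x)) \<in> borel_measurable M" for j
    by (rule gauge_measurable[OF \<phi>]) simp
  define B where "B m = {x \<in> space M. \<exists>j\<le>m. u < \<phi> j (\<lambda>k. e k x)}" for m
  have B [measurable]: "B m \<in> sets M" for m
  proof -
    have "(\<Union>j\<in>{..m}. {x \<in> space M. u < \<phi> j (\<lambda>k. e k x)}) \<in> sets M"
      by (intro sets.finite_UN) auto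
    also have "(\<Union>j\<in>{..m}. {x \<in> space M. u < \<phi> j (\<lambda>k. e k x)}) = B m"
      unfolding B_def by auto
    finally show ?thesis .
  qed
  have Bm: "ennreal (u\<^sup>2) * emeasure M (B m) \<le> (\<Sum>k\<le>m. \<integral>\<^sup>+x. ennreal ((e k x)\<^sup>2) \<partial>M)" for m
    using \<phi> unfolding gauges_def
  proof (elim insertE emptyE)
    assume "\<phi> = sum_gauge"
    then show ?thesis
      using mds_maximal_inequality[OF e u, of m] by (simp add: B_def sum_gauge_def)
  next
    assume \<phi>: "\<phi> = square_gauge"
    have "ennreal (u\<^sup>2) * emeasure M (B m) = (\<integral>\<^sup>+x. ennreal (u\<^sup>2) * indicator (B m) x \<partial>M)"
      by (simp add: nn_integral_cmult_indicator)
    also have "\<dots> \<le> (\<integral>\<^sup>+x. (\<Sum>k\<le>m. ennreal ((e k x)\<^sup>2)) \<partial>M)"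
    proof (rule nn_integral_mono)
      fix x
      show "ennreal (u\<^sup>2) * indicator (B m) x \<le> (\<Sum>k\<le>m. ennreal ((e k x)\<^sup>2))"
      proof (cases "x \<in> B m")
        case True
        then obtain j where j: "j \<le> m" "u < sqrt (\<Sum>k\<le>j. (e k x)\<^sup>2)"
          by (auto simp: B_def \<phi> square_gauge_def)
        then have "u\<^sup>2 \<le> (sqrt (\<Sum>k\<le>j. (e k x)\<^sup>2))\<^sup>2" using u by (intro power_mono) auto
        also have "\<dots> = (\<Sum>k\<le>j. (e k x)\<^sup>2)" by (simp add: sum_nonneg)
        also have "\<dots> \<le> (\<Sum>k\<le>m. (e k x)\<^sup>2)" using j by (intro sum_mono2) auto
        finally show ?thesis using True by (simp add: ennreal_leI)
      qed simp
    qed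
    also have "\<dots> = (\<Sum>k\<le>m. \<integral>\<^sup>+x. ennreal ((e k x)\<^sup>2) \<partial>M)"
      by (rule nn_integral_sum) measurable
    finally show ?thesis .
  qed
  have "{x \<in> space M. ennreal u < gauge_sup \<phi> (\<lambda>k. e k x)} = (\<Union>m. B m)"
    using less_gauge_sup_iff[OF \<phi>] u by (auto simp: B_def)
  moreover have "emeasure M (\<Union>m. B m) = (SUP m. emeasure M (B m))"
    by (rule SUP_emeasure_incseq[symmetric]) (auto simp: B_def incseq_def intro: order_trans)
  ultimately have "ennreal (u\<^sup>2) * emeasure M {x \<in> space M. ennreal u < gauge_sup \<phi> (\<lambda>k. e k x)}
      = (SUP m. ennreal (u\<^sup>2) * emeasure M (B m))"
    by (simp add: SUP_mult_left_ennreal)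
  also have "\<dots> \<le> (\<Sum>k. \<integral>\<^sup>+x. ennreal ((e k x)\<^sup>2) \<partial>M)"
  proof (rule SUP_least)
    fix m
    have "(\<Sum>k\<le>m. \<integral>\<^sup>+x. ennreal ((e k x)\<^sup>2) \<partial>M) \<le> (\<Sum>k. \<integral>\<^sup>+x. ennreal ((e k x)\<^sup>2) \<partial>M)"
      by (rule sum_le_suminf) auto
    with Bm[of m] show "ennreal (u\<^sup>2) * emeasure M (B m) \<le> (\<Sum>k. \<integral>\<^sup>+x. ennreal ((e k x)\<^sup>2) \<partial>M)"
      by (rule order_trans)
  qed
  finally show ?thesis .
qed

end

section \<open>Good-lambda inequalities\<close>

context atomic_filtration
begin

text \<open>For every level \<open>t\<close>, the sets \<open>disjointed U n\<close>, on which the sequence \<open>U\<close> is entered at time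
  \<open>n\<close>, cover the points where \<open>G\<close> exceeds \<open>2 * t\<close>, and on every atom contained in them it is unlikely
  that \<open>G\<close> exceeds \<open>2 * t\<close> while \<open>g\<close> is at most \<open>\<gamma> * t\<close>.\<close>

definition good_lambda :: "('a \<Rightarrow> ennreal) \<Rightarrow> ('a \<Rightarrow> ennreal) \<Rightarrow> bool" where
  "good_lambda G g \<longleftrightarrow> (\<forall>t>0. \<forall>\<gamma>>0. \<gamma> \<le> 1 / 4 \<longrightarrow>
    (\<exists>U. (\<forall>n. U n \<in> sets (F n) \<and> U n \<subseteq> {x \<in> space M. ennreal t < G x}) \<and>
      (AE x in M. ennreal (2 * t) < G x \<longrightarrow> x \<in> (\<Union>n. U n)) \<and>
      (\<forall>n A. is_atom M (F n) A \<longrightarrow> A \<subseteq> disjointed U n \<longrightarrow>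
        measure M ({x \<in> space M. ennreal (2 * t) < G x \<and> g x \<le> ennreal (\<gamma> * t)} \<inter> A)
          \<le> 16 * \<gamma>\<^sup>2 * measure M A)))"

lemma disjointed_F_sets:
  assumes "\<And>n. U n \<in> sets (F n)"
  shows "disjointed U n \<in> sets (F n)"
proof -
  have "(\<Union>i\<in>{0..<n}. U i) \<in> sets (F n)"
  proof (rule sets.finite_UN)
    fix i assume "i \<in> {0..<n}"
    then show "U i \<in> sets (F n)" using assms[of i] F_mono[of i n] by auto
  qed simp
  then show ?thesis unfolding disjointed_def using assms[of n] by auto
qed

lemma norm_factor_small:
  assumes "0 < \<delta>"
  shows "\<exists>x0>0. \<forall>x. 0 < x \<longrightarrow> x \<le> x0 \<longrightarrow> norm_factor x \<le> \<delta>"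
proof (intro exI[of _ "min 1 (\<delta> powr b)"] conjI allI impI)
  fix x :: real assume x: "0 < x" "x \<le> min 1 (\<delta> powr b)"
  have "x powr (1 / a) \<le> x powr (1 / b)"
    using x a_pos a_le_b by (intro powr_mono') (auto simp: divide_simps)
  then have "norm_factor x = x powr (1 / b)" by (simp add: norm_factor_def)
  also have "\<dots> \<le> (\<delta> powr b) powr (1 / b)" using x b_pos by (intro powr_mono2) auto
  also have "\<dots> = \<delta>" using assms b_pos by (simp add: powr_powr)
  finally show "norm_factor x \<le> \<delta>" .
qed (use assms in auto)

lemma ennreal_max_mult: "c * max x y = max (c * x) (c * y)" for c x y :: ennreal
  by (rule max_of_mono[symmetric]) (auto intro!: monoI mult_left_mono)

text \<open>For small \<open>\<gamma>\<close> the norm at level \<open>2 * t\<close> is at most the maximum of a multiple of the norm of a level of \<open>g\<close>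
  and a quarter of the norm at level \<open>t\<close>.  Iterating downwards loses nothing in the limit, because
  the norm of every set is at most \<open>1\<close>; no integrability of \<open>G\<close> is required.\<close>

lemma level_dominated_of_good_lambda:
  "\<exists>C>0. \<exists>c>0. c \<le> 1 / 8 \<and> (\<forall>G\<in>borel_measurable M. \<forall>g\<in>borel_measurable M.
    good_lambda G g \<longrightarrow> level_dominated C c 2 G g)"
proof -
  obtain B where B: "0 < B" and Un: "\<And>E E'. E \<in> sets M \<Longrightarrow> E' \<in> sets M \<Longrightarrow>
    set_norm (E \<union> E') \<le> ennreal B * max (set_norm E) (set_norm E')"
    using set_norm_Un_le by blast
  define O1 where "O1 = osc_const 1 * 1"
  have O1: "0 < O1" using osc_const_pos[of 1] by (simp add: O1_def)
  obtain x0 where x0: "0 < x0" and small: "\<And>x. 0 < x \<Longrightarrow> x \<le> x0 \<Longrightarrow> norm_factor x \<le> 1 / (4 * B)"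
    using norm_factor_small[of "1 / (4 * B)"] B by auto
  \<comment> \<open>small enough for the factor of the previous level, including the constant \<open>B\<close> of the union,
    to be at most \<open>1 / 4\<close>\<close>
  define \<gamma> where "\<gamma> = min (1 / 4) (sqrt (x0 / (16 * O1)))"
  have \<gamma>: "0 < \<gamma>" "\<gamma> \<le> 1 / 4" using x0 O1 by (auto simp: \<gamma>_def)
  have "\<gamma>\<^sup>2 \<le> (sqrt (x0 / (16 * O1)))\<^sup>2" using \<gamma> by (intro power_mono) (auto simp: \<gamma>_def)
  then have "\<gamma>\<^sup>2 \<le> x0 / (16 * O1)" using x0 O1 by simp
  then have "O1 * (16 * \<gamma>\<^sup>2) \<le> x0" using O1 by (simp add: field_simps)
  then have nf: "norm_factor (O1 * (16 * \<gamma>\<^sup>2)) \<le> 1 / (4 * B)"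
    using O1 \<gamma> by (intro small) auto
  show ?thesis
  proof (rule exI[of _ B], intro conjI B, rule exI[of _ "\<gamma> / 2"], intro conjI ballI impI)
    fix G g assume [measurable]: "G \<in> borel_measurable M" "g \<in> borel_measurable M"
      and gl: "good_lambda G g"
    let ?N = "level_norm M p G" and ?n = "level_norm M p g"
    have step: "?N (2 * t) \<le> max (ennreal B * ?n (\<gamma> * t)) (ennreal (1 / 4) * ?N t)" if t: "0 < t" for t
    proof -
      obtain U where U: "\<And>n. U n \<in> sets (F n)" "\<And>n. U n \<subseteq> {x \<in> space M. ennreal t < G x}"
        and cover: "AE x in M. ennreal (2 * t) < G x \<longrightarrow> x \<in> (\<Union>n. U n)"
        and bound: "\<And>n A. is_atom M (F n) A \<Longrightarrow> A \<subseteq> disjointed U n \<Longrightarrow>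
          measure M ({x \<in> space M. ennreal (2 * t) < G x \<and> g x \<le> ennreal (\<gamma> * t)} \<inter> A)
            \<le> 16 * \<gamma>\<^sup>2 * measure M A"
        using gl[unfolded good_lambda_def, rule_format, OF t \<gamma>] by blast
      let ?E = "{x \<in> space M. ennreal (2 * t) < G x \<and> g x \<le> ennreal (\<gamma> * t)}"
      let ?Gt = "{x \<in> space M. ennreal t < G x}"
      have "set_norm ?E \<le> ennreal (norm_factor (osc_const 1 * 1 * (16 * \<gamma>\<^sup>2))) * set_norm ?Gt"
      proof (rule set_norm_comparison[where D = "disjointed U"])
        show "disjointed U n \<in> sets (F n)" for n by (rule disjointed_F_sets[OF U(1)])
        show "disjoint_family (disjointed U)" by (rule disjoint_family_disjointed)
        show "AE x in M. x \<in> ?E \<longrightarrow> x \<in> (\<Union>n. disjointed U n)"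
          unfolding UN_disjointed_eq using cover by (auto elim!: eventually_mono)
        fix n A assume A: "is_atom M (F n) A" "A \<subseteq> disjointed U n"
        show "measure M (?E \<inter> A) \<le> 16 * \<gamma>\<^sup>2 * measure M A" by (rule bound[OF A])
        have "?Gt \<inter> A = A" using A(2) U(2)[of n] disjointed_subset[of U n] by blast
        then show "measure M A \<le> 1 * measure M (?Gt \<inter> A)" by simp
      next
        show "?E \<in> sets M" "?Gt \<in> sets M" by measurable
      qed (use \<gamma> in auto)
      also have "\<dots> \<le> ennreal (1 / (4 * B)) * ?N t"
        using nf unfolding O1_def level_norm_eq by (intro mult_right_mono ennreal_leI) auto
      finally have E: "set_norm ?E \<le> ennreal (1 / (4 * B)) * ?N t" .
      have "?N (2 * t) \<le> set_norm ({x \<in> space M. ennreal (\<gamma> * t) < g x} \<union> ?E)"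
        unfolding level_norm_eq by (rule set_norm_mono) (auto simp: not_less)
      also have "\<dots> \<le> ennreal B * max (?n (\<gamma> * t)) (set_norm ?E)"
        unfolding level_norm_eq by (rule Un) measurable
      also have "\<dots> \<le> ennreal B * max (?n (\<gamma> * t)) (ennreal (1 / (4 * B)) * ?N t)"
        using E by (intro mult_left_mono max.mono) auto
      also have "\<dots> = max (ennreal B * ?n (\<gamma> * t)) (ennreal B * (ennreal (1 / (4 * B)) * ?N t))"
        by (rule ennreal_max_mult)
      also have "ennreal B * (ennreal (1 / (4 * B)) * ?N t) = ennreal (1 / 4) * ?N t"
        using B by (simp add: mult.assoc[symmetric] ennreal_mult[symmetric])
      finally show ?thesis .
    qed
    define S where "S t = (SUP j::nat. ennreal (2 powr - (2 * real j)) * ?n (\<gamma> / 2 * 2 powr - real j * t))"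
      for t
    have S_shift: "ennreal (1 / 4) * S (t / 2) \<le> S t" for t
    proof -
      have "ennreal (1 / 4) * S (t / 2) = (SUP j::nat. ennreal (1 / 4) *
          (ennreal (2 powr - (2 * real j)) * ?n (\<gamma> / 2 * 2 powr - real j * (t / 2))))"
        unfolding S_def by (rule SUP_mult_left_ennreal)
      also have "\<dots> \<le> S t"
      proof (rule SUP_least)
        fix j :: nat
        have "(2::real) powr - (2 * real (Suc j)) = 1 / 4 * 2 powr - (2 * real j)"
          using powr_add[of 2 "-2" "- (2 * real j)"] by (simp add: powr_minus_divide algebra_simps)
        moreover have "(2::real) powr - real (Suc j) = 2 powr - real j / 2"
          using powr_add[of 2 "-1" "- real j"] by (simp add: powr_minus_divide algebra_simps)
        ultimately have "ennreal (1 / 4) * ennreal (2 powr - (2 * real j))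
            = ennreal (2 powr - (2 * real (Suc j)))"
          and "\<gamma> / 2 * 2 powr - real j * (t / 2) = \<gamma> / 2 * 2 powr - real (Suc j) * t"
          by (simp_all only: ennreal_mult[symmetric]) (simp_all add: ennreal_mult[symmetric])
        then have "ennreal (1 / 4) *
          (ennreal (2 powr - (2 * real j)) * ?n (\<gamma> / 2 * 2 powr - real j * (t / 2)))
          = ennreal (2 powr - (2 * real (Suc j))) * ?n (\<gamma> / 2 * 2 powr - real (Suc j) * t)"
          by (simp only: mult.assoc[symmetric])
        also have "\<dots> \<le> S t" unfolding S_def by (rule SUP_upper) auto
        finally show "ennreal (1 / 4) *
          (ennreal (2 powr - (2 * real j)) * ?n (\<gamma> / 2 * 2 powr - real j * (t / 2))) \<le> S t" .
      qed
      finally show ?thesis .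
    qed
    have S0: "?n (\<gamma> * (t / 2)) \<le> S t" for t
      unfolding S_def by (rule SUP_upper2[of 0]) auto
    have iter: "0 < t \<Longrightarrow> ?N t \<le> max (ennreal B * S t) (ennreal ((1 / 4) ^ J))" for J t
    proof (induction J arbitrary: t)
      case 0
      then show ?case using level_norm_le_1[of G t] by (simp add: le_max_iff_disj)
    next
      case (Suc J)
      have "?N t \<le> max (ennreal B * ?n (\<gamma> * (t / 2))) (ennreal (1 / 4) * ?N (t / 2))"
        using step[of "t / 2"] Suc.prems by simp
      also have "\<dots> \<le> max (ennreal B * S t)
          (ennreal (1 / 4) * max (ennreal B * S (t / 2)) (ennreal ((1 / 4) ^ J)))"
        using S0[of t] Suc.IH[of "t / 2"] Suc.prems by (intro max.mono mult_left_mono) auto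
      also have "\<dots> = max (ennreal B * S t)
          (max (ennreal B * (ennreal (1 / 4) * S (t / 2))) (ennreal ((1 / 4) ^ Suc J)))"
        by (simp add: ennreal_max_mult ennreal_mult[symmetric] mult.left_commute)
      also have "\<dots> \<le> max (ennreal B * S t) (max (ennreal B * S t) (ennreal ((1 / 4) ^ Suc J)))"
        using S_shift[of t] by (intro max.mono mult_left_mono) auto
      finally show ?case by simp
    qed
    show "level_dominated B (\<gamma> / 2) 2 G g"
      unfolding level_dominated_def
    proof (intro allI impI)
      fix t :: real assume t: "0 < t"
      have "?N t \<le> ennreal B * S t"
      proof (rule ccontr)
        assume neg: "\<not> ?thesis"
        have le: "?N t \<le> ennreal ((1 / 4) ^ J)" for J
          using iter[OF t, of J] neg by (auto simp: le_max_iff_disj)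
        have "(\<lambda>J. ennreal ((1 / 4) ^ J)) \<longlonglongrightarrow> ennreal 0"
          by (intro tendsto_ennrealI LIMSEQ_realpow_zero) auto
        then have "?N t \<le> ennreal 0" by (rule LIMSEQ_le_const) (use le in auto)
        then show False using neg by simp
      qed
      then show "level_norm M p G t \<le> ennreal B * (SUP j::nat. ennreal (2 powr - (2 * real j)) *
          level_norm M p g (\<gamma> / 2 * 2 powr - real j * t))" unfolding S_def .
    qed
  qed (use B \<gamma> in auto)
qed

section \<open>Martingales with predictable controls\<close>

text \<open>The part of \<open>A\<close> on which the \<open>k\<close>-th difference is kept, when one starts after time \<open>n\<close> and stops
  before the control exceeds \<open>\<tau>\<close>.  It is known at time \<open>k - 1\<close>.\<close>

definition window :: "(nat \<Rightarrow> 'a \<Rightarrow> real) \<Rightarrow> real \<Rightarrow> nat \<Rightarrow> 'a set \<Rightarrow> nat \<Rightarrow> 'a set" where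
  "window l \<tau> n A k = (if n < k then A \<inter> {x \<in> space M. l (k - 1) x \<le> \<tau>} else {})"

text \<open>The common consequence of the two kinds of control: the jumps are predictably bounded, and
  while the control is at most \<open>\<tau>\<close> the conditional quadratic variation after time \<open>n\<close> is of
  order \<open>\<tau>\<^sup>2\<close>.\<close>

definition controlled :: "(nat \<Rightarrow> 'a \<Rightarrow> real) \<Rightarrow> (nat \<Rightarrow> 'a \<Rightarrow> real) \<Rightarrow> bool" where
  "controlled f l \<longleftrightarrow> l \<in> control_seqs M F \<and> (AE x in M. \<bar>f 0 x\<bar> \<le> l 0 x) \<and>
    (\<forall>n. AE x in M. \<bar>mdiff f (Suc n) x\<bar> \<le> 2 * l n x) \<and>
    (\<forall>\<tau>>0. \<forall>n. \<forall>A\<in>sets (F n).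
      (\<Sum>k. \<integral>\<^sup>+x. ennreal ((indicator (window l \<tau> n A k) x * mdiff f k x)\<^sup>2) \<partial>M)
        \<le> ennreal (4 * \<tau>\<^sup>2) * emeasure M A)"

lemma control_mono:
  assumes "l \<in> control_seqs M F" "x \<in> space M" "m \<le> n"
  shows "l m x \<le> l n x"
  by (rule lift_Suc_mono_le[of "\<lambda>n. l n x", OF _ assms(3)])
    (use assms(1,2) in \<open>auto simp: control_seqs_def\<close>)

lemma control_limit_eq:
  assumes "l \<in> control_seqs M F" "x \<in> space M"
  shows "control_limit l x = (SUP n. ennreal (l n x))"
  unfolding control_limit_def
  by (intro lim_eq_SUP incseq_SucI ennreal_leI) (use assms in \<open>auto simp: control_seqs_def\<close>)

lemma control_limit_measurable:
  assumes "l \<in> control_seqs M F"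
  shows "control_limit l \<in> borel_measurable M"
proof -
  have "l n \<in> borel_measurable M" for n
    using assms F_measurable by (auto simp: control_seqs_def)
  then have "(\<lambda>x. SUP n. ennreal (l n x)) \<in> borel_measurable M"
    by (intro borel_measurable_SUP measurable_compose[OF _ measurable_ennreal]) auto
  then show ?thesis
    by (rule measurable_cong[THEN iffD1, rotated]) (simp add: control_limit_eq[OF assms])
qed

lemma control_le_of_limit:
  assumes "l \<in> control_seqs M F" "x \<in> space M" "control_limit l x \<le> ennreal \<tau>" "0 \<le> \<tau>"
  shows "l n x \<le> \<tau>"
proof -
  have "ennreal (l n x) \<le> (SUP n. ennreal (l n x))" by (rule SUP_upper) auto
  then have "ennreal (l n x) \<le> ennreal \<tau>"
    using assms(3) unfolding control_limit_eq[OF assms(1,2)] by (rule order_trans)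
  then show ?thesis using assms(4) by (simp add: ennreal_le_iff)
qed

lemma window_sets:
  assumes l: "l \<in> control_seqs M F" and A: "A \<in> sets (F n)"
  shows "window l \<tau> n A k \<in> sets (F (k - 1))"
proof (cases "n < k")
  case True
  then have "n \<le> k - 1" by simp
  then have "A \<in> sets (F (k - 1))" using A F_mono by blast
  moreover have "{x \<in> space (F (k - 1)). l (k - 1) x \<le> \<tau>} \<in> sets (F (k - 1))"
    using l by (intro borel_measurable_le) (auto simp: control_seqs_def)
  ultimately show ?thesis using True by (simp add: window_def F_space sets.Int)
qed (simp add: window_def)

lemma window_interval:
  assumes l: "l \<in> control_seqs M F" and x: "x \<in> space M"
  obtains "\<And>k. k \<le> m \<Longrightarrow> x \<notin> window l \<tau> n A k"
  | L where "n < L" "L \<le> m" "l (L - 1) x \<le> \<tau>" "x \<in> A"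
      "\<And>k. k \<le> m \<Longrightarrow> x \<in> window l \<tau> n A k \<longleftrightarrow> k \<in> {n<..L}"
proof (cases "\<exists>k\<le>m. x \<in> window l \<tau> n A k")
  case False
  then show ?thesis using that(1) by auto
next
  case True
  define S where "S = {k. k \<le> m \<and> x \<in> window l \<tau> n A k}"
  have S: "finite S" "S \<noteq> {}" using True by (auto simp: S_def)
  define L where "L = Max S"
  have "L \<in> S" unfolding L_def using S by (rule Max_in)
  then have L: "L \<le> m" "n < L" "l (L - 1) x \<le> \<tau>" "x \<in> A"
    by (auto simp: S_def window_def split: if_splits)
  moreover have "x \<in> window l \<tau> n A k \<longleftrightarrow> k \<in> {n<..L}" if "k \<le> m" for k
  proof
    assume *: "x \<in> window l \<tau> n A k"
    then have "k \<in> S" using that by (simp add: S_def)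
    then have "k \<le> L" unfolding L_def using S by simp
    then show "k \<in> {n<..L}" using * by (auto simp: window_def split: if_splits)
  next
    assume k: "k \<in> {n<..L}"
    then have "l (k - 1) x \<le> l (L - 1) x" by (intro control_mono[OF l x]) auto
    then show "x \<in> window l \<tau> n A k" using k L x by (auto simp: window_def)
  qed
  ultimately show ?thesis using that(2)[of L] by auto
qed

lemma window_sum:
  fixes u :: "nat \<Rightarrow> real"
  assumes "L \<le> m" "\<And>k. k \<le> m \<Longrightarrow> x \<in> W k \<longleftrightarrow> k \<in> {n<..L}"
  shows "(\<Sum>k\<le>m. indicator (W k) x * u k) = (\<Sum>k\<in>{n<..L}. u k)"
proof -
  have "(\<Sum>k\<le>m. indicator (W k) x * u k) = (\<Sum>k\<le>m. if k \<in> {n<..L} then u k else 0)"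
    using assms(2) by (intro sum.cong) (auto simp: indicator_def)
  also have "\<dots> = sum u ({..m} \<inter> {n<..L})" by (rule sum.inter_restrict[symmetric]) simp
  also have "{..m} \<inter> {n<..L} = {n<..L}" using assms(1) by auto
  finally show ?thesis .
qed

lemma sum_mdiff_interval:
  assumes "n < L"
  shows "(\<Sum>k\<in>{n<..L}. mdiff f k x) = f L x - f n x"
proof -
  have "{..L} = {..n} \<union> {n<..L}" using assms by auto
  then have "(\<Sum>k\<le>L. mdiff f k x) = (\<Sum>k\<le>n. mdiff f k x) + (\<Sum>k\<in>{n<..L}. mdiff f k x)"
    by (simp only:) (rule sum.union_disjoint, auto)
  then show ?thesis by (simp add: sum_mdiff)
qed

lemma controlled_of_square_control:
  assumes f: "martingale M F f" and l: "l \<in> control_seqs M F"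
    and S: "\<And>n. 1 \<le> n \<Longrightarrow> AE x in M. square_fn_upto f n x \<le> l (n - 1) x"
  shows "controlled f l"
proof -
  have [measurable]: "mdiff f k \<in> borel_measurable M" for k by (rule mdiff_measurable[OF f])
  have d_le: "\<bar>mdiff f k x\<bar> \<le> square_fn_upto f n x" if "k \<le> n" for k n x
  proof -
    have "(\<bar>mdiff f k x\<bar>)\<^sup>2 \<le> (\<Sum>k\<le>n. \<bar>mdiff f k x\<bar>\<^sup>2)"
      using that by (intro member_le_sum[where f = "\<lambda>k. \<bar>mdiff f k x\<bar>\<^sup>2"]) auto
    then show ?thesis unfolding square_fn_upto_def by (rule real_le_rsqrt)
  qed
  have "AE x in M. \<bar>f 0 x\<bar> \<le> l 0 x"
    using S[OF order_refl]
  proof eventually_elim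
    case (elim x)
    then show ?case using d_le[of 0 1 x] by (simp add: mdiff_def)
  qed
  moreover have "AE x in M. \<bar>mdiff f (Suc n) x\<bar> \<le> 2 * l n x" for n
    using S[of "Suc n", simplified] AE_space
  proof eventually_elim
    case (elim x)
    have "0 \<le> l n x" using l elim by (auto simp: control_seqs_def)
    then show ?case using elim d_le[of "Suc n" "Suc n" x] by simp
  qed
  moreover have "(\<Sum>k. \<integral>\<^sup>+x. ennreal ((indicator (window l \<tau> n A k) x * mdiff f k x)\<^sup>2) \<partial>M)
        \<le> ennreal (4 * \<tau>\<^sup>2) * emeasure M A" if \<tau>: "0 < \<tau>" and A: "A \<in> sets (F n)" for \<tau> n A
  proof (rule suminf_le_const[OF summableI])
    have [measurable]: "window l \<tau> n A k \<in> sets M" for k by (rule F_sets[OF window_sets[OF l A]])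
    have [measurable]: "A \<in> sets M" by (rule F_sets[OF A])
    fix m
    have "(\<Sum>k<m. \<integral>\<^sup>+x. ennreal ((indicator (window l \<tau> n A k) x * mdiff f k x)\<^sup>2) \<partial>M)
        \<le> (\<Sum>k\<le>m. \<integral>\<^sup>+x. ennreal ((indicator (window l \<tau> n A k) x * mdiff f k x)\<^sup>2) \<partial>M)"
      by (intro sum_mono2) auto
    also have "\<dots> = (\<integral>\<^sup>+x. (\<Sum>k\<le>m. ennreal ((indicator (window l \<tau> n A k) x * mdiff f k x)\<^sup>2)) \<partial>M)"
      by (rule nn_integral_sum[symmetric]) measurable
    also have "\<dots> \<le> (\<integral>\<^sup>+x. ennreal (4 * \<tau>\<^sup>2) * indicator A x \<partial>M)"
    proof (rule nn_integral_mono_AE)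
      have "AE x in M. \<forall>n\<ge>1. square_fn_upto f n x \<le> l (n - 1) x"
        using S by (auto simp: AE_all_countable)
      then show "AE x in M. (\<Sum>k\<le>m. ennreal ((indicator (window l \<tau> n A k) x * mdiff f k x)\<^sup>2))
          \<le> ennreal (4 * \<tau>\<^sup>2) * indicator A x"
        using AE_space
      proof eventually_elim
        case (elim x)
        have eq: "(\<Sum>k\<le>m. ennreal ((indicator (window l \<tau> n A k) x * mdiff f k x)\<^sup>2))
            = ennreal (\<Sum>k\<le>m. indicator (window l \<tau> n A k) x * (mdiff f k x)\<^sup>2)"
        proof -
          have sq: "(indicator W x * u)\<^sup>2 = indicator W x * u\<^sup>2" for W and u :: real
            by (simp add: indicator_def)
          show ?thesis unfolding sq by (rule sum_ennreal) simp
        qed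
        show ?case unfolding eq
        proof (rule window_interval[OF l elim(2), of m \<tau> n A])
          assume "\<And>k. k \<le> m \<Longrightarrow> x \<notin> window l \<tau> n A k"
          then show "ennreal (\<Sum>k\<le>m. indicator (window l \<tau> n A k) x * (mdiff f k x)\<^sup>2)
              \<le> ennreal (4 * \<tau>\<^sup>2) * indicator A x" by simp
        next
          fix L assume L: "n < L" "L \<le> m" "l (L - 1) x \<le> \<tau>" "x \<in> A"
            "\<And>k. k \<le> m \<Longrightarrow> x \<in> window l \<tau> n A k \<longleftrightarrow> k \<in> {n<..L}"
          have "(\<Sum>k\<le>m. indicator (window l \<tau> n A k) x * (mdiff f k x)\<^sup>2)
              = (\<Sum>k\<in>{n<..L}. (mdiff f k x)\<^sup>2)"
            by (rule window_sum[OF L(2,5)])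
          also have "\<dots> \<le> (\<Sum>k\<le>L. (mdiff f k x)\<^sup>2)" by (intro sum_mono2) auto
          also have "\<dots> = (square_fn_upto f L x)\<^sup>2" by (simp add: square_fn_upto_def sum_nonneg)
          also have "\<dots> \<le> \<tau>\<^sup>2"
            using elim(1)[rule_format, of L] L by (intro power_mono) (auto simp: square_fn_upto_def sum_nonneg)
          also have "\<dots> \<le> 4 * \<tau>\<^sup>2" by simp
          finally show "ennreal (\<Sum>k\<le>m. indicator (window l \<tau> n A k) x * (mdiff f k x)\<^sup>2)
              \<le> ennreal (4 * \<tau>\<^sup>2) * indicator A x" using L(4) by (simp add: ennreal_leI)
        qed
      qed
    qed
    also have "\<dots> = ennreal (4 * \<tau>\<^sup>2) * emeasure M A" by (simp add: nn_integral_cmult_indicator)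
    finally show "(\<Sum>k<m. \<integral>\<^sup>+x. ennreal ((indicator (window l \<tau> n A k) x * mdiff f k x)\<^sup>2) \<partial>M)
        \<le> ennreal (4 * \<tau>\<^sup>2) * emeasure M A" .
  qed
  ultimately show ?thesis using l unfolding controlled_def by blast
qed

text \<open>A bound at time \<open>1\<close> that is known at time \<open>0\<close> is inherited by the conditional expectation.  The
  control need not be integrable, so the martingale property is tested on the set where the claim
  fails.\<close>

lemma initial_le_control:
  assumes f: "martingale M F f" and l: "l \<in> borel_measurable (F 0)"
    and le: "AE x in M. \<bar>f 1 x\<bar> \<le> l x"
  shows "AE x in M. \<bar>f 0 x\<bar> \<le> l x"
proof -
  have f0 [measurable]: "f 0 \<in> borel_measurable (F 0)" and int: "integrable M (f 0)" "integrable M (f 1)"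
    using f by (auto simp: martingale_def)
  note l [measurable]
  define B where "B = {x \<in> space (F 0). l x < \<bar>f 0 x\<bar>}"
  have B [measurable]: "B \<in> sets (F 0)" unfolding B_def by measurable
  define h where "h x = indicator B x * sgn (f 0 x)" for x
  have h: "h \<in> borel_measurable (F 0)" unfolding h_def by measurable
  have hM [measurable]: "h \<in> borel_measurable M" by (rule F_measurable[OF h])
  have d: "mdiff f (Suc 0) = (\<lambda>x. f 1 x - f 0 x)" by (auto simp: mdiff_def)
  have int_d: "integrable M (\<lambda>x. h x * mdiff f (Suc 0) x)"
  proof (rule Bochner_Integration.integrable_bound)
    show "integrable M (\<lambda>x. f 1 x - f 0 x)" using int by auto
    show "(\<lambda>x. h x * mdiff f (Suc 0) x) \<in> borel_measurable M"
      using hM mdiff_measurable[OF f] by measurable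
    show "AE x in M. norm (h x * mdiff f (Suc 0) x) \<le> norm (f 1 x - f 0 x)"
      by (rule AE_I2) (auto simp: h_def d indicator_def sgn_if)
  qed
  have zero: "(\<integral>x. - (h x * mdiff f (Suc 0) x) \<partial>M) = 0"
    using mdiff_orthogonal[OF f h int_d] by simp
  have pos: "AE x in M. 0 \<le> - (h x * mdiff f (Suc 0) x) \<and> (x \<in> B \<longrightarrow> h x * mdiff f (Suc 0) x < 0)"
    using le
  proof eventually_elim
    case (elim x)
    then show ?case by (auto simp: h_def d B_def indicator_def sgn_if abs_if split: if_splits)
  qed
  have "AE x in M. - (h x * mdiff f (Suc 0) x) = 0"
    using int_d pos zero by (subst integral_nonneg_eq_0_iff_AE[symmetric]) (auto elim!: eventually_mono)
  with pos have "AE x in M. x \<notin> B" by eventually_elim auto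
  then show ?thesis using AE_space by eventually_elim (auto simp: B_def F_space)
qed

lemma controlled_of_value_control:
  assumes f: "martingale M F f" and l: "l \<in> control_seqs M F"
    and P: "\<And>n. 1 \<le> n \<Longrightarrow> AE x in M. \<bar>f n x\<bar> \<le> l (n - 1) x"
  shows "controlled f l"
proof -
  have [measurable]: "mdiff f k \<in> borel_measurable M" for k by (rule mdiff_measurable[OF f])
  have f0: "AE x in M. \<bar>f 0 x\<bar> \<le> l 0 x"
  proof (rule initial_le_control[OF f])
    show "l 0 \<in> borel_measurable (F 0)" using l by (auto simp: control_seqs_def)
    show "AE x in M. \<bar>f 1 x\<bar> \<le> l 0 x" using P[of 1] by simp
  qed
  have all: "AE x in M. x \<in> space M \<and> (\<forall>n. \<bar>f n x\<bar> \<le> l (n - 1) x)"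
  proof -
    have "AE x in M. \<bar>f n x\<bar> \<le> l (n - 1) x" for n
      using f0 P[of n] by (cases n) auto
    then show ?thesis using AE_space by (auto simp: AE_all_countable)
  qed
  have f_le: "\<bar>f n x\<bar> \<le> l m x" if "x \<in> space M" "\<forall>n. \<bar>f n x\<bar> \<le> l (n - 1) x" "n - 1 \<le> m" for n m x
    using that control_mono[OF l that(1,3)] by (meson order_trans)
  have d_le: "AE x in M. \<bar>mdiff f (Suc n) x\<bar> \<le> 2 * l n x" for n
    using all
  proof eventually_elim
    case (elim x)
    then have "\<bar>f (Suc n) x\<bar> \<le> l n x" "\<bar>f n x\<bar> \<le> l n x" by (auto intro: f_le)
    then show ?case by (simp add: mdiff_def)
  qed
  moreover have "(\<Sum>k. \<integral>\<^sup>+x. ennreal ((indicator (window l \<tau> n A k) x * mdiff f k x)\<^sup>2) \<partial>M)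
        \<le> ennreal (4 * \<tau>\<^sup>2) * emeasure M A" if \<tau>: "0 < \<tau>" and A: "A \<in> sets (F n)" for \<tau> n A
  proof (rule suminf_le_const[OF summableI])
    have [measurable]: "window l \<tau> n A k \<in> sets M" for k by (rule F_sets[OF window_sets[OF l A]])
    have [measurable]: "A \<in> sets M" by (rule F_sets[OF A])
    have mds: "mds (\<lambda>k x. indicator (window l \<tau> n A k) x * mdiff f k x)"
    proof (rule mds_mdiff[OF f window_sets[OF l A]])
      fix k
      have "(\<integral>\<^sup>+x. ennreal ((indicator (window l \<tau> n A k) x * mdiff f k x)\<^sup>2) \<partial>M)
          \<le> (\<integral>\<^sup>+x. ennreal ((2 * \<tau>)\<^sup>2) \<partial>M)"
      proof (cases k)
        case 0
        then show ?thesis by (simp add: window_def)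
      next
        case (Suc i)
        show ?thesis
        proof (rule nn_integral_mono_AE)
          show "AE x in M. ennreal ((indicator (window l \<tau> n A k) x * mdiff f k x)\<^sup>2) \<le> ennreal ((2 * \<tau>)\<^sup>2)"
            using d_le[of i]
          proof eventually_elim
            case (elim x)
            have "\<bar>indicator (window l \<tau> n A k) x * mdiff f k x\<bar> \<le> 2 * \<tau>"
              using elim \<tau> Suc by (auto simp: window_def indicator_def)
            then have "(indicator (window l \<tau> n A k) x * mdiff f k x)\<^sup>2 \<le> (2 * \<tau>)\<^sup>2"
              using \<tau> by (subst abs_le_square_iff[symmetric]) simp
            then show ?case by (rule ennreal_leI)
          qed
        qed
      qed
      also have "\<dots> < \<infinity>" using emeasure_space_1 by simp
      finally show "(\<integral>\<^sup>+x. ennreal ((indicator (window l \<tau> n A k) x * mdiff f k x)\<^sup>2) \<partial>M) < \<infinity>" .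
    qed
    fix m
    have "(\<Sum>k<m. \<integral>\<^sup>+x. ennreal ((indicator (window l \<tau> n A k) x * mdiff f k x)\<^sup>2) \<partial>M)
        \<le> (\<Sum>k\<le>m. \<integral>\<^sup>+x. ennreal ((indicator (window l \<tau> n A k) x * mdiff f k x)\<^sup>2) \<partial>M)"
      by (intro sum_mono2) auto
    also have "\<dots> = (\<integral>\<^sup>+x. ennreal ((\<Sum>k\<le>m. indicator (window l \<tau> n A k) x * mdiff f k x)\<^sup>2) \<partial>M)"
      by (rule mds_pythagoras_nn[OF mds])
    also have "\<dots> \<le> (\<integral>\<^sup>+x. ennreal (4 * \<tau>\<^sup>2) * indicator A x \<partial>M)"
    proof (rule nn_integral_mono_AE)
      show "AE x in M. ennreal ((\<Sum>k\<le>m. indicator (window l \<tau> n A k) x * mdiff f k x)\<^sup>2)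
          \<le> ennreal (4 * \<tau>\<^sup>2) * indicator A x"
        using all
      proof eventually_elim
        case (elim x)
        then have x: "x \<in> space M" by simp
        show ?case
        proof (rule window_interval[OF l x, of m \<tau> n A])
          assume "\<And>k. k \<le> m \<Longrightarrow> x \<notin> window l \<tau> n A k"
          then show "ennreal ((\<Sum>k\<le>m. indicator (window l \<tau> n A k) x * mdiff f k x)\<^sup>2)
              \<le> ennreal (4 * \<tau>\<^sup>2) * indicator A x" by simp
        next
          fix L assume L: "n < L" "L \<le> m" "l (L - 1) x \<le> \<tau>" "x \<in> A"
            "\<And>k. k \<le> m \<Longrightarrow> x \<in> window l \<tau> n A k \<longleftrightarrow> k \<in> {n<..L}"
          have "(\<Sum>k\<le>m. indicator (window l \<tau> n A k) x * mdiff f k x) = f L x - f n x"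
            using window_sum[OF L(2,5)] sum_mdiff_interval[OF L(1)] by simp
          moreover have "\<bar>f L x\<bar> \<le> l (L - 1) x" "\<bar>f n x\<bar> \<le> l (L - 1) x"
            using elim L(1) by (auto intro: f_le)
          ultimately have "\<bar>\<Sum>k\<le>m. indicator (window l \<tau> n A k) x * mdiff f k x\<bar> \<le> 2 * \<tau>"
            using L(3) by linarith
          then have "(\<Sum>k\<le>m. indicator (window l \<tau> n A k) x * mdiff f k x)\<^sup>2 \<le> (2 * \<tau>)\<^sup>2"
            using \<tau> by (subst abs_le_square_iff[symmetric]) simp
          then show "ennreal ((\<Sum>k\<le>m. indicator (window l \<tau> n A k) x * mdiff f k x)\<^sup>2)
              \<le> ennreal (4 * \<tau>\<^sup>2) * indicator A x"
            using L(4) by (simp add: ennreal_leI power_mult_distrib)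
        qed
      qed
    qed
    also have "\<dots> = ennreal (4 * \<tau>\<^sup>2) * emeasure M A" by (simp add: nn_integral_cmult_indicator)
    finally show "(\<Sum>k<m. \<integral>\<^sup>+x. ennreal ((indicator (window l \<tau> n A k) x * mdiff f k x)\<^sup>2) \<partial>M)
        \<le> ennreal (4 * \<tau>\<^sup>2) * emeasure M A" .
  qed
  ultimately show ?thesis using l f0 unfolding controlled_def by blast
qed

end

section \<open>The operators are dominated by the controls\<close>

lemma less_sqrt_epowr_iff:
  assumes "0 \<le> t"
  shows "ennreal t < epowr y (1 / 2) \<longleftrightarrow> ennreal (t\<^sup>2) < y"
proof (cases y)
  case (real r)
  have "sqrt (t\<^sup>2) < sqrt r \<longleftrightarrow> t\<^sup>2 < r" by (rule real_sqrt_less_iff)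
  then have "t < sqrt r \<longleftrightarrow> t\<^sup>2 < r" using assms by simp
  then show ?thesis
    using real assms by (simp add: epowr_ennreal powr_half_sqrt ennreal_less_iff)
qed (simp add: epowr_def)

context atomic_filtration
begin

text \<open>The conditional means of the squared differences, as \<open>[0,\<infinity>]\<close>-valued functions, and their
  partial sums.  For \<open>k > 0\<close> the partial sum up to \<open>k\<close> is known at time \<open>k - 1\<close>.\<close>

definition cond_sq :: "(nat \<Rightarrow> 'a \<Rightarrow> real) \<Rightarrow> nat \<Rightarrow> 'a \<Rightarrow> ennreal" where
  "cond_sq f k x = nn_cond_exp M (F (k - 1)) (\<lambda>y. ennreal (\<bar>mdiff f k y\<bar>\<^sup>2)) x"

definition cond_sq_sum :: "(nat \<Rightarrow> 'a \<Rightarrow> real) \<Rightarrow> nat \<Rightarrow> 'a \<Rightarrow> ennreal" where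
  "cond_sq_sum f n x = (\<Sum>k\<le>n. cond_sq f k x)"

lemma cond_sq_F_measurable: "k - 1 \<le> n \<Longrightarrow> cond_sq f k \<in> borel_measurable (F n)"
  unfolding cond_sq_def[abs_def]
  by (rule F_mono_measurable[of "k - 1"]) (auto intro: borel_measurable_nn_cond_exp)

lemma cond_sq_measurable [measurable]: "cond_sq f k \<in> borel_measurable M"
  using cond_sq_F_measurable[OF order_refl] by (rule F_measurable)

lemma cond_sq_sum_F_measurable: "k - 1 \<le> n \<Longrightarrow> cond_sq_sum f k \<in> borel_measurable (F n)"
  unfolding cond_sq_sum_def[abs_def]
  by (rule borel_measurable_sum, rule cond_sq_F_measurable) auto

lemma cond_sq_sum_mono: "m \<le> n \<Longrightarrow> cond_sq_sum f m x \<le> cond_sq_sum f n x"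
  unfolding cond_sq_sum_def by (intro sum_mono2) auto

lemma cond_sq_sum_le_suminf: "cond_sq_sum f n x \<le> (\<Sum>k. cond_sq f k x)"
  unfolding cond_sq_sum_def by (rule sum_le_suminf) auto

lemma suminf_cond_sq_eq: "(\<Sum>k. cond_sq f k x) = (SUP n. cond_sq_sum f n x)"
proof (rule antisym)
  show "(\<Sum>k. cond_sq f k x) \<le> (SUP n. cond_sq_sum f n x)"
  proof (rule suminf_le_const[OF summableI])
    fix m
    have "(\<Sum>k<m. cond_sq f k x) \<le> cond_sq_sum f m x"
      unfolding cond_sq_sum_def by (intro sum_mono2) auto
    also have "\<dots> \<le> (SUP n. cond_sq_sum f n x)" by (rule SUP_upper) auto
    finally show "(\<Sum>k<m. cond_sq f k x) \<le> (SUP n. cond_sq_sum f n x)" .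
  qed
qed (auto intro: SUP_least cond_sq_sum_le_suminf)

lemma cond_square_fn_eq: "cond_square_fn M F f x = epowr (\<Sum>k. cond_sq f k x) (1 / 2)"
  unfolding cond_square_fn_def cond_sq_def ..

lemma cond_square_fn_measurable: "cond_square_fn M F f \<in> borel_measurable M"
  unfolding cond_square_fn_eq[abs_def]
  by (rule measurable_compose[OF _ epowr_measurable]) measurable

lemma less_cond_square_fn_iff:
  "0 \<le> t \<Longrightarrow> ennreal t < cond_square_fn M F f x \<longleftrightarrow> ennreal (t\<^sup>2) < (\<Sum>k. cond_sq f k x)"
  unfolding cond_square_fn_eq by (rule less_sqrt_epowr_iff)

lemma integral_cond_sq:
  assumes f: "martingale M F f" and W: "W \<in> sets (F (k - 1))"
  shows "(\<integral>\<^sup>+x. ennreal ((indicator W x * mdiff f k x)\<^sup>2) \<partial>M) = (\<integral>\<^sup>+x. indicator W x * cond_sq f k x \<partial>M)"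
proof -
  interpret sigma_finite_subalgebra M "F (k - 1)" by (rule sigma_finite_F)
  have [measurable]: "mdiff f k \<in> borel_measurable M" by (rule mdiff_measurable[OF f])
  have "(\<integral>\<^sup>+x. ennreal ((indicator W x * mdiff f k x)\<^sup>2) \<partial>M)
      = (\<integral>\<^sup>+x. indicator W x * ennreal (\<bar>mdiff f k x\<bar>\<^sup>2) \<partial>M)"
    by (intro nn_integral_cong) (auto simp: indicator_def)
  also have "\<dots> = (\<integral>\<^sup>+x. indicator W x * cond_sq f k x \<partial>M)"
    unfolding cond_sq_def using W by (intro nn_cond_exp_intg[symmetric]) auto
  finally show ?thesis .
qed

lemma cond_sq_0:
  assumes f: "martingale M F f"
  shows "AE x in M. cond_sq f 0 x = ennreal ((f 0 x)\<^sup>2)"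
proof -
  interpret sigma_finite_subalgebra M "F 0" by (rule sigma_finite_F)
  have "f 0 \<in> borel_measurable (F 0)" using f by (auto simp: martingale_def)
  then have "AE x in M. ennreal (\<bar>mdiff f 0 x\<bar>\<^sup>2) = nn_cond_exp M (F 0) (\<lambda>y. ennreal (\<bar>mdiff f 0 y\<bar>\<^sup>2)) x"
    by (intro nn_cond_exp_F_meas) (auto simp: mdiff_def)
  then show ?thesis by eventually_elim (simp add: cond_sq_def mdiff_def)
qed

lemma measure_le_of_emeasure_bound:
  assumes A: "A \<in> sets M" and t: "0 < t" and r: "0 \<le> r"
    and le: "ennreal t * emeasure M E \<le> ennreal r * emeasure M A"
  shows "measure M E \<le> r / t * measure M A"
proof -
  have "ennreal (t * measure M E) \<le> ennreal (r * measure M A)"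
    using le t r by (simp add: emeasure_eq_measure ennreal_mult)
  then have "t * measure M E \<le> r * measure M A"
    using r by (subst (asm) ennreal_le_iff) auto
  then show ?thesis using t by (simp add: field_simps)
qed

text \<open>Up to the first time \<open>n\<close> at which a gauge exceeds \<open>t\<close> it is at most \<open>t\<close>, the jump at time \<open>n\<close> is small
  where the control is, and the remaining differences satisfy the weak type inequality.\<close>

lemma good_lambda_gauge:
  assumes f: "martingale M F f" and ctl: "controlled f l" and \<phi>: "\<phi> \<in> gauges"
  shows "good_lambda (\<lambda>x. gauge_sup \<phi> (\<lambda>k. mdiff f k x)) (control_limit l)"
  unfolding good_lambda_def
proof (intro allI impI)
  fix t \<gamma> :: real assume t: "0 < t" and \<gamma>: "0 < \<gamma>" "\<gamma> \<le> 1 / 4"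
  let ?G = "\<lambda>x. gauge_sup \<phi> (\<lambda>k. mdiff f k x)"
  let ?E = "{x \<in> space M. ennreal (2 * t) < ?G x \<and> control_limit l x \<le> ennreal (\<gamma> * t)}"
  have l: "l \<in> control_seqs M F" and f0: "AE x in M. \<bar>f 0 x\<bar> \<le> l 0 x"
    and jump: "\<And>n. AE x in M. \<bar>mdiff f (Suc n) x\<bar> \<le> 2 * l n x"
    and quad: "\<And>\<tau> n A. 0 < \<tau> \<Longrightarrow> A \<in> sets (F n) \<Longrightarrow>
      (\<Sum>k. \<integral>\<^sup>+x. ennreal ((indicator (window l \<tau> n A k) x * mdiff f k x)\<^sup>2) \<partial>M)
        \<le> ennreal (4 * \<tau>\<^sup>2) * emeasure M A"
    using ctl unfolding controlled_def by auto
  have l0: "0 \<le> l 0 x" if "x \<in> space M" for x using l that by (auto simp: control_seqs_def)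
  have jump': "AE x in M. x \<in> space M \<and> (\<forall>n. \<bar>mdiff f n x\<bar> \<le> 2 * l (n - 1) x)"
  proof -
    have "AE x in M. \<bar>mdiff f n x\<bar> \<le> 2 * l (n - 1) x" for n
    proof (cases n)
      case 0
      show ?thesis using f0 AE_space
      proof eventually_elim
        case (elim x)
        then show ?case using l0[of x] by (simp add: 0 mdiff_def)
      qed
    qed (use jump in simp)
    then show ?thesis using AE_space by (auto simp: AE_all_countable)
  qed
  define U where "U n = {x \<in> space M. t < \<phi> n (\<lambda>k. mdiff f k x)}" for n
  have UF: "U n \<in> sets (F n)" for n
  proof -
    have "(\<lambda>x. \<phi> n (\<lambda>k. mdiff f k x)) \<in> borel_measurable (F n)"
      by (rule gauge_measurable[OF \<phi>]) (rule mdiff_F_measurable[OF f])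
    then have "{x \<in> space (F n). t < \<phi> n (\<lambda>k. mdiff f k x)} \<in> sets (F n)" by simp
    then show ?thesis by (simp add: U_def F_space)
  qed
  show "\<exists>U. (\<forall>n. U n \<in> sets (F n) \<and> U n \<subseteq> {x \<in> space M. ennreal t < ?G x}) \<and>
      (AE x in M. ennreal (2 * t) < ?G x \<longrightarrow> x \<in> (\<Union>n. U n)) \<and>
      (\<forall>n A. is_atom M (F n) A \<longrightarrow> A \<subseteq> disjointed U n \<longrightarrow>
        measure M (?E \<inter> A) \<le> 16 * \<gamma>\<^sup>2 * measure M A)"
  proof (intro exI[of _ U] conjI allI impI)
    fix n
    show "U n \<in> sets (F n)" by (rule UF)
    show "U n \<subseteq> {x \<in> space M. ennreal t < ?G x}"
      using t less_gauge_sup_iff[OF \<phi>, of t] by (auto simp: U_def)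
  next
    show "AE x in M. ennreal (2 * t) < ?G x \<longrightarrow> x \<in> (\<Union>n. U n)"
    proof (rule AE_I2, rule impI)
      fix x assume "x \<in> space M" "ennreal (2 * t) < ?G x"
      then obtain m where "2 * t < \<phi> m (\<lambda>k. mdiff f k x)"
        using t less_gauge_sup_iff[OF \<phi>, of "2 * t"] by auto
      then show "x \<in> (\<Union>n. U n)" using t \<open>x \<in> space M\<close> by (auto simp: U_def intro!: exI[of _ m])
    qed
  next
    fix n A assume at: "is_atom M (F n) A" and AU: "A \<subseteq> disjointed U n"
    have A: "A \<in> sets (F n)" using at by (simp add: is_atom_def)
    have \<tau>: "0 < \<gamma> * t" using \<gamma> t by simp
    let ?W = "window l (\<gamma> * t) n A"
    let ?e = "\<lambda>k x. indicator (?W k) x * mdiff f k x"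
    have mds: "mds ?e"
    proof (rule mds_mdiff[OF f window_sets[OF l A]])
      fix k
      have "(\<integral>\<^sup>+x. ennreal ((?e k x)\<^sup>2) \<partial>M) \<le> (\<Sum>k. \<integral>\<^sup>+x. ennreal ((?e k x)\<^sup>2) \<partial>M)"
        using sum_le_suminf[of "\<lambda>k. \<integral>\<^sup>+x. ennreal ((?e k x)\<^sup>2) \<partial>M" "{k}"] by simp
      also have "\<dots> \<le> ennreal (4 * (\<gamma> * t)\<^sup>2) * emeasure M A" by (rule quad[OF \<tau> A])
      also have "\<dots> < \<infinity>" by (simp add: emeasure_eq_measure ennreal_mult_less_top)
      finally show "(\<integral>\<^sup>+x. ennreal ((?e k x)\<^sup>2) \<partial>M) < \<infinity>" .
    qed
    let ?R = "{x \<in> space M. ennreal (t / 2) < gauge_sup \<phi> (\<lambda>k. ?e k x)}"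
    have em [measurable]: "?e k \<in> borel_measurable M" for k
      using mds F_measurable unfolding mds_def by blast
    have RM: "?R \<in> sets M"
    proof -
      have "(\<lambda>x. gauge_sup \<phi> (\<lambda>k. ?e k x)) \<in> borel_measurable M"
        by (rule gauge_sup_measurable[OF \<phi> em])
      then show ?thesis by simp
    qed
    have "AE x in M. x \<in> ?E \<inter> A \<longrightarrow> x \<in> ?R"
      using jump'
    proof (eventually_elim, intro impI)
      fix x assume x: "x \<in> space M \<and> (\<forall>n. \<bar>mdiff f n x\<bar> \<le> 2 * l (n - 1) x)" and xE: "x \<in> ?E \<inter> A"
      have lx: "l k x \<le> \<gamma> * t" for k
        by (rule control_le_of_limit[OF l]) (use xE \<tau> in auto)
      let ?d = "\<lambda>k. mdiff f k x"
      have before: "\<phi> i ?d \<le> t" if "i < n" for i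
      proof -
        have "x \<notin> U i" using xE AU that by (auto simp: disjointed_def)
        then show ?thesis using x by (auto simp: U_def)
      qed
      obtain m where m: "2 * t < \<phi> m ?d"
        using xE t less_gauge_sup_iff[OF \<phi>, of "2 * t"] by auto
      have e: "?e k x = (if n < k then ?d k else 0)" for k
        using xE lx x by (simp add: window_def)
      have "\<phi> m ?d = \<phi> m (\<lambda>k. ((if k < n then ?d k else 0) + (if k = n then ?d k else 0)) + ?e k x)"
        unfolding e by (rule gauge_cong[OF \<phi>]) auto
      also have "\<dots> \<le> \<phi> m (\<lambda>k. (if k < n then ?d k else 0) + (if k = n then ?d k else 0))
          + \<phi> m (\<lambda>k. ?e k x)"
        by (rule gauge_add[OF \<phi>])
      also have "\<dots> \<le> \<phi> m (\<lambda>k. if k < n then ?d k else 0) + \<phi> m (\<lambda>k. if k = n then ?d k else 0)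
          + \<phi> m (\<lambda>k. ?e k x)"
        by (intro add_right_mono gauge_add[OF \<phi>])
      also have "\<phi> m (\<lambda>k. if k < n then ?d k else 0) \<le> t"
        using gauge_before[OF \<phi>, of m n ?d] before[of "min m (n - 1)"] t by auto
      also have "\<phi> m (\<lambda>k. if k = n then ?d k else 0) \<le> t / 2"
      proof -
        have "\<bar>?d n\<bar> \<le> 2 * l (n - 1) x" using x by blast
        also have "\<dots> \<le> 2 * (\<gamma> * t)" using lx[of "n - 1"] by simp
        also have "\<dots> \<le> 2 * (1 / 4 * t)" using \<gamma> t by (intro mult_left_mono mult_right_mono) auto
        finally show ?thesis using gauge_single[OF \<phi>, of m n ?d] by simp
      qed
      finally have "t / 2 < \<phi> m (\<lambda>k. ?e k x)" using m by simp
      then show "x \<in> ?R" using x t less_gauge_sup_iff[OF \<phi>, of "t / 2"] by auto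
    qed
    then have "emeasure M (?E \<inter> A) \<le> emeasure M ?R" using RM by (rule emeasure_mono_AE)
    then have "ennreal ((t / 2)\<^sup>2) * emeasure M (?E \<inter> A) \<le> ennreal ((t / 2)\<^sup>2) * emeasure M ?R"
      by (rule mult_left_mono) auto
    also have "\<dots> \<le> (\<Sum>k. \<integral>\<^sup>+x. ennreal ((?e k x)\<^sup>2) \<partial>M)"
      using t by (intro mds_weak_type[OF \<phi> mds]) auto
    also have "\<dots> \<le> ennreal (4 * (\<gamma> * t)\<^sup>2) * emeasure M A" by (rule quad[OF \<tau> A])
    finally have "measure M (?E \<inter> A) \<le> 4 * (\<gamma> * t)\<^sup>2 / (t / 2)\<^sup>2 * measure M A"
      using t by (intro measure_le_of_emeasure_bound F_sets[OF A]) auto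
    also have "4 * (\<gamma> * t)\<^sup>2 / (t / 2)\<^sup>2 = 16 * \<gamma>\<^sup>2" using t by (simp add: power2_eq_square field_simps)
    finally show "measure M (?E \<inter> A) \<le> 16 * \<gamma>\<^sup>2 * measure M A" .
  qed
qed

text \<open>The partial sums of the conditional square function are predictable, so the level is passed
  one step earlier and there is no jump to control.\<close>

lemma good_lambda_cond_square:
  assumes f: "martingale M F f" and ctl: "controlled f l"
  shows "good_lambda (cond_square_fn M F f) (control_limit l)"
  unfolding good_lambda_def
proof (intro allI impI)
  fix t \<gamma> :: real assume t: "0 < t" and \<gamma>: "0 < \<gamma>" "\<gamma> \<le> 1 / 4"
  let ?G = "cond_square_fn M F f"
  let ?E = "{x \<in> space M. ennreal (2 * t) < ?G x \<and> control_limit l x \<le> ennreal (\<gamma> * t)}"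
  have l: "l \<in> control_seqs M F" and f0: "AE x in M. \<bar>f 0 x\<bar> \<le> l 0 x"
    and quad: "\<And>\<tau> n A. 0 < \<tau> \<Longrightarrow> A \<in> sets (F n) \<Longrightarrow>
      (\<Sum>k. \<integral>\<^sup>+x. ennreal ((indicator (window l \<tau> n A k) x * mdiff f k x)\<^sup>2) \<partial>M)
        \<le> ennreal (4 * \<tau>\<^sup>2) * emeasure M A"
    using ctl unfolding controlled_def by auto
  define U where "U n = {x \<in> space M. ennreal (t\<^sup>2) < cond_sq_sum f (Suc n) x}" for n
  have UF: "U n \<in> sets (F n)" for n
  proof -
    have "cond_sq_sum f (Suc n) \<in> borel_measurable (F n)" by (rule cond_sq_sum_F_measurable) simp
    then have "{x \<in> space (F n). ennreal (t\<^sup>2) < cond_sq_sum f (Suc n) x} \<in> sets (F n)" by simp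
    then show ?thesis by (simp add: U_def F_space)
  qed
  have cover: "x \<in> (\<Union>n. U n)" if x: "x \<in> space M" "ennreal (2 * t) < ?G x" for x
  proof -
    have "ennreal t < ?G x" using x(2) t by (intro le_less_trans[OF _ x(2)] ennreal_leI) auto
    then have "ennreal (t\<^sup>2) < (SUP n. cond_sq_sum f n x)"
      using less_cond_square_fn_iff[of t f x] t by (simp add: suminf_cond_sq_eq)
    then obtain n where "ennreal (t\<^sup>2) < cond_sq_sum f n x" unfolding less_SUP_iff by auto
    also have "\<dots> \<le> cond_sq_sum f (Suc n) x" by (rule cond_sq_sum_mono) simp
    finally show ?thesis using x by (auto simp: U_def)
  qed
  show "\<exists>U. (\<forall>n. U n \<in> sets (F n) \<and> U n \<subseteq> {x \<in> space M. ennreal t < ?G x}) \<and>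
      (AE x in M. ennreal (2 * t) < ?G x \<longrightarrow> x \<in> (\<Union>n. U n)) \<and>
      (\<forall>n A. is_atom M (F n) A \<longrightarrow> A \<subseteq> disjointed U n \<longrightarrow>
        measure M (?E \<inter> A) \<le> 16 * \<gamma>\<^sup>2 * measure M A)"
  proof (intro exI[of _ U] conjI allI impI)
    fix n
    show "U n \<in> sets (F n)" by (rule UF)
    show "U n \<subseteq> {x \<in> space M. ennreal t < ?G x}"
      using t less_cond_square_fn_iff[of t f]
      by (auto simp: U_def intro: less_le_trans cond_sq_sum_le_suminf)
  next
    show "AE x in M. ennreal (2 * t) < ?G x \<longrightarrow> x \<in> (\<Union>n. U n)"
      by (rule AE_I2) (use cover in auto)
  next
    fix n A assume at: "is_atom M (F n) A" and AU: "A \<subseteq> disjointed U n"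
    have A: "A \<in> sets (F n)" using at by (simp add: is_atom_def)
    have \<tau>: "0 < \<gamma> * t" using \<gamma> t by simp
    let ?W = "window l (\<gamma> * t) n A"
    have [measurable]: "?W k \<in> sets M" for k by (rule F_sets[OF window_sets[OF l A]])
    have [measurable]: "A \<in> sets M" by (rule F_sets[OF A])
    have EA: "?E \<inter> A \<in> sets M"
      using cond_square_fn_measurable[of f] control_limit_measurable[OF l] by measurable
    have "ennreal (t\<^sup>2) * emeasure M (?E \<inter> A) = (\<integral>\<^sup>+x. ennreal (t\<^sup>2) * indicator (?E \<inter> A) x \<partial>M)"
      by (rule nn_integral_cmult_indicator[OF EA, symmetric])
    also have "\<dots> \<le> (\<integral>\<^sup>+x. (\<Sum>k. indicator (?W k) x * cond_sq f k x) \<partial>M)"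
    proof (rule nn_integral_mono_AE)
      show "AE x in M. ennreal (t\<^sup>2) * indicator (?E \<inter> A) x \<le> (\<Sum>k. indicator (?W k) x * cond_sq f k x)"
        using f0 cond_sq_0[OF f] AE_space
      proof eventually_elim
        case (elim x)
        show ?case
        proof (cases "x \<in> ?E \<inter> A")
          case xE: True
          have lx: "l k x \<le> \<gamma> * t" for k
            by (rule control_le_of_limit[OF l]) (use xE \<tau> in auto)
          have W: "indicator (?W k) x * cond_sq f k x = (if n < k then cond_sq f k x else 0)" for k
            using xE lx elim by (simp add: window_def)
          have before: "cond_sq_sum f n x \<le> ennreal (t\<^sup>2)"
          proof (cases n)
            case 0
            have "\<bar>f 0 x\<bar> \<le> t"
              using elim(1) lx[of 0] \<gamma> t mult_right_mono[of \<gamma> 1 t] by linarith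
            then have "(f 0 x)\<^sup>2 \<le> t\<^sup>2" using t by (simp add: abs_le_square_iff[symmetric])
            then show ?thesis using elim(2) 0 by (simp add: cond_sq_sum_def ennreal_leI)
          next
            case (Suc i)
            have "x \<notin> U i" using xE AU Suc by (auto simp: disjointed_def)
            then show ?thesis using elim(3) Suc by (auto simp: U_def not_less)
          qed
          have "ennreal (4 * t\<^sup>2) < (\<Sum>k. cond_sq f k x)"
            using xE t less_cond_square_fn_iff[of "2 * t" f x] by (simp add: power_mult_distrib)
          also have "\<dots> = (\<Sum>k. cond_sq f (k + Suc n) x) + cond_sq_sum f n x"
            unfolding cond_sq_sum_def lessThan_Suc_atMost[symmetric]
            by (rule suminf_offset) (rule summableI)
          also have "\<dots> \<le> (\<Sum>k. cond_sq f (k + Suc n) x) + ennreal (t\<^sup>2)"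
            by (rule add_left_mono[OF before])
          also have "\<dots> = ennreal (t\<^sup>2) + (\<Sum>k. cond_sq f (k + Suc n) x)" by (rule add.commute)
          finally have lt: "ennreal (4 * t\<^sup>2) < ennreal (t\<^sup>2) + (\<Sum>k. cond_sq f (k + Suc n) x)" .
          have "ennreal (t\<^sup>2) + ennreal (t\<^sup>2) = ennreal (t\<^sup>2 + t\<^sup>2)"
            by (rule ennreal_plus[symmetric]) auto
          also have "\<dots> \<le> ennreal (4 * t\<^sup>2)" by (rule ennreal_leI) simp
          also note less_imp_le[OF lt]
          finally have "ennreal (t\<^sup>2) \<le> (\<Sum>k. cond_sq f (k + Suc n) x)"
            unfolding ennreal_add_left_cancel_le by simp
          also have "\<dots> = (\<Sum>k. if n < k + Suc n then cond_sq f (k + Suc n) x else 0)" by simp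
          also have "\<dots> \<le> (\<Sum>k. if n < k then cond_sq f k x else 0)"
            unfolding suminf_offset[of "\<lambda>k. if n < k then cond_sq f k x else 0" "Suc n", OF summableI]
            by simp
          finally show ?thesis using xE unfolding W by simp
        qed simp
      qed
    qed
    also have "\<dots> = (\<Sum>k. \<integral>\<^sup>+x. indicator (?W k) x * cond_sq f k x \<partial>M)"
      by (rule nn_integral_suminf) measurable
    also have "\<dots> = (\<Sum>k. \<integral>\<^sup>+x. ennreal ((indicator (?W k) x * mdiff f k x)\<^sup>2) \<partial>M)"
      by (simp add: integral_cond_sq[OF f window_sets[OF l A]])
    also have "\<dots> \<le> ennreal (4 * (\<gamma> * t)\<^sup>2) * emeasure M A" by (rule quad[OF \<tau> A])
    finally have "measure M (?E \<inter> A) \<le> 4 * (\<gamma> * t)\<^sup>2 / t\<^sup>2 * measure M A"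
      using t by (intro measure_le_of_emeasure_bound F_sets[OF A]) auto
    also have "4 * (\<gamma> * t)\<^sup>2 / t\<^sup>2 = 4 * \<gamma>\<^sup>2" using t by (simp add: power2_eq_square field_simps)
    also have "4 * \<gamma>\<^sup>2 * measure M A \<le> 16 * \<gamma>\<^sup>2 * measure M A" by (intro mult_right_mono) auto
    finally show "measure M (?E \<inter> A) \<le> 16 * \<gamma>\<^sup>2 * measure M A" .
  qed
qed

lemma gauge_sup_mdiff_measurable:
  "martingale M F f \<Longrightarrow> \<phi> \<in> gauges \<Longrightarrow> (\<lambda>x. gauge_sup \<phi> (\<lambda>k. mdiff f k x)) \<in> borel_measurable M"
  by (rule gauge_sup_measurable) (auto intro: mdiff_measurable)

lemma lorentz_norm_gauge_le_control:
  assumes q: "0 < q"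
  shows "\<exists>C>0. \<forall>f l. martingale M F f \<longrightarrow> controlled f l \<longrightarrow>
    (\<forall>\<phi>\<in>gauges. lorentz_norm M p q (\<lambda>x. gauge_sup \<phi> (\<lambda>k. mdiff f k x))
        \<le> ennreal C * lorentz_norm M p q (control_limit l)) \<and>
    lorentz_norm M p q (cond_square_fn M F f) \<le> ennreal C * lorentz_norm M p q (control_limit l)"
proof -
  obtain C c where C: "0 < C" "0 < c" and dom: "\<And>G g. G \<in> borel_measurable M \<Longrightarrow>
      g \<in> borel_measurable M \<Longrightarrow> good_lambda G g \<Longrightarrow> level_dominated C c 2 G g"
    using level_dominated_of_good_lambda by blast
  obtain C' where C': "0 < C'" and le: "\<And>G g. level_dominated C c 2 G g \<Longrightarrow>
      lorentz_norm M p q G \<le> ennreal C' * lorentz_norm M p q g"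
    using lorentz_norm_le_of_level_dominated[OF C, of 2 q] q by auto
  show ?thesis
  proof (intro exI[of _ C'] conjI allI impI ballI C')
    fix f l assume f: "martingale M F f" and ctl: "controlled f l"
    have l: "control_limit l \<in> borel_measurable M"
      using ctl by (intro control_limit_measurable) (auto simp: controlled_def)
    show "lorentz_norm M p q (cond_square_fn M F f) \<le> ennreal C' * lorentz_norm M p q (control_limit l)"
      by (intro le dom cond_square_fn_measurable l good_lambda_cond_square f ctl)
    fix \<phi> :: "nat \<Rightarrow> (nat \<Rightarrow> real) \<Rightarrow> real" assume \<phi>: "\<phi> \<in> gauges"
    show "lorentz_norm M p q (\<lambda>x. gauge_sup \<phi> (\<lambda>k. mdiff f k x))
        \<le> ennreal C' * lorentz_norm M p q (control_limit l)"
      by (intro le dom gauge_sup_mdiff_measurable l good_lambda_gauge f ctl \<phi>)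
  qed
qed

text \<open>Each kind of control yields one of the other kind: the running maximum of a gauge of the past
  together with the bound on the next jump.\<close>

lemma gauge_control_of_controlled:
  assumes q: "0 < q"
  shows "\<exists>C>0. \<forall>f l. martingale M F f \<longrightarrow> controlled f l \<longrightarrow> (\<forall>\<phi>\<in>gauges.
    \<exists>l'\<in>control_seqs M F. (\<forall>n\<ge>1. AE x in M. \<phi> n (\<lambda>k. mdiff f k x) \<le> l' (n - 1) x) \<and>
      lorentz_norm M p q (control_limit l') \<le> ennreal C * lorentz_norm M p q (control_limit l))"
proof -
  obtain C c where C: "0 < C" "0 < c" "c \<le> 1 / 8" and dom: "\<And>G g. G \<in> borel_measurable M \<Longrightarrow>
      g \<in> borel_measurable M \<Longrightarrow> good_lambda G g \<Longrightarrow> level_dominated C c 2 G g"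
    using level_dominated_of_good_lambda by blast
  obtain B where B: "0 < B" and Un: "\<And>E E'. E \<in> sets M \<Longrightarrow> E' \<in> sets M \<Longrightarrow>
    set_norm (E \<union> E') \<le> ennreal B * max (set_norm E) (set_norm E')"
    using set_norm_Un_le by blast
  define C2 where "C2 = B * max C 1"
  have C2: "0 < C2" using B by (simp add: C2_def)
  obtain C' where C': "0 < C'" and le: "\<And>G g. level_dominated C2 (c / 2) 2 G g \<Longrightarrow>
      lorentz_norm M p q G \<le> ennreal C' * lorentz_norm M p q g"
    using lorentz_norm_le_of_level_dominated[OF C2, of "c / 2" 2 q] q C by auto
  show ?thesis
  proof (intro exI[of _ C'] conjI allI impI ballI C')
    fix f l and \<phi> :: "nat \<Rightarrow> (nat \<Rightarrow> real) \<Rightarrow> real"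
    assume f: "martingale M F f" and ctl: "controlled f l" and \<phi>: "\<phi> \<in> gauges"
    have l: "l \<in> control_seqs M F" and jump: "\<And>n. AE x in M. \<bar>mdiff f (Suc n) x\<bar> \<le> 2 * l n x"
      using ctl by (auto simp: controlled_def)
    let ?G = "\<lambda>x. gauge_sup \<phi> (\<lambda>k. mdiff f k x)"
    let ?\<phi> = "\<lambda>n x. \<phi> n (\<lambda>k. mdiff f k x)"
    have [measurable]: "?G \<in> borel_measurable M" by (rule gauge_sup_mdiff_measurable[OF f \<phi>])
    have [measurable]: "control_limit l \<in> borel_measurable M" by (rule control_limit_measurable[OF l])
    have Gl: "level_dominated C c 2 ?G (control_limit l)"
      by (intro dom good_lambda_gauge f ctl \<phi>) measurable
    define X where "X n x = Max ((\<lambda>k. ?\<phi> k x) ` {..n})" for n x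
    have X_ge: "?\<phi> k x \<le> X n x" if "k \<le> n" for k n x
      unfolding X_def using that by (intro Max_ge) auto
    have X_ex: "\<exists>k\<le>n. X n x = ?\<phi> k x" for n x
    proof -
      have "X n x \<in> (\<lambda>k. ?\<phi> k x) ` {..n}" unfolding X_def by (intro Max_in) auto
      then show ?thesis by auto
    qed
    define l' where "l' n x = X n x + 2 * l n x" for n x
    have l': "l' \<in> control_seqs M F"
      unfolding control_seqs_def mem_Collect_eq
    proof (intro conjI allI ballI)
      fix n
      have "X n \<in> borel_measurable (F n)"
        unfolding X_def[abs_def]
        by (rule borel_measurable_Max) (auto intro!: gauge_measurable[OF \<phi>] mdiff_F_measurable[OF f])
      moreover have "l n \<in> borel_measurable (F n)" using l by (auto simp: control_seqs_def)
      ultimately show "l' n \<in> borel_measurable (F n)"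
        unfolding l'_def[abs_def] by measurable
      fix x assume x: "x \<in> space M"
      have "0 \<le> X n x" using X_ge[of 0 n x] gauge_nonneg[OF \<phi>, of 0 "\<lambda>k. mdiff f k x"] by simp
      then show "0 \<le> l' n x" using l x by (auto simp: l'_def control_seqs_def)
      obtain k where "k \<le> n" "X n x = ?\<phi> k x" using X_ex by blast
      then have "X n x \<le> X (Suc n) x" using X_ge[of k "Suc n" x] by simp
      then show "l' n x \<le> l' (Suc n) x" using l x by (simp add: l'_def control_seqs_def add_mono)
    qed
    have "AE x in M. ?\<phi> n x \<le> l' (n - 1) x" if n: "1 \<le> n" for n
    proof -
      obtain i where i: "n = Suc i" using n by (cases n) auto
      show ?thesis using jump[of i]
      proof eventually_elim
        case (elim x)
        have "?\<phi> (Suc i) x \<le> ?\<phi> i x + \<bar>mdiff f (Suc i) x\<bar>" by (rule gauge_Suc_le[OF \<phi>])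
        then show ?case using elim X_ge[of i i x] by (simp add: i l'_def)
      qed
    qed
    moreover have "level_dominated C2 (c / 2) 2 (control_limit l') (control_limit l)"
      unfolding level_dominated_def
    proof (intro allI impI)
      fix t :: real assume t: "0 < t"
      let ?n = "level_norm M p (control_limit l)"
      let ?S = "SUP j::nat. ennreal (2 powr - (2 * real j)) * ?n (c / 2 * 2 powr - real j * t)"
      have "level_norm M p (control_limit l') t
          \<le> set_norm ({x \<in> space M. ennreal (t / 2) < ?G x} \<union> {x \<in> space M. ennreal (t / 4) < control_limit l x})"
        unfolding level_norm_eq
      proof (rule set_norm_mono, safe)
        fix x assume x: "x \<in> space M" and "ennreal t < control_limit l' x"
          and nl: "\<not> ennreal (t / 4) < control_limit l x"
        then obtain n where "ennreal t < ennreal (l' n x)"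
          unfolding control_limit_eq[OF l' x] less_SUP_iff by auto
        then have lt: "t < X n x + 2 * l n x" using t by (simp add: ennreal_less_iff l'_def)
        have "l n x \<le> t / 4"
          by (rule control_le_of_limit[OF l x]) (use nl t in \<open>auto simp: not_less\<close>)
        then have "t / 2 < X n x" using lt by simp
        then show "ennreal (t / 2) < ?G x"
          using X_ex[of n x] t less_gauge_sup_iff[OF \<phi>, of "t / 2"] by auto
      qed
      also have "\<dots> \<le> ennreal B * max (level_norm M p ?G (t / 2)) (?n (t / 4))"
        unfolding level_norm_eq by (rule Un) measurable
      also have "\<dots> \<le> ennreal B * (ennreal (max C 1) * ?S)"
      proof (intro mult_left_mono max.boundedI zero_le)
        have "level_norm M p ?G (t / 2) \<le> ennreal C * (SUP j::nat. ennreal (2 powr - (2 * real j)) *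
            ?n (c * 2 powr - real j * (t / 2)))"
          using t by (intro Gl[unfolded level_dominated_def, rule_format]) simp
        also have "\<dots> = ennreal C * ?S" by (simp add: mult.assoc)
        also have "\<dots> \<le> ennreal (max C 1) * ?S" by (intro mult_right_mono ennreal_leI) auto
        finally show "level_norm M p ?G (t / 2) \<le> ennreal (max C 1) * ?S" .
        have "?n (t / 4) \<le> ?n (c / 2 * 2 powr - real 0 * t)"
          using C t by (intro level_norm_antimono) (simp add: field_simps)
        also have "\<dots> \<le> ?S" by (rule SUP_upper2[of 0]) auto
        also have "\<dots> = ennreal 1 * ?S" by simp
        also have "\<dots> \<le> ennreal (max C 1) * ?S" by (intro mult_right_mono ennreal_leI) auto
        finally show "?n (t / 4) \<le> ennreal (max C 1) * ?S" .
      qed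
      also have "\<dots> = ennreal C2 * ?S" using B by (simp add: C2_def ennreal_mult mult.assoc)
      finally show "level_norm M p (control_limit l') t \<le> ennreal C2 * ?S" .
    qed
    ultimately show "\<exists>l'\<in>control_seqs M F. (\<forall>n\<ge>1. AE x in M. ?\<phi> n x \<le> l' (n - 1) x) \<and>
      lorentz_norm M p q (control_limit l') \<le> ennreal C' * lorentz_norm M p q (control_limit l)"
      using l' le by blast
  qed
qed

end

section \<open>Control by the conditional square function for exponents below two\<close>

context atomic_filtration
begin

text \<open>Differences that are kept only while the conditional square sum is at most \<open>v\<close> have total energy at
  most \<open>v\<close>.  This replaces a stopping argument; the differences need not be square integrable
  themselves.\<close>

lemma energy_le:
  assumes f: "martingale M F f" and A: "A \<in> sets M"
    and W: "\<And>k. W k \<in> sets (F (k - 1))"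
    and WA: "\<And>k x. x \<in> W k \<Longrightarrow> x \<in> A \<and> cond_sq_sum f k x \<le> ennreal v"
  shows "(\<Sum>k. \<integral>\<^sup>+x. ennreal ((indicator (W k) x * mdiff f k x)\<^sup>2) \<partial>M) \<le> ennreal v * emeasure M A"
proof -
  have [measurable]: "W k \<in> sets M" for k by (rule F_sets[OF W])
  have "(\<Sum>k. \<integral>\<^sup>+x. ennreal ((indicator (W k) x * mdiff f k x)\<^sup>2) \<partial>M)
      = (\<Sum>k. \<integral>\<^sup>+x. indicator (W k) x * cond_sq f k x \<partial>M)"
    by (simp add: integral_cond_sq[OF f W])
  also have "\<dots> = (\<integral>\<^sup>+x. (\<Sum>k. indicator (W k) x * cond_sq f k x) \<partial>M)"
    by (rule nn_integral_suminf[symmetric]) measurable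
  also have "\<dots> \<le> (\<integral>\<^sup>+x. ennreal v * indicator A x \<partial>M)"
  proof (intro nn_integral_mono suminf_le_const summableI)
    fix x m
    define S where "S = {k. k < m \<and> x \<in> W k}"
    have fin: "finite S" by (simp add: S_def)
    have "(\<Sum>k<m. indicator (W k) x * cond_sq f k x) = (\<Sum>k<m. if x \<in> W k then cond_sq f k x else 0)"
      by (intro sum.cong) (auto simp: indicator_def)
    also have "\<dots> = (\<Sum>k\<in>S. cond_sq f k x)"
      by (subst sum.inter_filter[symmetric]) (auto simp: S_def intro!: sum.cong)
    also have "\<dots> \<le> ennreal v * indicator A x"
    proof (cases "S = {}")
      case False
      then have "Max S \<in> S" using fin by (intro Max_in)
      then have L: "x \<in> W (Max S)" by (simp add: S_def)
      have "(\<Sum>k\<in>S. cond_sq f k x) \<le> cond_sq_sum f (Max S) x"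
        unfolding cond_sq_sum_def using fin by (intro sum_mono2) auto
      then show ?thesis using WA[OF L] by auto
    qed simp
    finally show "(\<Sum>k<m. indicator (W k) x * cond_sq f k x) \<le> ennreal v * indicator A x" .
  qed
  also have "\<dots> = ennreal v * emeasure M A" by (rule nn_integral_cmult_indicator[OF A])
  finally show ?thesis .
qed

lemma energy_weak_type:
  assumes f: "martingale M F f" and \<phi>: "\<phi> \<in> gauges" and A: "A \<in> sets M"
    and W: "\<And>k. W k \<in> sets (F (k - 1))"
    and WA: "\<And>k x. x \<in> W k \<Longrightarrow> x \<in> A \<and> cond_sq_sum f k x \<le> ennreal v" and s: "0 < s" and v: "0 \<le> v"
  shows "measure M {x \<in> space M. ennreal s < gauge_sup \<phi> (\<lambda>k. indicator (W k) x * mdiff f k x)}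
    \<le> v / s\<^sup>2 * measure M A"
proof (rule measure_le_of_emeasure_bound[OF A])
  note energy = energy_le[OF f A W WA]
  have mds: "mds (\<lambda>k x. indicator (W k) x * mdiff f k x)"
  proof (rule mds_mdiff[OF f W])
    fix k
    have "(\<integral>\<^sup>+x. ennreal ((indicator (W k) x * mdiff f k x)\<^sup>2) \<partial>M)
        \<le> (\<Sum>k. \<integral>\<^sup>+x. ennreal ((indicator (W k) x * mdiff f k x)\<^sup>2) \<partial>M)"
      using sum_le_suminf[of "\<lambda>k. \<integral>\<^sup>+x. ennreal ((indicator (W k) x * mdiff f k x)\<^sup>2) \<partial>M" "{k}"] by simp
    also have "\<dots> \<le> ennreal v * emeasure M A" by (rule energy)
    also have "\<dots> < \<infinity>" by (simp add: emeasure_eq_measure ennreal_mult_less_top)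
    finally show "(\<integral>\<^sup>+x. ennreal ((indicator (W k) x * mdiff f k x)\<^sup>2) \<partial>M) < \<infinity>" .
  qed
  show "ennreal (s\<^sup>2) * emeasure M {x \<in> space M. ennreal s < gauge_sup \<phi> (\<lambda>k. indicator (W k) x * mdiff f k x)}
      \<le> ennreal v * emeasure M A"
    using mds_weak_type[OF \<phi> mds s] energy by (rule order_trans)
qed (use s v in auto)

text \<open>The sets on which the conditional square sum at index \<open>k\<close> lies between two thresholds, or below
  one.  They are predictable.\<close>

definition layer :: "(nat \<Rightarrow> 'a \<Rightarrow> real) \<Rightarrow> real \<Rightarrow> real \<Rightarrow> nat \<Rightarrow> 'a set" where
  "layer f u v k = {x \<in> space M. ennreal u < cond_sq_sum f k x \<and> cond_sq_sum f k x \<le> ennreal v}"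

definition lower_layer :: "(nat \<Rightarrow> 'a \<Rightarrow> real) \<Rightarrow> real \<Rightarrow> nat \<Rightarrow> 'a set" where
  "lower_layer f v k = {x \<in> space M. cond_sq_sum f k x \<le> ennreal v}"

lemma indicator_lower_layer:
  assumes x: "x \<in> space M" and uv: "u \<le> v"
  shows "(indicator (lower_layer f v k) x :: real)
    = indicator (layer f u v k) x + indicator (lower_layer f u k) x"
proof (cases "cond_sq_sum f k x \<le> ennreal u")
  case True
  have "cond_sq_sum f k x \<le> ennreal v" using True ennreal_leI[OF uv] by (rule order_trans)
  moreover have "\<not> ennreal u < cond_sq_sum f k x" using True by (simp only: not_less)
  ultimately show ?thesis using True x by (simp only: lower_layer_def layer_def) simp
next
  case False
  then have "ennreal u < cond_sq_sum f k x" by (simp only: not_le)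
  then show ?thesis using False x by (simp only: lower_layer_def layer_def indicator_def) simp
qed

lemma layer_sets: "layer f u v k \<in> sets (F (k - 1))" "lower_layer f v k \<in> sets (F (k - 1))"
proof -
  have [measurable]: "cond_sq_sum f k \<in> borel_measurable (F (k - 1))"
    by (rule cond_sq_sum_F_measurable) simp
  have "{x \<in> space (F (k - 1)). ennreal u < cond_sq_sum f k x \<and> cond_sq_sum f k x \<le> ennreal v} \<in> sets (F (k - 1))"
    "{x \<in> space (F (k - 1)). cond_sq_sum f k x \<le> ennreal v} \<in> sets (F (k - 1))"
    by measurable
  then show "layer f u v k \<in> sets (F (k - 1))" "lower_layer f v k \<in> sets (F (k - 1))"
    by (simp_all add: layer_def lower_layer_def F_space)
qed

lemma gauge_sup_indicator_measurable:
  assumes f: "martingale M F f" and \<phi>: "\<phi> \<in> gauges" and W: "\<And>k. W k \<in> sets (F (k - 1))"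
  shows "(\<lambda>x. gauge_sup \<phi> (\<lambda>k. indicator (W k) x * mdiff f k x)) \<in> borel_measurable M"
proof (rule gauge_sup_measurable[OF \<phi>])
  fix k
  have [measurable]: "W k \<in> sets M" "mdiff f k \<in> borel_measurable M"
    using F_sets[OF W] mdiff_measurable[OF f] by auto
  show "(\<lambda>x. indicator (W k) x * mdiff f k x) \<in> borel_measurable M" by measurable
qed

text \<open>The differences of a layer with lower threshold \<open>u\<^sup>2\<close> live where the conditional square function
  exceeds \<open>u\<close>; the norms are compared on the atoms on which the threshold is first passed.\<close>

lemma layer_norm_le:
  assumes f: "martingale M F f" and \<phi>: "\<phi> \<in> gauges" and u: "0 < u" and v: "0 < v" and s: "0 < s"
  shows "set_norm {x \<in> space M. ennreal s < gauge_sup \<phi> (\<lambda>k. indicator (layer f (u\<^sup>2) v k) x * mdiff f k x)}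
    \<le> ennreal (norm_factor (osc_const 1 * (v / s\<^sup>2))) * level_norm M p (cond_square_fn M F f) u"
proof -
  let ?Ly = "layer f (u\<^sup>2) v"
  let ?E = "{x \<in> space M. ennreal s < gauge_sup \<phi> (\<lambda>k. indicator (?Ly k) x * mdiff f k x)}"
  let ?G = "{x \<in> space M. ennreal u < cond_square_fn M F f x}"
  define U where "U n = {x \<in> space M. ennreal (u\<^sup>2) < cond_sq_sum f (Suc n) x}" for n
  have UF: "U n \<in> sets (F n)" for n
  proof -
    have "cond_sq_sum f (Suc n) \<in> borel_measurable (F n)" by (rule cond_sq_sum_F_measurable) simp
    then have "{x \<in> space (F n). ennreal (u\<^sup>2) < cond_sq_sum f (Suc n) x} \<in> sets (F n)" by simp
    then show ?thesis by (simp add: U_def F_space)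
  qed
  have UG: "U n \<subseteq> ?G" for n
    using u less_cond_square_fn_iff[of u f]
    by (auto simp: U_def intro: less_le_trans cond_sq_sum_le_suminf)
  have cover: "x \<in> (\<Union>n. U n)" if x: "x \<in> ?E" for x
  proof -
    have "\<exists>k. x \<in> ?Ly k"
    proof (rule ccontr)
      assume "\<not> ?thesis"
      then have "gauge_sup \<phi> (\<lambda>k. indicator (?Ly k) x * mdiff f k x) = 0"
        by (simp add: gauge_sup_def gauge_zero[OF \<phi>])
      then show False using x by simp
    qed
    then obtain k where "ennreal (u\<^sup>2) < cond_sq_sum f k x" by (auto simp: layer_def)
    also have "\<dots> \<le> cond_sq_sum f (Suc k) x" by (rule cond_sq_sum_mono) simp
    finally show ?thesis using x by (auto simp: U_def)
  qed
  have "set_norm ?E \<le> ennreal (norm_factor (osc_const 1 * 1 * (v / s\<^sup>2))) * set_norm ?G"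
  proof (rule set_norm_comparison[where D = "disjointed U"])
    show "disjointed U n \<in> sets (F n)" for n by (rule disjointed_F_sets[OF UF])
    show "disjoint_family (disjointed U)" by (rule disjoint_family_disjointed)
    show "?E \<in> sets M" using gauge_sup_indicator_measurable[OF f \<phi> layer_sets(1)] by simp
    show "?G \<in> sets M" using cond_square_fn_measurable[of f] by simp
    show "AE x in M. x \<in> ?E \<longrightarrow> x \<in> (\<Union>n. disjointed U n)"
      unfolding UN_disjointed_eq by (rule AE_I2) (use cover in blast)
    fix n A assume at: "is_atom M (F n) A" and AU: "A \<subseteq> disjointed U n"
    have A: "A \<in> sets (F n)" using at by (simp add: is_atom_def)
    have "?G \<inter> A = A" using AU UG[of n] disjointed_subset[of U n] by blast
    then show "measure M A \<le> 1 * measure M (?G \<inter> A)" by simp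
    \<comment> \<open>on \<open>A\<close> the threshold is first passed at index \<open>Suc n\<close>, so the layer starts there; only for
      \<open>n = 0\<close> may it contain index \<open>0\<close>, whose conditional mean is also taken at time \<open>0\<close>\<close>
    define W where "W k = (if n < k \<or> n = 0 then A \<inter> ?Ly k else {})" for k
    have W: "W k \<in> sets (F (k - 1))" for k
    proof (cases "n < k \<or> n = 0")
      case True
      then have "n \<le> k - 1" by auto
      then have "A \<in> sets (F (k - 1))" using A F_mono by blast
      then show ?thesis using True layer_sets(1)[of f "u\<^sup>2" v k] by (simp add: W_def sets.Int)
    qed (simp add: W_def)
    have same: "x \<in> W k \<longleftrightarrow> x \<in> ?Ly k" if x: "x \<in> A" for x k
    proof (cases "n < k \<or> n = 0")
      case False
      then obtain i where i: "n = Suc i" "k \<le> n" by (cases n) auto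
      have "x \<notin> U i" using x AU i by (auto simp: disjointed_def)
      then have "x \<in> space M \<Longrightarrow> cond_sq_sum f n x \<le> ennreal (u\<^sup>2)" using i by (auto simp: U_def not_less)
      then have "x \<in> space M \<Longrightarrow> cond_sq_sum f k x \<le> ennreal (u\<^sup>2)"
        using cond_sq_sum_mono[OF i(2), of f x] by auto
      then show ?thesis using False by (auto simp: W_def layer_def)
    qed (use x in \<open>auto simp: W_def\<close>)
    let ?R = "{x \<in> space M. ennreal s < gauge_sup \<phi> (\<lambda>k. indicator (W k) x * mdiff f k x)}"
    have "?R \<in> sets M" using gauge_sup_indicator_measurable[OF f \<phi> W] by simp
    moreover have "?E \<inter> A \<subseteq> ?R" using same by (auto simp: indicator_def)
    ultimately have "measure M (?E \<inter> A) \<le> measure M ?R" by (intro finite_measure_mono)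
    also have "\<dots> \<le> v / s\<^sup>2 * measure M A"
      using v by (intro energy_weak_type[OF f \<phi> F_sets[OF A] W _ s])
        (auto simp: W_def layer_def split: if_splits)
    finally show "measure M (?E \<inter> A) \<le> v / s\<^sup>2 * measure M A" .
  qed (use v s in auto)
  then show ?thesis by (simp add: level_norm_eq)
qed

lemma norm_factor_mult_le:
  assumes "0 < x" "0 < y" "y \<le> 1"
  shows "norm_factor (x * y) \<le> norm_factor x * y powr (1 / b)"
proof -
  have "y powr (1 / a) \<le> y powr (1 / b)"
    using assms a_pos a_le_b by (intro powr_mono') (auto simp: divide_simps)
  then have "x powr (1 / a) * y powr (1 / a) \<le> norm_factor x * y powr (1 / b)"
    "x powr (1 / b) * y powr (1 / b) \<le> norm_factor x * y powr (1 / b)"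
    unfolding norm_factor_def by (intro mult_mono; simp add: le_max_iff_disj)+
  then show ?thesis using assms by (simp add: norm_factor_def[of "x * y"] powr_mult)
qed

text \<open>On the layers, with thresholds \<open>2 powr - real j * t\<close> for the conditional square function, the weak
  type inequality of order \<open>2\<close> gives a gain with exponent \<open>2 / b > 1\<close>, of which a part, measured by
  \<open>\<eta>\<close>, pays for summing the layers.\<close>

lemma level_dominated_cond_square:
  assumes b2: "b < 2"
  shows "\<exists>C>0. \<exists>\<theta>>1. \<forall>f. martingale M F f \<longrightarrow> (\<forall>\<phi>\<in>gauges.
    level_dominated C (1 / 2) \<theta> (\<lambda>x. gauge_sup \<phi> (\<lambda>k. mdiff f k x)) (cond_square_fn M F f))"
proof -
  \<comment> \<open>any positive \<open>\<eta> < (2 - b) / (2 + b)\<close> makes \<open>\<theta> > 1\<close>\<close>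
  define \<eta> where "\<eta> = (2 - b) / (2 * (2 + b))"
  have \<eta>: "0 < \<eta>" using b2 b_pos by (simp add: \<eta>_def)
  define \<theta> where "\<theta> = 2 * (1 - \<eta>) / b - \<eta>"
  have \<eta>2: "\<eta> * (2 * (2 + b)) = 2 - b" using b_pos by (simp add: \<eta>_def)
  have "b * \<theta> = 2 - \<eta> * (2 + b)"
    unfolding \<theta>_def using b_pos by (simp add: field_simps)
  also have "\<dots> = (2 + b) / 2" using \<eta>2 by (simp add: algebra_simps)
  also have "\<dots> > b * 1" using b2 by simp
  finally have \<theta>: "1 < \<theta>" using b_pos by (simp only: mult_less_cancel_left_pos)
  have \<eta>1: "\<eta> < 1" unfolding \<eta>_def using b2 b_pos by (simp add: field_simps)
  define \<rho> where "\<rho> = 2 powr - \<eta>"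
  have \<rho>: "0 < \<rho>" "\<rho> < 1" unfolding \<rho>_def using \<eta> by (auto intro!: powr_less_one)
  define c0 where "c0 = (1 - \<rho>) / 2"
  have c0: "0 < c0" using \<rho> by (simp add: c0_def)
  obtain B where B: "0 < B" and UN: "\<And>E. (\<And>j. E j \<in> sets M) \<Longrightarrow>
    set_norm (\<Union>j::nat. E j) \<le> ennreal B * (SUP j. ennreal (2 powr (\<eta> * real j)) * set_norm (E j))"
    using set_norm_UN_le[OF \<eta>] by auto
  obtain B2 where B2: "0 < B2" and Un: "\<And>E E'. E \<in> sets M \<Longrightarrow> E' \<in> sets M \<Longrightarrow>
    set_norm (E \<union> E') \<le> ennreal B2 * max (set_norm E) (set_norm E')"
    using set_norm_Un_le by blast
  define nf where "nf = norm_factor (osc_const 1 * (1 / c0\<^sup>2))"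
  have nf: "0 < nf" unfolding nf_def using osc_const_pos[of 1] c0 by (intro norm_factor_pos) simp
  define C where "C = B2 * max (B * nf) 1"
  have C: "0 < C" using B2 by (simp add: C_def)
  show ?thesis
  proof (rule exI[of _ C], intro conjI C, rule exI[of _ \<theta>], intro conjI \<theta> allI impI ballI)
    fix f and \<phi> :: "nat \<Rightarrow> (nat \<Rightarrow> real) \<Rightarrow> real" assume f: "martingale M F f" and \<phi>: "\<phi> \<in> gauges"
    let ?G = "\<lambda>x. gauge_sup \<phi> (\<lambda>k. mdiff f k x)" and ?s = "cond_square_fn M F f"
    let ?n = "level_norm M p ?s"
    show "level_dominated C (1 / 2) \<theta> ?G ?s"
      unfolding level_dominated_def
    proof (intro allI impI)
      fix t :: real assume t: "0 < t"
      define u where "u j = 2 powr - real j * t" for j :: nat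
      define c where "c j = c0 * \<rho> ^ j" for j :: nat
      have u: "0 < u j" for j using t by (simp add: u_def)
      have u_Suc: "u (Suc j) \<le> u j" for j
        using t by (auto simp: u_def intro!: mult_right_mono powr_mono)
      have u0: "u 0 = t" by (simp add: u_def)
      have c: "0 < c j" for j using c0 \<rho> by (simp add: c_def)
      define Ly where "Ly j = layer f ((u (Suc j))\<^sup>2) ((u j)\<^sup>2)" for j
      define E where "E j = {x \<in> space M. ennreal (c j * t)
          < gauge_sup \<phi> (\<lambda>k. indicator (Ly j k) x * mdiff f k x)}" for j
      define R where "R J = {x \<in> space M. ennreal (t / 2)
          < gauge_sup \<phi> (\<lambda>k. indicator (lower_layer f ((u J)\<^sup>2) k) x * mdiff f k x)}" for J
      let ?S = "SUP j::nat. ennreal (2 powr - (\<theta> * real j)) * ?n (1 / 2 * 2 powr - real j * t)"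
      have EM: "E j \<in> sets M" for j
        unfolding E_def Ly_def using gauge_sup_indicator_measurable[OF f \<phi> layer_sets(1)] by simp
      have RM: "R J \<in> sets M" for J
        unfolding R_def using gauge_sup_indicator_measurable[OF f \<phi> layer_sets(2)] by simp
      have E_le: "ennreal (2 powr (\<eta> * real j)) * set_norm (E j) \<le> ennreal nf * ?S" for j
      proof -
        define y where "y = 2 powr (- 2 * (1 - \<eta>) * real j)"
        have y: "0 < y" "y \<le> 1"
          unfolding y_def using \<eta>1 powr_mono[of "- 2 * (1 - \<eta>) * real j" 0 "2 :: real"]
          by (auto simp: mult_nonneg_nonneg mult_le_0_iff)
        have ratio: "(u j)\<^sup>2 / (c j * t)\<^sup>2 = 1 / c0\<^sup>2 * y"
        proof -
          have "\<rho> ^ j = 2 powr (- \<eta> * real j)" by (simp add: \<rho>_def powr_realpow[symmetric] powr_powr)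
          then have "u j / (c j * t) = 1 / c0 * 2 powr (- (1 - \<eta>) * real j)"
            using t c0 powr_diff[of 2 "- real j" "- \<eta> * real j"]
            by (simp add: u_def c_def algebra_simps)
          then have "(u j / (c j * t))\<^sup>2 = (1 / c0)\<^sup>2 * (2 powr (- (1 - \<eta>) * real j))\<^sup>2"
            by (simp only: power_mult_distrib)
          also have "(2 powr (- (1 - \<eta>) * real j))\<^sup>2 = y"
            unfolding y_def power2_eq_square powr_add[symmetric] by (simp add: algebra_simps)
          finally show ?thesis by (simp add: power_divide)
        qed
        have "set_norm (E j) \<le> ennreal (norm_factor (osc_const 1 * ((u j)\<^sup>2 / (c j * t)\<^sup>2))) * ?n (u (Suc j))"
          unfolding E_def Ly_def using u[of j] u[of "Suc j"] c[of j] t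
          by (intro layer_norm_le[OF f \<phi>]) auto
        also have "\<dots> \<le> ennreal (nf * y powr (1 / b)) * ?n (u (Suc j))"
        proof (intro mult_right_mono ennreal_leI zero_le)
          have "norm_factor (osc_const 1 * (1 / c0\<^sup>2) * y) \<le> nf * y powr (1 / b)"
            unfolding nf_def using osc_const_pos[of 1] c0 y by (intro norm_factor_mult_le) auto
          then show "norm_factor (osc_const 1 * ((u j)\<^sup>2 / (c j * t)\<^sup>2)) \<le> nf * y powr (1 / b)"
            unfolding ratio by (simp add: mult.assoc)
        qed
        finally have "ennreal (2 powr (\<eta> * real j)) * set_norm (E j)
            \<le> ennreal (2 powr (\<eta> * real j)) * (ennreal (nf * y powr (1 / b)) * ?n (u (Suc j)))"
          by (rule mult_left_mono) auto
        also have "\<dots> = ennreal (2 powr (\<eta> * real j) * (nf * y powr (1 / b))) * ?n (u (Suc j))"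
          using nf by (simp add: ennreal_mult mult.assoc)
        also have "2 powr (\<eta> * real j) * (nf * y powr (1 / b)) = nf * 2 powr - (\<theta> * real j)"
        proof -
          have "\<eta> * real j + - 2 * (1 - \<eta>) * real j * (1 / b) = - (\<theta> * real j)"
            unfolding \<theta>_def by (simp add: algebra_simps diff_divide_distrib add_divide_distrib)
          then show ?thesis unfolding y_def powr_powr
            by (simp add: powr_add[symmetric] mult.left_commute del: times_divide_eq_right)
        qed
        also have "ennreal (nf * 2 powr - (\<theta> * real j)) * ?n (u (Suc j))
            = ennreal nf * (ennreal (2 powr - (\<theta> * real j)) * ?n (u (Suc j)))"
          using nf by (simp add: ennreal_mult mult.assoc)
        also have "u (Suc j) = 1 / 2 * 2 powr - real j * t"
          unfolding u_def using powr_add[of 2 "- 1" "- real j"] by (simp add: powr_minus_divide)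
        also have "ennreal nf * (ennreal (2 powr - (\<theta> * real j)) * ?n (1 / 2 * 2 powr - real j * t))
            \<le> ennreal nf * ?S"
          by (intro mult_left_mono SUP_upper) auto
        finally show ?thesis .
      qed
      \<comment> \<open>what lies below all layers: it vanishes almost everywhere, by the energy bound\<close>
      have R0: "measure M (\<Inter>J. R J) = 0"
      proof -
        have "measure M (\<Inter>J. R J) \<le> 4 * (1 / 4) ^ J" for J
        proof -
          have "measure M (\<Inter>J. R J) \<le> measure M (R J)" by (intro finite_measure_mono RM) auto
          also have "\<dots> \<le> (u J)\<^sup>2 / (t / 2)\<^sup>2 * measure M (space M)"
            unfolding R_def using t
            by (intro energy_weak_type[OF f \<phi> sets.top layer_sets(2)]) (auto simp: lower_layer_def)
          also have "\<dots> = 4 * (1 / 4) ^ J"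
          proof -
            have "(2 powr - real J) = (1 / 2 :: real) ^ J"
              by (simp add: powr_minus_divide powr_realpow power_divide)
            then have "(u J)\<^sup>2 = ((1 / 2) ^ J)\<^sup>2 * t\<^sup>2" by (simp add: u_def power_mult_distrib)
            also have "((1 / 2 :: real) ^ J)\<^sup>2 = (1 / 4) ^ J"
              by (simp add: power_mult[symmetric] mult.commute[of J] power_mult power_divide)
            finally show ?thesis using t by (simp add: prob_space power_divide)
          qed
          finally show ?thesis .
        qed
        moreover have "(\<lambda>J. 4 * (1 / 4 :: real) ^ J) \<longlonglongrightarrow> 4 * 0"
          by (intro tendsto_mult tendsto_const LIMSEQ_realpow_zero) auto
        ultimately have "measure M (\<Inter>J. R J) \<le> 4 * 0"
          by (intro LIMSEQ_le_const[of "\<lambda>J. 4 * (1 / 4 :: real) ^ J"]) auto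
        then show ?thesis by (intro antisym measure_nonneg) simp
      qed
      have "(\<Inter>J. R J) \<in> sets M" using RM by (intro sets.countable_INT) auto
      then have R_null: "AE x in M. x \<notin> (\<Inter>J. R J)"
        using R0 by (intro AE_not_in) (simp add: null_sets_def emeasure_eq_measure)
      have split: "AE x in M. x \<in> {x \<in> space M. ennreal t < ?G x}
          \<longrightarrow> x \<in> {x \<in> space M. ennreal t < ?s x} \<union> (\<Union>j. E j)"
        using R_null
      proof (eventually_elim, intro impI)
        fix x assume xR: "x \<notin> (\<Inter>J. R J)" and xG: "x \<in> {x \<in> space M. ennreal t < ?G x}"
        then have x: "x \<in> space M" by simp
        show "x \<in> {x \<in> space M. ennreal t < ?s x} \<union> (\<Union>j. E j)"
        proof (rule ccontr)
          assume neg: "\<not> ?thesis"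
          then have "\<not> ennreal (t\<^sup>2) < (\<Sum>k. cond_sq f k x)"
            using x t less_cond_square_fn_iff[of t f x] by auto
          then have V: "cond_sq_sum f k x \<le> ennreal ((u 0)\<^sup>2)" for k
            using cond_sq_sum_le_suminf[of f k x] by (simp add: u0 not_less)
          obtain J where J: "x \<notin> R J" using xR by auto
          obtain m where m: "t < \<phi> m (\<lambda>k. mdiff f k x)"
            using xG t less_gauge_sup_iff[OF \<phi>, of t] by auto
          let ?d = "\<lambda>k. mdiff f k x"
          have decomp: "?d k = (\<Sum>j<J. indicator (Ly j k) x * ?d k)
              + indicator (lower_layer f ((u J)\<^sup>2) k) x * ?d k" for k
          proof (induction J)
            case 0
            then show ?case using V[of k] x by (simp add: lower_layer_def)
          next
            case (Suc J)
            have "(u (Suc J))\<^sup>2 \<le> (u J)\<^sup>2"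
              using u_Suc[of J] u[of "Suc J"] by (intro power_mono) auto
            then have eq: "(indicator (lower_layer f ((u J)\<^sup>2) k) x :: real)
                = indicator (Ly J k) x + indicator (lower_layer f ((u (Suc J))\<^sup>2) k) x"
              unfolding Ly_def by (rule indicator_lower_layer[OF x])
            note Suc
            also have "(\<Sum>j<J. indicator (Ly j k) x * ?d k) + indicator (lower_layer f ((u J)\<^sup>2) k) x * ?d k
                = (\<Sum>j<Suc J. indicator (Ly j k) x * ?d k) + indicator (lower_layer f ((u (Suc J))\<^sup>2) k) x * ?d k"
              unfolding eq by (simp add: distrib_right)
            finally show ?case .
          qed
          have "\<phi> m ?d = \<phi> m (\<lambda>k. (\<Sum>j<J. indicator (Ly j k) x * ?d k)
              + indicator (lower_layer f ((u J)\<^sup>2) k) x * ?d k)"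
            by (rule gauge_cong[OF \<phi>]) (rule decomp)
          also have "\<dots> \<le> \<phi> m (\<lambda>k. \<Sum>j<J. indicator (Ly j k) x * ?d k)
              + \<phi> m (\<lambda>k. indicator (lower_layer f ((u J)\<^sup>2) k) x * ?d k)"
            by (rule gauge_add[OF \<phi>])
          also have "\<dots> \<le> (\<Sum>j<J. \<phi> m (\<lambda>k. indicator (Ly j k) x * ?d k))
              + \<phi> m (\<lambda>k. indicator (lower_layer f ((u J)\<^sup>2) k) x * ?d k)"
            by (intro add_right_mono gauge_sum[OF \<phi>])
          also have "\<dots> \<le> (\<Sum>j<J. c j * t) + t / 2"
          proof (intro add_mono sum_mono)
            fix j
            have "x \<notin> E j" using neg by auto
            then show "\<phi> m (\<lambda>k. indicator (Ly j k) x * ?d k) \<le> c j * t"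
              using x c[of j] t less_gauge_sup_iff[OF \<phi>, of "c j * t"] by (auto simp: E_def not_less)
            show "\<phi> m (\<lambda>k. indicator (lower_layer f ((u J)\<^sup>2) k) x * ?d k) \<le> t / 2"
              using J x t less_gauge_sup_iff[OF \<phi>, of "t / 2"] by (auto simp: R_def not_less)
          qed
          also have "(\<Sum>j<J. c j * t) \<le> t / 2"
          proof -
            have "(\<Sum>j<J. \<rho> ^ j) \<le> (\<Sum>j. \<rho> ^ j)"
              using \<rho> by (intro sum_le_suminf summable_geometric) auto
            also have "\<dots> = 1 / (1 - \<rho>)" using \<rho> by (intro suminf_geometric) auto
            finally have "c0 * t * (\<Sum>j<J. \<rho> ^ j) \<le> c0 * t * (1 / (1 - \<rho>))"
              using c0 t by (intro mult_left_mono) auto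
            also have "\<dots> = t / 2" using \<rho> by (simp add: c0_def field_simps)
            finally show ?thesis by (simp add: c_def sum_distrib_left mult_ac)
          qed
          finally show False using m by simp
        qed
      qed
      have "level_norm M p ?G t \<le> set_norm ({x \<in> space M. ennreal t < ?s x} \<union> (\<Union>j. E j))"
        unfolding level_norm_eq by (rule set_norm_mono_AE[OF split])
      also have "\<dots> \<le> ennreal B2 * max (?n t) (set_norm (\<Union>j. E j))"
        unfolding level_norm_eq
        by (rule Un) (use cond_square_fn_measurable[of f] EM in \<open>auto intro: sets.countable_UN\<close>)
      also have "\<dots> \<le> ennreal B2 * (ennreal (max (B * nf) 1) * ?S)"
      proof (intro mult_left_mono max.boundedI zero_le)
        have "?n t \<le> ?n (1 / 2 * 2 powr - real 0 * t)"
          using t by (intro level_norm_antimono) simp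
        also have "\<dots> \<le> ?S" by (rule SUP_upper2[of 0]) auto
        also have "\<dots> = ennreal 1 * ?S" by simp
        also have "\<dots> \<le> ennreal (max (B * nf) 1) * ?S" by (intro mult_right_mono ennreal_leI) auto
        finally show "?n t \<le> ennreal (max (B * nf) 1) * ?S" .
        have "set_norm (\<Union>j. E j) \<le> ennreal B * (SUP j. ennreal (2 powr (\<eta> * real j)) * set_norm (E j))"
          by (rule UN[OF EM])
        also have "\<dots> \<le> ennreal B * (ennreal nf * ?S)"
          by (intro mult_left_mono SUP_least E_le) auto
        also have "\<dots> = ennreal (B * nf) * ?S" using B nf by (simp add: ennreal_mult mult.assoc)
        also have "\<dots> \<le> ennreal (max (B * nf) 1) * ?S" by (intro mult_right_mono ennreal_leI) auto
        finally show "set_norm (\<Union>j. E j) \<le> ennreal (max (B * nf) 1) * ?S" .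
      qed
      also have "\<dots> = ennreal C * ?S" using B2 by (simp add: C_def ennreal_mult mult.assoc)
      finally show "level_norm M p ?G t \<le> ennreal C * ?S" .
    qed
  qed
qed

lemma lorentz_norm_gauge_le_cond_square:
  assumes b2: "b < 2" and q: "0 < q"
  shows "\<exists>C>0. \<forall>f. martingale M F f \<longrightarrow> (\<forall>\<phi>\<in>gauges.
    lorentz_norm M p q (\<lambda>x. gauge_sup \<phi> (\<lambda>k. mdiff f k x))
      \<le> ennreal C * lorentz_norm M p q (cond_square_fn M F f))"
proof -
  obtain C \<theta> where C: "0 < C" "1 < \<theta>" and dom: "\<And>f \<phi>. martingale M F f \<Longrightarrow> \<phi> \<in> gauges \<Longrightarrow>
    level_dominated C (1 / 2) \<theta> (\<lambda>x. gauge_sup \<phi> (\<lambda>k. mdiff f k x)) (cond_square_fn M F f)"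
    using level_dominated_cond_square[OF b2] by blast
  obtain C' where "0 < C'" "\<And>G g. level_dominated C (1 / 2) \<theta> G g \<Longrightarrow>
      lorentz_norm M p q G \<le> ennreal C' * lorentz_norm M p q g"
    using lorentz_norm_le_of_level_dominated[OF C(1) _ C(2) q, of "1 / 2"] by auto
  then show ?thesis using dom by blast
qed

end

section \<open>Regular filtrations\<close>

context atomic_filtration
begin

text \<open>Regularity with a given constant \<open>R\<close>.\<close>

definition regular_with :: "real \<Rightarrow> bool" where
  "regular_with R \<longleftrightarrow> (\<forall>n\<ge>1. \<forall>A\<in>sets (F n). \<exists>B\<in>sets (F (n - 1)).
      A \<subseteq> B \<and> measure M B \<le> R * measure M A)"

lemma regular_atom:
  assumes reg: "regular_with R"
    and J: "is_atom M (F n) J" and A: "A \<in> sets (F (Suc n))" "A \<subseteq> J" "measure M A \<noteq> 0"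
  shows "measure M J \<le> R * measure M A"
proof -
  obtain B where B: "B \<in> sets (F n)" "A \<subseteq> B" "measure M B \<le> R * measure M A"
    using reg[unfolded regular_with_def, rule_format, of "Suc n" A] A(1) by auto
  have JF: "J \<in> sets (F n)" using J by (simp add: is_atom_def)
  have BJ: "B \<inter> J \<in> sets (F n)" using B(1) JF by auto
  have "0 < measure M A" using A(3) measure_nonneg[of M A] by linarith
  also have "\<dots> \<le> measure M (B \<inter> J)" using A B by (intro finite_measure_mono F_sets[OF BJ]) auto
  finally have "measure M (B \<inter> J) = measure M J"
    by (intro atom_subset(2)[OF finite_measure_axioms subalg J BJ]) auto
  moreover have "measure M (B \<inter> J) \<le> measure M B" by (intro finite_measure_mono F_sets[OF B(1)]) auto
  ultimately show ?thesis using B(3) by simp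
qed

text \<open>An a.e. finite predictable bound can be replaced by a real-valued one.\<close>

lemma real_control:
  assumes V: "\<And>n. V n \<in> borel_measurable (F n)" and fin: "AE x in M. (SUP n. V n x) < (\<infinity> :: ennreal)"
  shows "\<exists>l\<in>control_seqs M F. (AE x in M. control_limit l x \<le> (SUP n. V n x)) \<and>
    (AE x in M. \<forall>n. V n x \<le> ennreal (l n x))"
proof -
  define l where "l n x = Max ((\<lambda>k. enn2real (V k x)) ` {..n})" for n x
  have l_ge: "enn2real (V k x) \<le> l n x" if "k \<le> n" for k n x
    unfolding l_def using that by (intro Max_ge) auto
  have l_ex: "\<exists>k\<le>n. l n x = enn2real (V k x)" for n x
  proof -
    have "l n x \<in> (\<lambda>k. enn2real (V k x)) ` {..n}" unfolding l_def by (intro Max_in) auto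
    then show ?thesis by auto
  qed
  have l: "l \<in> control_seqs M F"
    unfolding control_seqs_def mem_Collect_eq
  proof (intro conjI allI ballI)
    fix n
    show "l n \<in> borel_measurable (F n)"
      unfolding l_def[abs_def]
    proof (rule borel_measurable_Max)
      fix k assume "k \<in> {..n}"
      then have "V k \<in> borel_measurable (F n)" using F_mono_measurable[OF _ V[of k], of n] by auto
      then show "(\<lambda>x. enn2real (V k x)) \<in> borel_measurable (F n)" by measurable
    qed simp
    fix x
    show "0 \<le> l n x" using l_ge[of 0 n x] enn2real_nonneg[of "V 0 x"] by linarith
    obtain k where "k \<le> n" "l n x = enn2real (V k x)" using l_ex by blast
    then show "l n x \<le> l (Suc n) x" using l_ge[of k "Suc n" x] by simp
  qed
  have V_fin: "V n x < \<infinity>" if "(SUP n. V n x) < \<infinity>" for n x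
    using that by (rule le_less_trans[rotated]) (rule SUP_upper, simp)
  have "AE x in M. control_limit l x \<le> (SUP n. V n x)"
    using fin AE_space
  proof eventually_elim
    case (elim x)
    show ?case unfolding control_limit_eq[OF l elim(2)]
    proof (rule SUP_least)
      fix n
      obtain k where "l n x = enn2real (V k x)" using l_ex by blast
      then have "ennreal (l n x) = V k x" using V_fin[OF elim(1), of k] by simp
      also have "\<dots> \<le> (SUP n. V n x)" by (rule SUP_upper) auto
      finally show "ennreal (l n x) \<le> (SUP n. V n x)" .
    qed
  qed
  moreover have "AE x in M. \<forall>n. V n x \<le> ennreal (l n x)"
    using fin
  proof (eventually_elim, intro allI)
    fix x n assume "(SUP n. V n x) < \<infinity>"
    then have "V n x = ennreal (enn2real (V n x))" using V_fin[of x n] by simp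
    also have "\<dots> \<le> ennreal (l n x)" using l_ge[of n n x] by (rule ennreal_leI) simp
    finally show "V n x \<le> ennreal (l n x)" .
  qed
  ultimately show ?thesis using l by blast
qed

text \<open>The predictable envelope of a gauge is its essential supremum over the atoms of the previous level,
  encoded without a choice of atoms: the set \<open>exceed f \<phi> r n\<close> consists, up to a null set, of
  the atoms of level \<open>n\<close> that the event \<open>r < \<phi> (Suc n)\<close> meets in positive measure.\<close>

definition exceed ::
    "(nat \<Rightarrow> 'a \<Rightarrow> real) \<Rightarrow> (nat \<Rightarrow> (nat \<Rightarrow> real) \<Rightarrow> real) \<Rightarrow> real \<Rightarrow> nat \<Rightarrow> 'a set" where
  "exceed f \<phi> r n = {x \<in> space M. 0 < nn_cond_exp M (F n)
      (indicator {x \<in> space M. r < \<phi> (Suc n) (\<lambda>k. mdiff f k x)}) x}"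

definition envelope ::
    "(nat \<Rightarrow> 'a \<Rightarrow> real) \<Rightarrow> (nat \<Rightarrow> (nat \<Rightarrow> real) \<Rightarrow> real) \<Rightarrow> nat \<Rightarrow> 'a \<Rightarrow> ennreal" where
  "envelope f \<phi> n x = (SUP r\<in>\<rat> \<inter> {0<..}. ennreal r * indicator (exceed f \<phi> r n) x)"

lemma exceed_sets: "exceed f \<phi> r n \<in> sets (F n)"
proof -
  have "{x \<in> space (F n). 0 < nn_cond_exp M (F n)
      (indicator {x \<in> space M. r < \<phi> (Suc n) (\<lambda>k. mdiff f k x)}) x} \<in> sets (F n)" by measurable
  then show ?thesis by (simp add: exceed_def F_space)
qed

lemma countable_pos_rat: "countable (\<rat> \<inter> {0::real<..})"
  using countable_rat by (rule countable_subset[rotated]) auto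

lemma envelope_measurable: "envelope f \<phi> n \<in> borel_measurable (F n)"
  unfolding envelope_def[abs_def]
proof (rule borel_measurable_SUP[OF countable_pos_rat])
  fix r
  show "(\<lambda>x. ennreal r * indicator (exceed f \<phi> r n) x) \<in> borel_measurable (F n)"
    using exceed_sets[measurable] by measurable
qed

lemma gauge_exceed_sets:
  assumes f: "martingale M F f" and \<phi>: "\<phi> \<in> gauges"
  shows "{x \<in> space M. r < \<phi> n (\<lambda>k. mdiff f k x)} \<in> sets (F n)"
proof -
  have "(\<lambda>x. \<phi> n (\<lambda>k. mdiff f k x)) \<in> borel_measurable (F n)"
    by (rule gauge_measurable[OF \<phi>]) (rule mdiff_F_measurable[OF f])
  then have "{x \<in> space (F n). r < \<phi> n (\<lambda>k. mdiff f k x)} \<in> sets (F n)" by simp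
  then show ?thesis by (simp add: F_space)
qed

lemma exceed_integral:
  assumes f: "martingale M F f" and \<phi>: "\<phi> \<in> gauges" and A: "A \<in> sets (F n)"
  shows "(\<integral>\<^sup>+x. indicator A x * nn_cond_exp M (F n)
      (indicator {x \<in> space M. r < \<phi> (Suc n) (\<lambda>k. mdiff f k x)}) x \<partial>M)
    = emeasure M (A \<inter> {x \<in> space M. r < \<phi> (Suc n) (\<lambda>k. mdiff f k x)})"
proof -
  interpret sigma_finite_subalgebra M "F n" by (rule sigma_finite_F)
  let ?X = "{x \<in> space M. r < \<phi> (Suc n) (\<lambda>k. mdiff f k x)}"
  have X [measurable]: "?X \<in> sets M" by (rule F_sets[OF gauge_exceed_sets[OF f \<phi>]])
  have AM: "A \<in> sets M" by (rule F_sets[OF A])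
  have "(\<integral>\<^sup>+x. indicator A x * nn_cond_exp M (F n) (indicator ?X) x \<partial>M)
      = (\<integral>\<^sup>+x. indicator A x * indicator ?X x \<partial>M)"
    using A X by (intro nn_cond_exp_intg) auto
  also have "\<dots> = (\<integral>\<^sup>+x. indicator (A \<inter> ?X) x \<partial>M)"
    by (simp add: indicator_inter_arith)
  also have "\<dots> = emeasure M (A \<inter> ?X)" using X AM by (intro nn_integral_indicator) auto
  finally show ?thesis .
qed

lemma gauge_le_envelope:
  assumes f: "martingale M F f" and \<phi>: "\<phi> \<in> gauges"
  shows "AE x in M. ennreal (\<phi> (Suc n) (\<lambda>k. mdiff f k x)) \<le> envelope f \<phi> n x"
proof -
  let ?\<phi> = "\<lambda>x. \<phi> (Suc n) (\<lambda>k. mdiff f k x)"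
  have "AE x in M. r < ?\<phi> x \<longrightarrow> x \<in> exceed f \<phi> r n" for r
  proof -
    let ?X = "{x \<in> space M. r < ?\<phi> x}" and ?N = "space M - exceed f \<phi> r n"
    have N: "?N \<in> sets (F n)" using exceed_sets[of f \<phi> r n] F_space[of n] by (metis sets.compl_sets)
    have XM: "?X \<in> sets M" by (rule F_sets[OF gauge_exceed_sets[OF f \<phi>]])
    have "emeasure M (?N \<inter> ?X) = (\<integral>\<^sup>+x. indicator ?N x * nn_cond_exp M (F n) (indicator ?X) x \<partial>M)"
      by (rule exceed_integral[OF f \<phi> N, symmetric])
    also have "\<dots> = (\<integral>\<^sup>+x. 0 \<partial>M)"
      by (intro nn_integral_cong) (auto simp: exceed_def indicator_def)
    finally have "?N \<inter> ?X \<in> null_sets M" using XM F_sets[OF N] by (auto simp: null_sets_def)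
    then have "AE x in M. x \<notin> ?N \<inter> ?X" by (rule AE_not_in)
    then show ?thesis using AE_space by eventually_elim auto
  qed
  then have "AE x in M. \<forall>r\<in>\<rat> \<inter> {0<..}. r < ?\<phi> x \<longrightarrow> x \<in> exceed f \<phi> r n"
    by (intro AE_ball_countable[THEN iffD2] countable_pos_rat) auto
  then show ?thesis
  proof eventually_elim
    case (elim x)
    show ?case
    proof (rule ccontr)
      assume "\<not> ?case"
      then have lt: "envelope f \<phi> n x < ennreal (?\<phi> x)" by simp
      then obtain e where e: "0 \<le> e" "envelope f \<phi> n x = ennreal e"
        by (cases "envelope f \<phi> n x") auto
      then have "e < ?\<phi> x" using lt by (simp add: ennreal_less_iff)
      then obtain r where r: "r \<in> \<rat>" "e < r" "r < ?\<phi> x" using Rats_dense_in_real by blast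
      then have "x \<in> exceed f \<phi> r n" using elim e by auto
      then have "ennreal r \<le> envelope f \<phi> n x"
        unfolding envelope_def using r e by (intro SUP_upper2[of r]) auto
      then show False using e r by (simp add: ennreal_le_iff)
    qed
  qed
qed

text \<open>Regularity is used through the comparison of an atom with its part on which the gauge is
  large.\<close>

lemma level_norm_envelope:
  assumes reg: "regular_with R" and R: "1 \<le> R"
    and f: "martingale M F f" and \<phi>: "\<phi> \<in> gauges" and t: "0 < t"
  shows "level_norm M p (\<lambda>x. SUP n. envelope f \<phi> n x) t
    \<le> ennreal (norm_factor (osc_const R * R)) * level_norm M p (\<lambda>x. gauge_sup \<phi> (\<lambda>k. mdiff f k x)) t"
proof -
  let ?Y = "\<lambda>x. SUP n. envelope f \<phi> n x" and ?G = "\<lambda>x. gauge_sup \<phi> (\<lambda>k. mdiff f k x)"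
  let ?E = "{x \<in> space M. ennreal t < ?Y x}" and ?Gt = "{x \<in> space M. ennreal t < ?G x}"
  define U where "U n = {x \<in> space M. ennreal t < envelope f \<phi> n x}" for n
  have UF: "U n \<in> sets (F n)" for n
  proof -
    have "{x \<in> space (F n). ennreal t < envelope f \<phi> n x} \<in> sets (F n)"
      using envelope_measurable by simp
    then show ?thesis by (simp add: U_def F_space)
  qed
  have E_eq: "?E = (\<Union>n. U n)" by (auto simp: U_def less_SUP_iff)
  have "set_norm ?E \<le> ennreal (norm_factor (osc_const R * R * 1)) * set_norm ?Gt"
  proof (rule set_norm_comparison[where D = "disjointed U"])
    show "disjointed U n \<in> sets (F n)" for n by (rule disjointed_F_sets[OF UF])
    show "disjoint_family (disjointed U)" by (rule disjoint_family_disjointed)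
    show "?E \<in> sets M" unfolding E_eq using F_sets[OF UF] by auto
    show Gt: "?Gt \<in> sets M" using gauge_sup_mdiff_measurable[OF f \<phi>] by simp
    show "AE x in M. x \<in> ?E \<longrightarrow> x \<in> (\<Union>n. disjointed U n)"
      unfolding UN_disjointed_eq E_eq by simp
    fix n A assume at: "is_atom M (F n) A" and AU: "A \<subseteq> disjointed U n"
    have A: "A \<in> sets (F n)" using at by (simp add: is_atom_def)
    show "measure M (?E \<inter> A) \<le> 1 * measure M A"
      using finite_measure_mono[OF _ F_sets[OF A], of "?E \<inter> A"] by simp
    have "\<exists>r\<in>\<rat> \<inter> {t<..}. emeasure M (A \<inter> exceed f \<phi> r n) \<noteq> 0"
    proof (rule ccontr)
      assume neg: "\<not> ?thesis"
      have "A \<subseteq> (\<Union>r\<in>\<rat> \<inter> {t<..}. A \<inter> exceed f \<phi> r n)"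
      proof
        fix x assume x: "x \<in> A"
        then have "ennreal t < envelope f \<phi> n x"
          using AU disjointed_subset[of U n] by (auto simp: U_def)
        then obtain r where r: "r \<in> \<rat>" "0 < r" "ennreal t < ennreal r * indicator (exceed f \<phi> r n) x"
          unfolding envelope_def less_SUP_iff by auto
        then have "x \<in> exceed f \<phi> r n" by (cases "x \<in> exceed f \<phi> r n") auto
        moreover have "t < r" using r calculation t by (simp add: ennreal_less_iff)
        ultimately have "x \<in> exceed f \<phi> r n" "t < r" by auto
        then show "x \<in> (\<Union>r\<in>\<rat> \<inter> {t<..}. A \<inter> exceed f \<phi> r n)" using x r by auto
      qed
      moreover have "(\<Union>r\<in>\<rat> \<inter> {t<..}. A \<inter> exceed f \<phi> r n) \<in> null_sets M"
      proof (rule null_sets_UN')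
        show "countable (\<rat> \<inter> {t<..})" using countable_rat by (rule countable_subset[rotated]) auto
        fix r assume "r \<in> \<rat> \<inter> {t<..}"
        then show "A \<inter> exceed f \<phi> r n \<in> null_sets M"
          using neg F_sets[OF A] F_sets[OF exceed_sets] by (auto simp: null_sets_def)
      qed
      ultimately have "A \<in> null_sets M" using F_sets[OF A] null_sets_subset by blast
      then have "measure M A = 0" by (simp add: null_sets_def measure_def)
      then show False using at by (simp add: is_atom_def)
    qed
    then obtain r where r: "t < r" "emeasure M (A \<inter> exceed f \<phi> r n) \<noteq> 0" by auto
    let ?X = "{x \<in> space M. r < \<phi> (Suc n) (\<lambda>k. mdiff f k x)}"
    have XF: "?X \<in> sets (F (Suc n))" by (rule gauge_exceed_sets[OF f \<phi>])
    have AX: "A \<inter> ?X \<in> sets (F (Suc n))" using A XF F_mono[of n "Suc n"] by auto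
    have "emeasure M (A \<inter> ?X) \<noteq> 0"
    proof
      assume 0: "emeasure M (A \<inter> ?X) = 0"
      let ?Z = "nn_cond_exp M (F n) (indicator ?X)"
      have "(\<integral>\<^sup>+x. indicator A x * ?Z x \<partial>M) = 0"
        unfolding exceed_integral[OF f \<phi> A] by (rule 0)
      then have "AE x in M. indicator A x * ?Z x = 0"
        using F_sets[OF A] by (subst (asm) nn_integral_0_iff_AE) auto
      then have "AE x in M. x \<notin> A \<inter> exceed f \<phi> r n"
        by eventually_elim (auto simp: exceed_def indicator_def)
      then have "A \<inter> exceed f \<phi> r n \<in> null_sets M"
        using F_sets[OF A] F_sets[OF exceed_sets] by (subst AE_iff_null_sets) auto
      then show False using r(2) by (simp add: null_sets_def)
    qed
    then have "measure M (A \<inter> ?X) \<noteq> 0" by (simp add: emeasure_eq_measure)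
    then have "measure M A \<le> R * measure M (A \<inter> ?X)"
      by (intro regular_atom[OF reg at AX]) auto
    also have "\<dots> \<le> R * measure M (?Gt \<inter> A)"
    proof (intro mult_left_mono finite_measure_mono)
      show "A \<inter> ?X \<subseteq> ?Gt \<inter> A"
        using r(1) t less_gauge_sup_iff[OF \<phi>, of t] by (auto intro: less_trans)
      show "?Gt \<inter> A \<in> sets M" using Gt F_sets[OF A] by auto
    qed (use R in auto)
    finally show "measure M A \<le> R * measure M (?Gt \<inter> A)" .
  qed (use R in auto)
  then show ?thesis by (simp add: level_norm_eq)
qed

lemma level_dominatedI:
  assumes C: "0 < C" and le: "\<And>t. 0 < t \<Longrightarrow> level_norm M p G t \<le> ennreal C * level_norm M p g (c * t)"
  shows "level_dominated C c \<theta> G g"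
  unfolding level_dominated_def
proof (intro allI impI)
  fix t :: real assume t: "0 < t"
  have "level_norm M p g (c * t) \<le> (SUP j::nat. ennreal (2 powr - (\<theta> * real j)) *
      level_norm M p g (c * 2 powr - real j * t))"
    by (rule SUP_upper2[of 0]) auto
  then show "level_norm M p G t \<le> ennreal C * (SUP j::nat. ennreal (2 powr - (\<theta> * real j)) *
      level_norm M p g (c * 2 powr - real j * t))"
    using le[OF t] by (meson mult_left_mono order_trans zero_le)
qed

lemma regular_gauge_control:
  assumes reg: "regular_with R" and R: "1 \<le> R" and q: "0 < q"
  shows "\<exists>C>0. \<forall>f. martingale M F f \<longrightarrow> (\<forall>\<phi>\<in>gauges.
    lorentz_norm M p q (\<lambda>x. gauge_sup \<phi> (\<lambda>k. mdiff f k x)) < \<infinity> \<longrightarrow>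
    (\<exists>l\<in>control_seqs M F. (\<forall>n\<ge>1. AE x in M. \<phi> n (\<lambda>k. mdiff f k x) \<le> l (n - 1) x) \<and>
      lorentz_norm M p q (control_limit l)
        \<le> ennreal C * lorentz_norm M p q (\<lambda>x. gauge_sup \<phi> (\<lambda>k. mdiff f k x))))"
proof -
  define C where "C = norm_factor (osc_const R * R)"
  have C: "0 < C" unfolding C_def using osc_const_pos[OF R] R by (intro norm_factor_pos) simp
  obtain C' where C': "0 < C'" and le: "\<And>G g. level_dominated C 1 2 G g \<Longrightarrow>
      lorentz_norm M p q G \<le> ennreal C' * lorentz_norm M p q g"
    using lorentz_norm_le_of_level_dominated[OF C, of 1 2 q] q by auto
  show ?thesis
  proof (intro exI[of _ C'] conjI allI impI ballI C')
    fix f and \<phi> :: "nat \<Rightarrow> (nat \<Rightarrow> real) \<Rightarrow> real" assume f: "martingale M F f" and \<phi>: "\<phi> \<in> gauges"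
    let ?G = "\<lambda>x. gauge_sup \<phi> (\<lambda>k. mdiff f k x)" and ?Y = "\<lambda>x. SUP n. envelope f \<phi> n x"
    assume fin: "lorentz_norm M p q ?G < \<infinity>"
    have Y: "lorentz_norm M p q ?Y \<le> ennreal C' * lorentz_norm M p q ?G"
    proof (rule le, rule level_dominatedI[OF C])
      fix t :: real assume "0 < t"
      then show "level_norm M p ?Y t \<le> ennreal C * level_norm M p ?G (1 * t)"
        using level_norm_envelope[OF reg R f \<phi>, of t] by (simp add: C_def)
    qed
    also have "\<dots> < \<infinity>" using fin by (simp add: ennreal_mult_less_top)
    finally have Y_fin: "lorentz_norm M p q ?Y < \<infinity>" .
    have [measurable]: "envelope f \<phi> n \<in> borel_measurable M" for n
      by (rule F_measurable[OF envelope_measurable])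
    have "AE x in M. ?Y x < \<infinity>"
      by (rule AE_finite_of_lorentz_norm[OF _ q Y_fin]) measurable
    from real_control[OF envelope_measurable this]
    obtain l where l: "l \<in> control_seqs M F" and lY: "AE x in M. control_limit l x \<le> ?Y x"
      and Vl: "AE x in M. \<forall>n. envelope f \<phi> n x \<le> ennreal (l n x)" by blast
    have "AE x in M. \<phi> n (\<lambda>k. mdiff f k x) \<le> l (n - 1) x" if n: "1 \<le> n" for n
    proof -
      obtain i where i: "n = Suc i" using n by (cases n) auto
      show ?thesis using gauge_le_envelope[OF f \<phi>, of i] Vl AE_space
      proof eventually_elim
        case (elim x)
        have "0 \<le> l i x" using l elim(3) by (auto simp: control_seqs_def)
        moreover have "ennreal (\<phi> (Suc i) (\<lambda>k. mdiff f k x)) \<le> ennreal (l i x)"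
          using elim(1) elim(2)[rule_format, of i] by (rule order_trans)
        ultimately show ?case by (simp add: i ennreal_le_iff)
      qed
    qed
    moreover have "lorentz_norm M p q (control_limit l) \<le> ennreal C' * lorentz_norm M p q ?G"
      using lorentz_norm_mono_AE[OF lY q] Y by (rule order_trans)
    ultimately show "\<exists>l\<in>control_seqs M F. (\<forall>n\<ge>1. AE x in M. \<phi> n (\<lambda>k. mdiff f k x) \<le> l (n - 1) x) \<and>
      lorentz_norm M p q (control_limit l) \<le> ennreal C' * lorentz_norm M p q ?G"
      using l by blast
  qed
qed

text \<open>A difference is constant on an atom, which fills a fixed proportion of the atom of the
  previous level; hence its square is at most \<open>R\<close> times the conditional mean.  The argument separates
  the two sides by rational numbers, so that the constancy is never needed explicitly.\<close>

lemma regular_jump: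
  assumes reg: "regular_with R" and R: "1 \<le> R"
    and f: "martingale M F f"
  shows "AE x in M. ennreal ((mdiff f (Suc n) x)\<^sup>2) \<le> ennreal R * cond_sq f (Suc n) x"
proof -
  let ?d = "mdiff f (Suc n)" and ?Z = "cond_sq f (Suc n)"
  have d [measurable]: "?d \<in> borel_measurable (F (Suc n))" by (rule mdiff_F_measurable[OF f]) simp
  have Z [measurable]: "?Z \<in> borel_measurable (F n)" by (rule cond_sq_F_measurable) simp
  define L where "L r = {x \<in> space M. ennreal R * ?Z x < ennreal r}" for r
  define H where "H r = {x \<in> space M. r < (?d x)\<^sup>2}" for r
  have L: "L r \<in> sets (F n)" for r
  proof -
    have "{x \<in> space (F n). ennreal R * ?Z x < ennreal r} \<in> sets (F n)" by measurable
    then show ?thesis by (simp add: L_def F_space)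
  qed
  have H: "H r \<in> sets (F (Suc n))" for r
  proof -
    have "{x \<in> space (F (Suc n)). r < (?d x)\<^sup>2} \<in> sets (F (Suc n))" by measurable
    then show ?thesis by (simp add: H_def F_space)
  qed
  have LH: "L r \<inter> H s \<in> sets (F (Suc n))" for r s
    using L[of r] H[of s] F_mono[of n "Suc n"] by auto
  have null: "AE x in M. x \<notin> L r \<inter> H s" if rs: "0 < r" "r < s" for r s
  proof -
    obtain J :: "nat \<Rightarrow> 'a set" where J: "space (F n) = (\<Union>i. J i)" "\<And>i. J i \<in> sets (F n)"
      "\<And>i. measure M (J i) = 0 \<or> is_atom M (F n) (J i)"
      using atom_decomposition[OF finite_measure_axioms subalg[of n] atoms[of n] sets.top[of "F n"]] by blast
    have "L r \<inter> H s \<inter> J i \<in> null_sets M" for i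
    proof -
      have AF: "L r \<inter> H s \<inter> J i \<in> sets (F (Suc n))"
        using LH[of r s] J(2)[of i] F_mono[of n "Suc n"] by auto
      let ?A = "L r \<inter> H s \<inter> J i" and ?J = "J i \<inter> L r"
      have AM: "?A \<in> sets M" by (rule F_sets[OF AF])
      have JF: "?J \<in> sets (F n)" using J(2) L by auto
      have JM: "?J \<in> sets M" by (rule F_sets[OF JF])
      have "measure M ?A = 0"
      proof (rule ccontr)
        assume A0: "measure M ?A \<noteq> 0"
        then have Apos: "0 < measure M ?A" using measure_nonneg[of M ?A] by linarith
        also have "measure M ?A \<le> measure M ?J" by (intro finite_measure_mono JM) auto
        finally have Jpos: "measure M ?J \<noteq> 0" by simp
        have "measure M ?J \<le> measure M (J i)" by (intro finite_measure_mono F_sets[OF J(2)]) auto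
        then have "is_atom M (F n) (J i)" using J(3)[of i] Jpos measure_nonneg[of M ?J] by auto
        then have "is_atom M (F n) ?J"
          using Jpos by (intro atom_subset(1)[OF finite_measure_axioms subalg _ JF]) auto
        then have JA: "measure M ?J \<le> R * measure M ?A"
          by (intro regular_atom[OF reg _ AF _ A0]) auto
        have "ennreal (R * (s * measure M ?A)) = ennreal R * (\<integral>\<^sup>+x. ennreal s * indicator ?A x \<partial>M)"
          using rs R by (subst nn_integral_cmult_indicator[OF AM]) (simp add: emeasure_eq_measure ennreal_mult)
        also have "\<dots> \<le> ennreal R * (\<integral>\<^sup>+x. ennreal ((indicator ?J x * ?d x)\<^sup>2) \<partial>M)"
          by (intro mult_left_mono nn_integral_mono)
            (auto simp: indicator_def H_def intro!: ennreal_leI)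
        also have "\<dots> = ennreal R * (\<integral>\<^sup>+x. indicator ?J x * ?Z x \<partial>M)"
          using integral_cond_sq[OF f, of ?J "Suc n"] JF by simp
        also have "\<dots> = (\<integral>\<^sup>+x. ennreal R * (indicator ?J x * ?Z x) \<partial>M)"
          using JM by (intro nn_integral_cmult[symmetric]) auto
        also have "\<dots> \<le> (\<integral>\<^sup>+x. ennreal r * indicator ?J x \<partial>M)"
          by (intro nn_integral_mono) (auto simp: indicator_def L_def)
        also have "\<dots> = ennreal (r * measure M ?J)"
          using rs by (subst nn_integral_cmult_indicator[OF JM]) (simp add: emeasure_eq_measure ennreal_mult)
        also have "\<dots> \<le> ennreal (r * (R * measure M ?A))"
          using rs JA by (intro ennreal_leI mult_left_mono) auto
        finally have "R * (s * measure M ?A) \<le> r * (R * measure M ?A)"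
          using rs R by (subst (asm) ennreal_le_iff) auto
        then have "s * (R * measure M ?A) \<le> r * (R * measure M ?A)" by (simp add: mult_ac)
        moreover have "0 < R * measure M ?A" using R Apos by simp
        ultimately show False using rs by (simp only: mult_le_cancel_right_pos)
      qed
      then show ?thesis using AM by (simp add: null_sets_def emeasure_eq_measure)
    qed
    then have "(\<Union>i. L r \<inter> H s \<inter> J i) \<in> null_sets M" by (intro null_sets_UN) auto
    moreover have "(\<Union>i. L r \<inter> H s \<inter> J i) = L r \<inter> H s"
      using J(1) by (auto simp: L_def F_space)
    ultimately show ?thesis by (metis AE_not_in)
  qed
  have "AE x in M. \<forall>r\<in>\<rat> \<inter> {0<..}. \<forall>s\<in>\<rat> \<inter> {0<..}. r < s \<longrightarrow> x \<notin> L r \<inter> H s"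
    by (intro AE_ball_countable[THEN iffD2] countable_pos_rat ballI) (use null in auto)
  then show ?thesis using AE_space
  proof eventually_elim
    case (elim x)
    show ?case
    proof (rule ccontr)
      assume "\<not> ?case"
      then have lt: "ennreal R * ?Z x < ennreal ((?d x)\<^sup>2)" by simp
      then obtain e where e: "0 \<le> e" "ennreal R * ?Z x = ennreal e"
        by (cases "ennreal R * ?Z x") auto
      then have "e < (?d x)\<^sup>2" using lt by (simp add: ennreal_less_iff)
      then obtain s where s: "s \<in> \<rat>" "e < s" "s < (?d x)\<^sup>2" using Rats_dense_in_real by blast
      then obtain r where r: "r \<in> \<rat>" "e < r" "r < s" using Rats_dense_in_real by blast
      have "x \<in> L r \<inter> H s" using r s e elim(2) by (simp add: L_def H_def ennreal_less_iff)
      moreover have "0 < r" "0 < s" using e r by auto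
      ultimately show False using elim(1) r s by blast
    qed
  qed
qed

lemma regular_square_control:
  assumes reg: "regular_with R" and R: "1 \<le> R" and q: "0 < q"
  shows "\<exists>C>0. \<forall>f. martingale M F f \<longrightarrow> lorentz_norm M p q (cond_square_fn M F f) < \<infinity> \<longrightarrow>
    (\<exists>l\<in>control_seqs M F. (\<forall>n\<ge>1. AE x in M. square_fn_upto f n x \<le> l (n - 1) x) \<and>
      lorentz_norm M p q (control_limit l) \<le> ennreal C * lorentz_norm M p q (cond_square_fn M F f))"
proof -
  have sR: "0 < sqrt R" using R by simp
  obtain C' where C': "0 < C'" and le: "\<And>G g. level_dominated 1 (1 / sqrt R) 2 G g \<Longrightarrow>
      lorentz_norm M p q G \<le> ennreal C' * lorentz_norm M p q g"
    using lorentz_norm_le_of_level_dominated[of 1 "1 / sqrt R" 2 q] q sR by auto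
  show ?thesis
  proof (intro exI[of _ C'] conjI allI impI ballI C')
    fix f assume f: "martingale M F f"
    let ?s = "cond_square_fn M F f"
    assume fin: "lorentz_norm M p q ?s < \<infinity>"
    define V where "V n x = ennreal (sqrt R) * epowr (cond_sq_sum f (Suc n) x) (1 / 2)" for n x
    have V: "V n \<in> borel_measurable (F n)" for n
    proof -
      have "cond_sq_sum f (Suc n) \<in> borel_measurable (F n)" by (rule cond_sq_sum_F_measurable) simp
      then have "(\<lambda>x. epowr (cond_sq_sum f (Suc n) x) (1 / 2)) \<in> borel_measurable (F n)"
        by (rule measurable_compose[OF _ epowr_measurable])
      then show ?thesis unfolding V_def[abs_def] by measurable
    qed
    have V_le: "(SUP n. V n x) \<le> ennreal (sqrt R) * ?s x" for x
      unfolding V_def cond_square_fn_eq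
      by (intro SUP_least mult_left_mono epowr_mono cond_sq_sum_le_suminf) auto
    have "AE x in M. ?s x < \<infinity>"
      by (rule AE_finite_of_lorentz_norm[OF cond_square_fn_measurable q fin])
    then have "AE x in M. (SUP n. V n x) < \<infinity>"
      by eventually_elim (rule le_less_trans[OF V_le], simp add: ennreal_mult_less_top)
    from real_control[OF V this]
    obtain l where l: "l \<in> control_seqs M F" and lV: "AE x in M. control_limit l x \<le> (SUP n. V n x)"
      and Vl: "AE x in M. \<forall>n. V n x \<le> ennreal (l n x)" by blast
    have "AE x in M. ennreal ((mdiff f n x)\<^sup>2) \<le> ennreal R * cond_sq f n x" for n
    proof (cases n)
      case 0
      show ?thesis using cond_sq_0[OF f]
      proof eventually_elim
        case (elim x)
        have "1 * ennreal ((f 0 x)\<^sup>2) \<le> ennreal R * ennreal ((f 0 x)\<^sup>2)"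
          using R by (intro mult_right_mono) auto
        then show ?case using elim by (simp add: 0 mdiff_def)
      qed
    next
      case (Suc i)
      show ?thesis unfolding Suc by (rule regular_jump[OF reg R f])
    qed
    then have jumps: "AE x in M. \<forall>n. ennreal ((mdiff f n x)\<^sup>2) \<le> ennreal R * cond_sq f n x"
      by (simp add: AE_all_countable)
    have "AE x in M. square_fn_upto f n x \<le> l (n - 1) x" if n: "1 \<le> n" for n
    proof -
      obtain i where i: "n = Suc i" using n by (cases n) auto
      show ?thesis using jumps Vl AE_space
      proof eventually_elim
        case (elim x)
        have "ennreal (\<Sum>k\<le>n. (mdiff f k x)\<^sup>2) = (\<Sum>k\<le>n. ennreal ((mdiff f k x)\<^sup>2))"
          by (rule sum_ennreal[symmetric]) simp
        also have "\<dots> \<le> (\<Sum>k\<le>n. ennreal R * cond_sq f k x)" using elim(1) by (intro sum_mono) auto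
        also have "\<dots> = ennreal R * cond_sq_sum f n x" by (simp add: cond_sq_sum_def sum_distrib_left)
        finally have "epowr (ennreal (\<Sum>k\<le>n. (mdiff f k x)\<^sup>2)) (1 / 2) \<le> epowr (ennreal R * cond_sq_sum f n x) (1 / 2)"
          by (rule epowr_mono) simp
        also have "\<dots> = V i x"
          using R by (simp add: epowr_mult epowr_ennreal powr_half_sqrt V_def i)
        also have "epowr (ennreal (\<Sum>k\<le>n. (mdiff f k x)\<^sup>2)) (1 / 2) = ennreal (square_fn_upto f n x)"
          by (simp add: epowr_ennreal powr_half_sqrt sum_nonneg square_fn_upto_def)
        also have "V i x \<le> ennreal (l i x)" using elim(2) by blast
        finally have "ennreal (square_fn_upto f n x) \<le> ennreal (l i x)" .
        moreover have "0 \<le> l i x" using l elim(3) by (auto simp: control_seqs_def)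
        ultimately show ?case by (simp add: i ennreal_le_iff)
      qed
    qed
    moreover have "lorentz_norm M p q (control_limit l) \<le> ennreal C' * lorentz_norm M p q ?s"
    proof (rule le, rule level_dominatedI)
      fix t :: real assume t: "0 < t"
      have "level_norm M p (control_limit l) t \<le> level_norm M p ?s (1 / sqrt R * t)"
        unfolding level_norm_eq
      proof (rule set_norm_mono_AE)
        show "AE x in M. x \<in> {x \<in> space M. ennreal t < control_limit l x}
            \<longrightarrow> x \<in> {x \<in> space M. ennreal (1 / sqrt R * t) < ?s x}"
          using lV
        proof (eventually_elim, intro impI)
          fix x assume lV: "control_limit l x \<le> (SUP n. V n x)"
            and x: "x \<in> {x \<in> space M. ennreal t < control_limit l x}"
          have "ennreal t < ennreal (sqrt R) * ?s x"
            using x lV V_le[of x] by (auto intro: less_le_trans order_trans)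
          moreover have "ennreal (sqrt R) * ennreal (1 / sqrt R * t) = ennreal t"
            using sR t by (simp add: ennreal_mult[symmetric])
          ultimately have "\<not> ?s x \<le> ennreal (1 / sqrt R * t)"
            by (metis mult_left_mono not_le zero_le)
          then show "x \<in> {x \<in> space M. ennreal (1 / sqrt R * t) < ?s x}" using x by simp
        qed
      qed
      then show "level_norm M p (control_limit l) t \<le> ennreal 1 * level_norm M p ?s (1 / sqrt R * t)" by simp
    qed simp
    ultimately show "\<exists>l\<in>control_seqs M F. (\<forall>n\<ge>1. AE x in M. square_fn_upto f n x \<le> l (n - 1) x) \<and>
      lorentz_norm M p q (control_limit l) \<le> ennreal C' * lorentz_norm M p q ?s"
      using l by blast
  qed
qed

end

section \<open>The inequalities between the spaces\<close>

lemma le_mult_INF: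
  fixes y :: ennreal
  assumes C: "0 < C" and le: "\<And>x. x \<in> X \<Longrightarrow> y \<le> ennreal C * N x"
  shows "y \<le> ennreal C * (INF x\<in>X. N x)"
proof -
  have "ennreal (1 / C) * y \<le> (INF x\<in>X. N x)"
  proof (rule INF_greatest)
    fix x assume "x \<in> X"
    then have "ennreal (1 / C) * y \<le> ennreal (1 / C) * (ennreal C * N x)"
      by (intro mult_left_mono le) auto
    also have "\<dots> = N x" using C by (simp add: mult.assoc[symmetric] ennreal_mult[symmetric])
    finally show "ennreal (1 / C) * y \<le> N x" .
  qed
  then have "ennreal C * (ennreal (1 / C) * y) \<le> ennreal C * (INF x\<in>X. N x)"
    by (rule mult_left_mono) auto
  then show ?thesis using C by (simp add: mult.assoc[symmetric] ennreal_mult[symmetric])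
qed

lemma equivalent_onI:
  assumes "0 < C" "0 < C'" "\<And>f. f \<in> X \<Longrightarrow> N f \<le> ennreal C * N' f" "\<And>f. f \<in> X \<Longrightarrow> N' f \<le> ennreal C' * N f"
  shows "equivalent_on X N N'"
  unfolding equivalent_on_def
proof (rule exI[of _ "1 / C"], intro conjI, simp add: assms(1), rule exI[of _ C'], intro conjI ballI)
  fix f assume f: "f \<in> X"
  have "ennreal (1 / C) * N f \<le> ennreal (1 / C) * (ennreal C * N' f)"
    by (intro mult_left_mono assms(3) f) auto
  also have "\<dots> = N' f" using assms(1) by (simp add: mult.assoc[symmetric] ennreal_mult[symmetric])
  finally show "ennreal (1 / C) * N f \<le> N' f" .
  show "N' f \<le> ennreal C' * N f" by (rule assms(4)[OF f])
qed (use assms in auto)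

lemma HM_norm_eq: "HM_norm M p q f = lorentz_norm M p q (\<lambda>x. gauge_sup sum_gauge (\<lambda>k. mdiff f k x))"
  unfolding HM_norm_def maximal_fn_eq[abs_def] ..

lemma HS_norm_eq: "HS_norm M p q f = lorentz_norm M p q (\<lambda>x. gauge_sup square_gauge (\<lambda>k. mdiff f k x))"
  unfolding HS_norm_def square_fn_eq[abs_def] ..

context atomic_filtration
begin

lemma controls_controlled:
  assumes "martingale M F f" and "l \<in> P_controls M F p q f \<union> Q_controls M F p q f"
  shows "controlled f l"
  using assms controlled_of_square_control[OF assms(1), of l] controlled_of_value_control[OF assms(1), of l]
  by (auto simp: P_controls_def Q_controls_def)

text \<open>A gauge that is itself bounded by the control is dominated without a constant; the index \<open>0\<close>,
  which the definition of a control leaves out, is covered by the bound on \<open>f 0\<close>.\<close>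

lemma lorentz_norm_gauge_le_direct:
  assumes q: "0 < q" and \<phi>: "\<phi> \<in> gauges" and ctl: "controlled f l"
    and le: "\<And>n. 1 \<le> n \<Longrightarrow> AE x in M. \<phi> n (\<lambda>k. mdiff f k x) \<le> l (n - 1) x"
  shows "lorentz_norm M p q (\<lambda>x. gauge_sup \<phi> (\<lambda>k. mdiff f k x)) \<le> lorentz_norm M p q (control_limit l)"
proof (rule lorentz_norm_mono_AE[OF _ q])
  have l: "l \<in> control_seqs M F" and f0: "AE x in M. \<bar>f 0 x\<bar> \<le> l 0 x"
    using ctl by (auto simp: controlled_def)
  have "AE x in M. \<phi> n (\<lambda>k. mdiff f k x) \<le> l (n - 1) x" for n
  proof (cases n)
    case 0
    then show ?thesis using f0 by (simp add: gauge_0[OF \<phi>] mdiff_def)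
  next
    case (Suc i)
    then show ?thesis using le[of n] by simp
  qed
  then have "AE x in M. \<forall>n. \<phi> n (\<lambda>k. mdiff f k x) \<le> l (n - 1) x" by (simp add: AE_all_countable)
  then show "AE x in M. gauge_sup \<phi> (\<lambda>k. mdiff f k x) \<le> control_limit l x"
    using AE_space
  proof eventually_elim
    case (elim x)
    show ?case unfolding gauge_sup_def control_limit_eq[OF l elim(2)]
    proof (rule SUP_mono)
      fix n
      show "\<exists>m\<in>UNIV. ennreal (\<phi> n (\<lambda>k. mdiff f k x)) \<le> ennreal (l m x)"
        using elim(1) by (auto intro!: ennreal_leI exI[of _ "n - 1"])
    qed
  qed
qed

lemma HM_le_P_control:
  assumes "0 < q" "martingale M F f" "l \<in> P_controls M F p q f"
  shows "HM_norm M p q f \<le> lorentz_norm M p q (control_limit l)"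
  unfolding HM_norm_eq
  by (rule lorentz_norm_gauge_le_direct)
    (use assms controls_controlled in \<open>auto simp: P_controls_def gauge_mdiff\<close>)

lemma HS_le_Q_control:
  assumes "0 < q" "martingale M F f" "l \<in> Q_controls M F p q f"
  shows "HS_norm M p q f \<le> lorentz_norm M p q (control_limit l)"
  unfolding HS_norm_eq
  by (rule lorentz_norm_gauge_le_direct)
    (use assms controls_controlled in \<open>auto simp: Q_controls_def gauge_mdiff\<close>)

lemma norms_le_control:
  assumes q: "0 < q"
  shows "\<exists>C>0. \<forall>f l. martingale M F f \<longrightarrow> l \<in> P_controls M F p q f \<union> Q_controls M F p q f \<longrightarrow>
    HM_norm M p q f \<le> ennreal C * lorentz_norm M p q (control_limit l) \<and>
    HS_norm M p q f \<le> ennreal C * lorentz_norm M p q (control_limit l) \<and>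
    Hs_norm M F p q f \<le> ennreal C * lorentz_norm M p q (control_limit l)"
proof -
  obtain C where "0 < C" and C: "\<And>f l. martingale M F f \<Longrightarrow> controlled f l \<Longrightarrow>
    (\<forall>\<phi>\<in>gauges. lorentz_norm M p q (\<lambda>x. gauge_sup \<phi> (\<lambda>k. mdiff f k x))
        \<le> ennreal C * lorentz_norm M p q (control_limit l)) \<and>
    lorentz_norm M p q (cond_square_fn M F f) \<le> ennreal C * lorentz_norm M p q (control_limit l)"
    using lorentz_norm_gauge_le_control[OF q] by blast
  have "HM_norm M p q f \<le> ennreal C * lorentz_norm M p q (control_limit l) \<and>
    HS_norm M p q f \<le> ennreal C * lorentz_norm M p q (control_limit l) \<and>
    Hs_norm M F p q f \<le> ennreal C * lorentz_norm M p q (control_limit l)"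
    if "martingale M F f" "l \<in> P_controls M F p q f \<union> Q_controls M F p q f" for f l
    using C[OF that(1) controls_controlled[OF that]]
    unfolding HM_norm_eq HS_norm_eq Hs_norm_def by simp
  then show ?thesis using \<open>0 < C\<close> by blast
qed

lemma exchange_controls:
  assumes q: "0 < q"
  shows "\<exists>C>0. \<forall>f l. martingale M F f \<longrightarrow> l \<in> P_controls M F p q f \<union> Q_controls M F p q f \<longrightarrow>
    (\<exists>l'\<in>P_controls M F p q f. lorentz_norm M p q (control_limit l') \<le> ennreal C * lorentz_norm M p q (control_limit l)) \<and>
    (\<exists>l'\<in>Q_controls M F p q f. lorentz_norm M p q (control_limit l') \<le> ennreal C * lorentz_norm M p q (control_limit l))"
proof -
  obtain C where "0 < C" and C: "\<And>f l \<phi>. martingale M F f \<Longrightarrow> controlled f l \<Longrightarrow> \<phi> \<in> gauges \<Longrightarrow>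
    \<exists>l'\<in>control_seqs M F. (\<forall>n\<ge>1. AE x in M. \<phi> n (\<lambda>k. mdiff f k x) \<le> l' (n - 1) x) \<and>
      lorentz_norm M p q (control_limit l') \<le> ennreal C * lorentz_norm M p q (control_limit l)"
    using gauge_control_of_controlled[OF q] by blast
  show ?thesis
  proof (intro exI[of _ C] conjI allI impI \<open>0 < C\<close>)
    fix f l assume f: "martingale M F f" and l: "l \<in> P_controls M F p q f \<union> Q_controls M F p q f"
    have "lorentz_norm M p q (control_limit l) < \<infinity>" using l by (auto simp: P_controls_def Q_controls_def)
    then have fin: "ennreal C * lorentz_norm M p q (control_limit l) < \<infinity>"
      by (simp add: ennreal_mult_less_top)
    show "\<exists>l'\<in>P_controls M F p q f. lorentz_norm M p q (control_limit l') \<le> ennreal C * lorentz_norm M p q (control_limit l)"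
      using C[OF f controls_controlled[OF f l] sum_gauge_in] fin
      unfolding P_controls_def gauge_mdiff by (auto intro: le_less_trans)
    show "\<exists>l'\<in>Q_controls M F p q f. lorentz_norm M p q (control_limit l') \<le> ennreal C * lorentz_norm M p q (control_limit l)"
      using C[OF f controls_controlled[OF f l] square_gauge_in] fin
      unfolding Q_controls_def gauge_mdiff by (auto intro: le_less_trans)
  qed
qed

lemma P_Q_norm_bounds:
  assumes q: "0 < q"
  shows "\<exists>C>0. \<forall>f. martingale M F f \<longrightarrow> (\<forall>N\<in>{P_norm M F p q f, Q_norm M F p q f}.
    HM_norm M p q f \<le> ennreal C * N \<and> HS_norm M p q f \<le> ennreal C * N \<and>
    Hs_norm M F p q f \<le> ennreal C * N \<and>
    P_norm M F p q f \<le> ennreal C * N \<and> Q_norm M F p q f \<le> ennreal C * N)"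
proof -
  let ?N = "\<lambda>l. lorentz_norm M p q (control_limit l)"
  obtain C1 where C1: "0 < C1" and le: "\<And>f l. martingale M F f \<Longrightarrow>
    l \<in> P_controls M F p q f \<union> Q_controls M F p q f \<Longrightarrow>
    HM_norm M p q f \<le> ennreal C1 * ?N l \<and> HS_norm M p q f \<le> ennreal C1 * ?N l \<and>
    Hs_norm M F p q f \<le> ennreal C1 * ?N l"
    using norms_le_control[OF q] by blast
  obtain C2 where C2: "0 < C2" and ex: "\<And>f l. martingale M F f \<Longrightarrow>
    l \<in> P_controls M F p q f \<union> Q_controls M F p q f \<Longrightarrow>
    (\<exists>l'\<in>P_controls M F p q f. ?N l' \<le> ennreal C2 * ?N l) \<and>
    (\<exists>l'\<in>Q_controls M F p q f. ?N l' \<le> ennreal C2 * ?N l)"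
    using exchange_controls[OF q] by blast
  define C where "C = max C1 C2"
  have C: "0 < C" using C1 by (simp add: C_def)
  have up: "ennreal C1 * y \<le> ennreal C * y" "ennreal C2 * y \<le> ennreal C * y" for y
    unfolding C_def by (intro mult_right_mono ennreal_leI; simp)+
  have "HM_norm M p q f \<le> ennreal C * ?N l \<and> HS_norm M p q f \<le> ennreal C * ?N l \<and>
      Hs_norm M F p q f \<le> ennreal C * ?N l \<and>
      P_norm M F p q f \<le> ennreal C * ?N l \<and> Q_norm M F p q f \<le> ennreal C * ?N l"
    if fl: "martingale M F f" "l \<in> P_controls M F p q f \<union> Q_controls M F p q f" for f l
  proof -
    obtain l1 l2 where l1: "l1 \<in> P_controls M F p q f" "?N l1 \<le> ennreal C2 * ?N l"
      and l2: "l2 \<in> Q_controls M F p q f" "?N l2 \<le> ennreal C2 * ?N l"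
      using ex[OF fl] by blast
    have "P_norm M F p q f \<le> ennreal C2 * ?N l"
      unfolding P_norm_def by (intro INF_lower2[of l1] l1)
    moreover have "Q_norm M F p q f \<le> ennreal C2 * ?N l"
      unfolding Q_norm_def by (intro INF_lower2[of l2] l2)
    ultimately show ?thesis using le[OF fl] up[of "?N l"] by (meson order_trans)
  qed
  note bound = this
  show ?thesis
  proof (intro exI[of _ C] conjI C allI impI ballI)
    fix f N assume f: "martingale M F f" and N: "N \<in> {P_norm M F p q f, Q_norm M F p q f}"
    have all: "y \<le> ennreal C * N" if "\<And>l. l \<in> P_controls M F p q f \<union> Q_controls M F p q f \<Longrightarrow> y \<le> ennreal C * ?N l" for y
      using N that unfolding P_norm_def Q_norm_def by (auto intro!: le_mult_INF[OF C])
    show "HM_norm M p q f \<le> ennreal C * N" "HS_norm M p q f \<le> ennreal C * N"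
      "Hs_norm M F p q f \<le> ennreal C * N" "P_norm M F p q f \<le> ennreal C * N"
      "Q_norm M F p q f \<le> ennreal C * N"
      by (rule all, simp add: bound[OF f])+
  qed
qed

lemma regular_controls:
  assumes reg: "regular_with R" and R: "1 \<le> R" and q: "0 < q"
  shows "\<exists>C>0. \<forall>f. martingale M F f \<longrightarrow>
    (HM_norm M p q f < \<infinity> \<longrightarrow> (\<exists>l\<in>P_controls M F p q f.
      lorentz_norm M p q (control_limit l) \<le> ennreal C * HM_norm M p q f)) \<and>
    (HS_norm M p q f < \<infinity> \<longrightarrow> (\<exists>l\<in>Q_controls M F p q f.
      lorentz_norm M p q (control_limit l) \<le> ennreal C * HS_norm M p q f)) \<and>
    (Hs_norm M F p q f < \<infinity> \<longrightarrow> (\<exists>l\<in>Q_controls M F p q f.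
      lorentz_norm M p q (control_limit l) \<le> ennreal C * Hs_norm M F p q f))"
proof -
  obtain C1 where C1: "0 < C1" and g: "\<And>f \<phi>. martingale M F f \<Longrightarrow> \<phi> \<in> gauges \<Longrightarrow>
    lorentz_norm M p q (\<lambda>x. gauge_sup \<phi> (\<lambda>k. mdiff f k x)) < \<infinity> \<Longrightarrow>
    (\<exists>l\<in>control_seqs M F. (\<forall>n\<ge>1. AE x in M. \<phi> n (\<lambda>k. mdiff f k x) \<le> l (n - 1) x) \<and>
      lorentz_norm M p q (control_limit l)
        \<le> ennreal C1 * lorentz_norm M p q (\<lambda>x. gauge_sup \<phi> (\<lambda>k. mdiff f k x)))"
    using regular_gauge_control[OF reg R q] by blast
  obtain C2 where C2: "0 < C2" and s: "\<And>f. martingale M F f \<Longrightarrow>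
    lorentz_norm M p q (cond_square_fn M F f) < \<infinity> \<Longrightarrow>
    (\<exists>l\<in>control_seqs M F. (\<forall>n\<ge>1. AE x in M. square_fn_upto f n x \<le> l (n - 1) x) \<and>
      lorentz_norm M p q (control_limit l) \<le> ennreal C2 * lorentz_norm M p q (cond_square_fn M F f))"
    using regular_square_control[OF reg R q] by blast
  define C where "C = max C1 C2"
  have C: "ennreal C1 * y \<le> ennreal C * y" "ennreal C2 * y \<le> ennreal C * y" for y
    unfolding C_def by (intro mult_right_mono ennreal_leI; simp)+
  have fin: "y < \<infinity> \<Longrightarrow> ennreal C * y < \<infinity>" for y by (simp add: ennreal_mult_less_top)
  show ?thesis
  proof (intro exI[of _ C] conjI allI impI)
    show "0 < C" using C1 by (simp add: C_def)
    fix f assume f: "martingale M F f"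
    { assume *: "HM_norm M p q f < \<infinity>"
      obtain l where "l \<in> control_seqs M F" "\<And>n. n \<ge> 1 \<Longrightarrow> AE x in M. \<bar>f n x\<bar> \<le> l (n - 1) x"
        "lorentz_norm M p q (control_limit l) \<le> ennreal C1 * HM_norm M p q f"
        using g[OF f sum_gauge_in] * unfolding HM_norm_eq[symmetric] gauge_mdiff by blast
      then show "\<exists>l\<in>P_controls M F p q f. lorentz_norm M p q (control_limit l) \<le> ennreal C * HM_norm M p q f"
        using C(1)[of "HM_norm M p q f"] fin[OF *]
        by (intro bexI[of _ l]) (auto simp: P_controls_def intro: order_trans le_less_trans) }
    { assume *: "HS_norm M p q f < \<infinity>"
      obtain l where "l \<in> control_seqs M F" "\<And>n. n \<ge> 1 \<Longrightarrow> AE x in M. square_fn_upto f n x \<le> l (n - 1) x"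
        "lorentz_norm M p q (control_limit l) \<le> ennreal C1 * HS_norm M p q f"
        using g[OF f square_gauge_in] * unfolding HS_norm_eq[symmetric] gauge_mdiff by blast
      then show "\<exists>l\<in>Q_controls M F p q f. lorentz_norm M p q (control_limit l) \<le> ennreal C * HS_norm M p q f"
        using C(1)[of "HS_norm M p q f"] fin[OF *]
        by (intro bexI[of _ l]) (auto simp: Q_controls_def intro: order_trans le_less_trans) }
    { assume *: "Hs_norm M F p q f < \<infinity>"
      obtain l where "l \<in> control_seqs M F" "\<And>n. n \<ge> 1 \<Longrightarrow> AE x in M. square_fn_upto f n x \<le> l (n - 1) x"
        "lorentz_norm M p q (control_limit l) \<le> ennreal C2 * Hs_norm M F p q f"
        using s[OF f] * unfolding Hs_norm_def[symmetric] by blast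
      then show "\<exists>l\<in>Q_controls M F p q f. lorentz_norm M p q (control_limit l) \<le> ennreal C * Hs_norm M F p q f"
        using C(2)[of "Hs_norm M F p q f"] fin[OF *]
        by (intro bexI[of _ l]) (auto simp: Q_controls_def intro: order_trans le_less_trans) }
  qed
qed

lemma norms_le_conditional:
  assumes "b < 2" and q: "0 < q"
  shows "\<exists>C>0. \<forall>f. martingale M F f \<longrightarrow>
    HM_norm M p q f \<le> ennreal C * Hs_norm M F p q f \<and> HS_norm M p q f \<le> ennreal C * Hs_norm M F p q f"
  using lorentz_norm_gauge_le_cond_square[OF assms]
  unfolding HM_norm_eq HS_norm_eq Hs_norm_def by (meson square_gauge_in sum_gauge_in)

lemma equivalence_of_spaces:
  assumes reg: "regular_with R" and R: "1 \<le> R" and q: "0 < q"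
  shows "HS_space M F p q = Q_space M F p q \<and> Q_space M F p q = P_space M F p q \<and>
        P_space M F p q = HM_space M F p q \<and> HM_space M F p q = Hs_space M F p q \<and>
        equivalent_on (HS_space M F p q) (HS_norm M p q) (Q_norm M F p q) \<and>
        equivalent_on (HS_space M F p q) (Q_norm M F p q) (P_norm M F p q) \<and>
        equivalent_on (HS_space M F p q) (P_norm M F p q) (HM_norm M p q) \<and>
        equivalent_on (HS_space M F p q) (HM_norm M p q) (Hs_norm M F p q)"
proof -
  let ?N = "\<lambda>l. lorentz_norm M p q (control_limit l)"
  obtain C1 where C1: "0 < C1" and le: "\<And>f N. martingale M F f \<Longrightarrow>
    N \<in> {P_norm M F p q f, Q_norm M F p q f} \<Longrightarrow>
    HM_norm M p q f \<le> ennreal C1 * N \<and> HS_norm M p q f \<le> ennreal C1 * N \<and>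
    Hs_norm M F p q f \<le> ennreal C1 * N \<and>
    P_norm M F p q f \<le> ennreal C1 * N \<and> Q_norm M F p q f \<le> ennreal C1 * N"
    using P_Q_norm_bounds[OF q] by blast
  obtain C3 where C3: "0 < C3" and rc: "\<And>f. martingale M F f \<Longrightarrow>
    (HM_norm M p q f < \<infinity> \<longrightarrow> (\<exists>l\<in>P_controls M F p q f. ?N l \<le> ennreal C3 * HM_norm M p q f)) \<and>
    (HS_norm M p q f < \<infinity> \<longrightarrow> (\<exists>l\<in>Q_controls M F p q f. ?N l \<le> ennreal C3 * HS_norm M p q f)) \<and>
    (Hs_norm M F p q f < \<infinity> \<longrightarrow> (\<exists>l\<in>Q_controls M F p q f. ?N l \<le> ennreal C3 * Hs_norm M F p q f))"
    using regular_controls[OF reg R q] by blast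
  have Qn: "Q_norm M F p q f \<le> ?N l" if "l \<in> Q_controls M F p q f" for f l
    unfolding Q_norm_def by (rule INF_lower[OF that])
  have Pn: "P_norm M F p q f \<le> ?N l" if "l \<in> P_controls M F p q f" for f l
    unfolding P_norm_def by (rule INF_lower[OF that])
  have fin: "N < \<infinity>"
    if "l \<in> P_controls M F p q f \<union> Q_controls M F p q f" "martingale M F f"
      "N = HM_norm M p q f \<or> N = HS_norm M p q f \<or> N = Hs_norm M F p q f" for l f N
  proof -
    define N' where "N' = (if l \<in> P_controls M F p q f then P_norm M F p q f else Q_norm M F p q f)"
    have N': "N' \<in> {P_norm M F p q f, Q_norm M F p q f}" "N' \<le> ?N l"
      using that(1) by (auto simp: N'_def intro: Pn Qn)
    have "?N l < \<infinity>" using that(1) by (auto simp: P_controls_def Q_controls_def)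
    then have "N' < \<infinity>" using N'(2) by (rule le_less_trans[rotated])
    then have "ennreal C1 * N' < \<infinity>" by (simp add: ennreal_mult_less_top)
    moreover have "N \<le> ennreal C1 * N'" using le[OF that(2) N'(1)] that(3) by auto
    ultimately show ?thesis by (rule le_less_trans[rotated])
  qed
  have fin': "HM_norm M p q f < \<infinity>" "HS_norm M p q f < \<infinity>" "Hs_norm M F p q f < \<infinity>"
    if "martingale M F f" "l \<in> P_controls M F p q f \<union> Q_controls M F p q f" for l f
    by (rule fin[OF that(2,1)], simp)+
  have Q_P: "Q_controls M F p q f \<noteq> {} \<longleftrightarrow> P_controls M F p q f \<noteq> {}" if f: "martingale M F f" for f
  proof
    assume "Q_controls M F p q f \<noteq> {}"
    then have "HM_norm M p q f < \<infinity>" using fin'(1)[OF f] by blast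
    then show "P_controls M F p q f \<noteq> {}" using rc[OF f] by blast
  next
    assume "P_controls M F p q f \<noteq> {}"
    then have "HS_norm M p q f < \<infinity>" using fin'(2)[OF f] by blast
    then show "Q_controls M F p q f \<noteq> {}" using rc[OF f] by blast
  qed
  have HS: "HS_space M F p q = Q_space M F p q"
    using rc fin' unfolding HS_space_def Q_space_def by blast
  have QP: "Q_space M F p q = P_space M F p q"
    unfolding Q_space_def P_space_def using Q_P by blast
  have HM: "P_space M F p q = HM_space M F p q"
    using rc fin' unfolding HM_space_def P_space_def by blast
  have Hs: "HM_space M F p q = Hs_space M F p q"
  proof -
    have "Q_space M F p q = Hs_space M F p q"
      using rc fin' unfolding Hs_space_def Q_space_def by blast
    then show ?thesis using QP HM by simp
  qed
  have space: "martingale M F f" "HM_norm M p q f < \<infinity>" "HS_norm M p q f < \<infinity>" "Hs_norm M F p q f < \<infinity>"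
    if "f \<in> HS_space M F p q" for f
    using that HS QP HM Hs by (auto simp: HS_space_def HM_space_def Hs_space_def set_eq_iff)
  have HS_Q: "HS_norm M p q f \<le> ennreal C1 * Q_norm M F p q f"
    and HM_P: "HM_norm M p q f \<le> ennreal C1 * P_norm M F p q f"
    and Hs_P: "Hs_norm M F p q f \<le> ennreal C1 * P_norm M F p q f"
    and P_Q: "P_norm M F p q f \<le> ennreal C1 * Q_norm M F p q f"
    and Q_P': "Q_norm M F p q f \<le> ennreal C1 * P_norm M F p q f"
    if "martingale M F f" for f
    using le[OF that, of "P_norm M F p q f"] le[OF that, of "Q_norm M F p q f"] by auto
  have Q_HS: "Q_norm M F p q f \<le> ennreal C3 * HS_norm M p q f"
    and Q_Hs: "Q_norm M F p q f \<le> ennreal C3 * Hs_norm M F p q f"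
    and P_HM: "P_norm M F p q f \<le> ennreal C3 * HM_norm M p q f" if "f \<in> HS_space M F p q" for f
    using rc[OF space(1)[OF that]] space[OF that] Qn Pn by (meson order_trans)+
  have mult: "x \<le> ennreal (A * B) * z" if "x \<le> ennreal A * y" "y \<le> ennreal B * z" "0 < A" "0 < B" for x y z A B
  proof -
    have "x \<le> ennreal A * (ennreal B * z)" using that by (meson mult_left_mono order_trans zero_le)
    then show ?thesis using that by (simp add: ennreal_mult mult.assoc)
  qed
  have "equivalent_on (HS_space M F p q) (HS_norm M p q) (Q_norm M F p q)"
    by (rule equivalent_onI[OF C1 C3 HS_Q Q_HS]) (use space in auto)
  moreover have "equivalent_on (HS_space M F p q) (Q_norm M F p q) (P_norm M F p q)"
    by (rule equivalent_onI[OF C1 C1 Q_P' P_Q]) (use space in auto)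
  moreover have "equivalent_on (HS_space M F p q) (P_norm M F p q) (HM_norm M p q)"
    by (rule equivalent_onI[OF C3 C1 P_HM HM_P]) (use space in auto)
  moreover have "equivalent_on (HS_space M F p q) (HM_norm M p q) (Hs_norm M F p q)"
  proof (rule equivalent_onI)
    fix f assume f: "f \<in> HS_space M F p q"
    show "HM_norm M p q f \<le> ennreal (C1 * (C1 * C3)) * Hs_norm M F p q f"
      using C1 C3 by (intro mult[OF HM_P[OF space(1)[OF f]]] mult[OF P_Q[OF space(1)[OF f]] Q_Hs[OF f]]) auto
    show "Hs_norm M F p q f \<le> ennreal (C1 * C3) * HM_norm M p q f"
      using C1 C3 by (intro mult[OF Hs_P[OF space(1)[OF f]] P_HM[OF f]]) auto
  qed (use C1 C3 in auto)
  ultimately show ?thesis using HS QP HM Hs by blast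
qed

end

section \<open>Essential bounds of the exponent\<close>

lemma AE_essential_bounds:
  assumes "A \<in> sets M"
  shows "AE x in M. x \<in> A \<longrightarrow> p_minus M p A \<le> ereal (p x) \<and> ereal (p x) \<le> p_plus M p A"
proof -
  have sp: "A \<inter> space M \<in> sets M" using assms by auto
  have "AE x in restrict_space M A. ereal (p x) \<le> p_plus M p A"
    "AE x in restrict_space M A. - ereal (p x) \<le> - p_minus M p A"
    unfolding p_plus_def p_minus_def ereal_uminus_uminus by (rule esssup_AE)+
  then have "AE x in M. x \<in> A \<longrightarrow> ereal (p x) \<le> p_plus M p A"
    "AE x in M. x \<in> A \<longrightarrow> - ereal (p x) \<le> - p_minus M p A"
    unfolding AE_restrict_space_iff[OF sp] by auto
  then show ?thesis by eventually_elim (simp only: ereal_minus_le_minus, blast)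
qed

lemma essential_bounds_mono:
  assumes p [measurable]: "p \<in> borel_measurable M" and A: "A \<in> sets M"
  shows "p_plus M p A \<le> p_plus M p (space M)" "p_minus M p (space M) \<le> p_minus M p A"
proof -
  have sp: "A \<inter> space M \<in> sets M" using A by auto
  have bounds: "AE x in M. p_minus M p (space M) \<le> ereal (p x) \<and> ereal (p x) \<le> p_plus M p (space M)"
    using AE_essential_bounds[OF sets.top, of M p] AE_space by eventually_elim auto
  have boundsA: "AE x in restrict_space M A. p_minus M p (space M) \<le> ereal (p x) \<and> ereal (p x) \<le> p_plus M p (space M)"
    unfolding AE_restrict_space_iff[OF sp] using bounds by eventually_elim simp
  have pA: "p \<in> borel_measurable (restrict_space M A)" by (rule measurable_restrict_space1[OF p])
  show "p_plus M p A \<le> p_plus M p (space M)"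
    unfolding p_plus_def[of M p A]
  proof (rule esssup_I)
    show "(\<lambda>x. ereal (p x)) \<in> borel_measurable (restrict_space M A)" using pA by measurable
    show "AE x in restrict_space M A. ereal (p x) \<le> p_plus M p (space M)"
      using boundsA by eventually_elim simp
  qed
  have "esssup (restrict_space M A) (\<lambda>x. - ereal (p x)) \<le> - p_minus M p (space M)"
  proof (rule esssup_I)
    show "(\<lambda>x. - ereal (p x)) \<in> borel_measurable (restrict_space M A)" using pA by measurable
    show "AE x in restrict_space M A. - ereal (p x) \<le> - p_minus M p (space M)"
      using boundsA by eventually_elim (simp only: ereal_minus_le_minus simp_thms)
  qed
  then have "- (- p_minus M p (space M)) \<le> p_minus M p A"
    unfolding p_minus_def[of M p A] by (simp only: ereal_minus_le_minus)
  then show "p_minus M p (space M) \<le> p_minus M p A" by simp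
qed

lemma essential_bounds_le:
  assumes "prob_space M" "A \<in> sets M" "measure M A \<noteq> 0"
  shows "p_minus M p A \<le> p_plus M p A"
proof (rule ccontr)
  interpret prob_space M by fact
  assume neg: "\<not> ?thesis"
  have "AE x in M. x \<notin> A"
    using AE_essential_bounds[OF assms(2), of p] neg by (auto elim!: eventually_mono)
  then have "A \<in> null_sets M" using assms(2) by (subst (asm) AE_iff_null_sets[symmetric]) auto
  then show False using assms(3) by (simp add: null_sets_def measure_def)
qed

theorem theorem4p11:
  fixes M :: "'a measure" and F :: "nat \<Rightarrow> 'a measure"
    and p :: "'a \<Rightarrow> real" and q :: ennreal and K :: real
  assumes "prob_space M" and "complete_measure M"
    and "filtration (space M) F" and "\<And>n. subalgebra M (F n)"
    and "filtration_generates M F"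
    and "\<And>n. generated_by_countably_many_atoms M (F n)"
    and "p \<in> borel_measurable M" and "\<And>x. x \<in> space M \<Longrightarrow> 0 < p x"
    and "0 < p_minus M p (space M)" and "p_plus M p (space M) < \<infinity>"
    and "1 \<le> K"
    and "\<And>n A. is_atom M (F n) A \<Longrightarrow>
           measure M A powr real_of_ereal (p_minus M p A - p_plus M p A) \<le> K"
    and "0 < q"
  shows
    "(p_plus M p (space M) < 2 \<longrightarrow>
        (\<exists>C>0. \<forall>f\<in>Hs_space M F p q. HM_norm M p q f \<le> ennreal C * Hs_norm M F p q f) \<and>
        (\<exists>C>0. \<forall>f\<in>Hs_space M F p q. HS_norm M p q f \<le> ennreal C * Hs_norm M F p q f)) \<and>
     (\<forall>f\<in>P_space M F p q. HM_norm M p q f \<le> P_norm M F p q f) \<and>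
     (\<forall>f\<in>Q_space M F p q. HS_norm M p q f \<le> Q_norm M F p q f) \<and>
     (\<exists>C>0. \<forall>f\<in>P_space M F p q. HS_norm M p q f \<le> ennreal C * P_norm M F p q f) \<and>
     (\<exists>C>0. \<forall>f\<in>Q_space M F p q. HM_norm M p q f \<le> ennreal C * Q_norm M F p q f) \<and>
     (\<exists>C>0. \<forall>f\<in>P_space M F p q. Hs_norm M F p q f \<le> ennreal C * P_norm M F p q f) \<and>
     (\<exists>C>0. \<forall>f\<in>Q_space M F p q. Hs_norm M F p q f \<le> ennreal C * Q_norm M F p q f) \<and>
     (\<exists>C>0. \<forall>f\<in>Q_space M F p q. P_norm M F p q f \<le> ennreal C * Q_norm M F p q f) \<and>
     (\<exists>C>0. \<forall>f\<in>P_space M F p q. Q_norm M F p q f \<le> ennreal C * P_norm M F p q f) \<and>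
     (regular_filtration M F \<longrightarrow>
        HS_space M F p q = Q_space M F p q \<and> Q_space M F p q = P_space M F p q \<and>
        P_space M F p q = HM_space M F p q \<and> HM_space M F p q = Hs_space M F p q \<and>
        equivalent_on (HS_space M F p q) (HS_norm M p q) (Q_norm M F p q) \<and>
        equivalent_on (HS_space M F p q) (Q_norm M F p q) (P_norm M F p q) \<and>
        equivalent_on (HS_space M F p q) (P_norm M F p q) (HM_norm M p q) \<and>
        equivalent_on (HS_space M F p q) (HM_norm M p q) (Hs_norm M F p q))"
proof -
  note q = assms(13)
  interpret prob_space M by fact
  define a where "a = real_of_ereal (p_minus M p (space M))"
  define b where "b = real_of_ereal (p_plus M p (space M))"
  have pm_pp: "p_minus M p (space M) \<le> p_plus M p (space M)"
    by (rule essential_bounds_le) (use assms(1) prob_space in auto)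
  have a: "p_minus M p (space M) = ereal a"
    unfolding a_def using assms(9,10) pm_pp by (cases "p_minus M p (space M)") auto
  have b: "p_plus M p (space M) = ereal b"
    unfolding b_def using assms(9,10) pm_pp by (cases "p_plus M p (space M)") auto
  interpret atomic_filtration M p a b F K
  proof
    show "p \<in> borel_measurable M" by fact
    show "0 < a" using assms(9) unfolding a by simp
    show "AE x in M. a \<le> p x \<and> p x \<le> b"
      using AE_essential_bounds[OF sets.top, of M p] AE_space
      by eventually_elim (simp add: a b)
    show "subalgebra M (F n)" for n by fact
    show "sets (F m) \<subseteq> sets (F n)" if "m \<le> n" for m n
      using filtration.sets_F_mono[OF assms(3) that] .
    show "generated_by_countably_many_atoms M (F n)" for n by fact
    show "1 \<le> K" by fact
  next
    fix n A assume at: "is_atom M (F n) A"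
    have A: "A \<in> sets M" using at assms(4)[of n] by (auto simp: is_atom_def subalgebra_def)
    have le: "p_minus M p A \<le> p_plus M p A"
      by (rule essential_bounds_le[OF assms(1) A]) (use at in \<open>simp add: is_atom_def\<close>)
    note mono = essential_bounds_mono[OF assms(7) A]
    obtain \<alpha> where \<alpha>: "p_minus M p A = ereal \<alpha>"
      using mono le by (cases "p_minus M p A") (auto simp: a b)
    obtain \<beta> where \<beta>: "p_plus M p A = ereal \<beta>"
      using mono le by (cases "p_plus M p A") (auto simp: a b)
    show "\<exists>\<alpha> \<beta>. a \<le> \<alpha> \<and> \<alpha> \<le> \<beta> \<and> \<beta> \<le> b \<and>
        (AE x in M. x \<in> A \<longrightarrow> \<alpha> \<le> p x \<and> p x \<le> \<beta>) \<and> measure M A powr (\<alpha> - \<beta>) \<le> K"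
      using mono le AE_essential_bounds[OF A, of p] assms(12)[OF at]
      by (intro exI[of _ \<alpha>] exI[of _ \<beta>]) (simp add: a b \<alpha> \<beta>)
  qed
  obtain C where C: "0 < C" and le: "\<And>f N. martingale M F f \<Longrightarrow>
    N \<in> {P_norm M F p q f, Q_norm M F p q f} \<Longrightarrow>
    HM_norm M p q f \<le> ennreal C * N \<and> HS_norm M p q f \<le> ennreal C * N \<and>
    Hs_norm M F p q f \<le> ennreal C * N \<and>
    P_norm M F p q f \<le> ennreal C * N \<and> Q_norm M F p q f \<le> ennreal C * N"
    using P_Q_norm_bounds[OF q] by blast
  have P_mart: "martingale M F f" if "f \<in> P_space M F p q" for f using that by (simp add: P_space_def)
  have Q_mart: "martingale M F f" if "f \<in> Q_space M F p q" for f using that by (simp add: Q_space_def)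
  have part1: "(\<exists>C>0. \<forall>f\<in>Hs_space M F p q. HM_norm M p q f \<le> ennreal C * Hs_norm M F p q f) \<and>
        (\<exists>C>0. \<forall>f\<in>Hs_space M F p q. HS_norm M p q f \<le> ennreal C * Hs_norm M F p q f)"
    if "p_plus M p (space M) < 2"
  proof -
    have "b < 2" using that unfolding b by simp
    then obtain C where "0 < C" "\<And>f. martingale M F f \<Longrightarrow>
      HM_norm M p q f \<le> ennreal C * Hs_norm M F p q f \<and> HS_norm M p q f \<le> ennreal C * Hs_norm M F p q f"
      using norms_le_conditional q by blast
    then show ?thesis unfolding Hs_space_def by blast
  qed
  have part2: "\<forall>f\<in>P_space M F p q. HM_norm M p q f \<le> P_norm M F p q f"
    "\<forall>f\<in>Q_space M F p q. HS_norm M p q f \<le> Q_norm M F p q f"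
    unfolding P_norm_def Q_norm_def
    using HM_le_P_control[OF q] HS_le_Q_control[OF q] P_mart Q_mart by (auto intro!: INF_greatest)
  have part3: "\<forall>f\<in>P_space M F p q. HS_norm M p q f \<le> ennreal C * P_norm M F p q f"
    "\<forall>f\<in>Q_space M F p q. HM_norm M p q f \<le> ennreal C * Q_norm M F p q f"
    and part4: "\<forall>f\<in>P_space M F p q. Hs_norm M F p q f \<le> ennreal C * P_norm M F p q f"
    "\<forall>f\<in>Q_space M F p q. Hs_norm M F p q f \<le> ennreal C * Q_norm M F p q f"
    and part5: "\<forall>f\<in>Q_space M F p q. P_norm M F p q f \<le> ennreal C * Q_norm M F p q f"
    "\<forall>f\<in>P_space M F p q. Q_norm M F p q f \<le> ennreal C * P_norm M F p q f"
    using le P_mart Q_mart by auto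
  have regular: "\<exists>R\<ge>1. regular_with R" if reg: "regular_filtration M F"
  proof -
    obtain R where R: "\<And>n A. 1 \<le> n \<Longrightarrow> A \<in> sets (F n) \<Longrightarrow> \<exists>B\<in>sets (F (n - 1)).
        A \<subseteq> B \<and> measure M B \<le> R * measure M A"
      using reg unfolding regular_filtration_def by blast
    have "R * measure M A \<le> max R 1 * measure M A" for A by (intro mult_right_mono) auto
    then have "regular_with (max R 1)"
      unfolding regular_with_def using R by (meson order_trans)
    then show ?thesis by (intro exI[of _ "max R 1"]) auto
  qed
  show ?thesis
  proof (intro conjI impI)
    assume "regular_filtration M F"
    then obtain R where R: "1 \<le> R" "regular_with R" using regular by blast
    note eq = equivalence_of_spaces[OF R(2,1) q]
    show "HS_space M F p q = Q_space M F p q" "Q_space M F p q = P_space M F p q"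
      "P_space M F p q = HM_space M F p q" "HM_space M F p q = Hs_space M F p q"
      "equivalent_on (HS_space M F p q) (HS_norm M p q) (Q_norm M F p q)"
      "equivalent_on (HS_space M F p q) (Q_norm M F p q) (P_norm M F p q)"
      "equivalent_on (HS_space M F p q) (P_norm M F p q) (HM_norm M p q)"
      "equivalent_on (HS_space M F p q) (HM_norm M p q) (Hs_norm M F p q)"
      using eq by - (elim conjE, assumption)+
  qed (use part1 part2 in \<open>simp_all\<close>, (rule exI, rule conjI[OF C], rule part3 part4 part5)+)
qed

end
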